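(* Let $1<\beta_1<\beta_2$, let $\alpha_{cr}=\frac{\beta_1-1}{\beta_2-1}$, and let $\zeta(t)=(\zeta_1(t),\zeta_2(t))$ be the balls-in-bins model with reflection in the domain $Q_{\varphi,\psi}$, where $\varphi(x)=x^{\alpha}$ and $\psi(x)=x^{\gamma}$ for some $\alpha,\gamma$ with $0<\alpha<\alpha_{cr}<\gamma$. Then for any initial state $\zeta(0)=\zeta\in Q_{\varphi,\psi}$ (from which the chain is well defined) there exist integers $k_1=k_1(\alpha,\beta_1,\beta_2)$ and $k_2=k_2(\gamma,\beta_1,\beta_2)$ such that $$\mathsf{P}_{\zeta}(A_{\alpha,k_1})+\mathsf{P}_{\zeta}(B_{\gamma})=1\quad\text{if }\alpha_{cr}<\gamma<1,$$ $$\mathsf{P}_{\zeta}(A_{\alpha,k_1})+\mathsf{P}_{\zeta}(E_{k_2})=1\quad\text{if }\gamma=1,$$ $$\mathsf{P}_{\zeta}(A_{\alpha,k_1})+\mathsf{P}_{\zeta}(\widetilde A_{\gamma,k_2})=1\quad\text{if }\gamma>1,$$ where $k_1$ and $k_2$ are the integer solutions of the inequalities $$\frac{\alpha}{(\beta_2-1)(\alpha_{cr}-\alpha)}<k_1\leq1+\frac{\alpha}{(\beta_2-1)(\alpha_{cr}-\alpha)},$$ $$\frac{1}{(\beta_2-1)(\gamma-\alpha_{cr})}<k_2\leq1+\frac{1}{(\beta_2-1)(\gamma-\alpha_{cr})}.$$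
   Context: $\mathbb{N}=\{1,2,\dots\}$. For increasing functions $\varphi,\psi$, $Q_{\varphi,\psi}=\{(x,y)\in\mathbb{N}^2:\varphi(x)\leq y\leq\psi(x)\}$. The balls-in-bins model with reflection in $Q_{\varphi,\psi}$ with parameters $\beta_1,\beta_2>0$ is the discrete time Markov chain $\zeta(t)=(\zeta_1(t),\zeta_2(t))\in Q_{\varphi,\psi}$, $t\in\{0,1,2,\dots\}$, with the following transitions from a state $(x,y)$: (i) if $\varphi(x+1)\leq y\leq\psi(x)-1$, it moves to $(x+1,y)$ with probability $\frac{x^{\beta_1}}{x^{\beta_1}+y^{\beta_2}}$ and to $(x,y+1)$ with probability $\frac{y^{\beta_2}}{x^{\beta_1}+y^{\beta_2}}$; (ii) if $\varphi(x)\leq y<\varphi(x+1)$, it moves to $(x,y+1)$ with probability 1 (reflection by the lower boundary); (iii) if $\psi(x)-1<y\leq\psi(x)$, it moves to $(x+1,y)$ with probability 1 (reflection by the upper boundary). The chain is well defined from an initial state if no state satisfying the conditions of both (ii) and (iii) is reachable from it (the initial state itself included). $\mathsf{P}_\zeta$ is the distribution of the chain started at $\zeta$; "i.o." means for infinitely many $t$. Events ($k\in\mathbb{N}$): for $\alpha\in(0,1)$, $$A_{\alpha,k}=\Big\{\limsup_{t\to\infty}(\zeta_2(t)-\zeta_1^{\alpha}(t))=k\Big\}\cap\Big\{\liminf_{t\to\infty}(\zeta_2(t)-\zeta_1^{\alpha}(t))=0\Big\};$$ for $\gamma\geq1$, $$\widetilde A_{\gamma,k}=\Big\{\limsup_{t\to\infty}(\zeta_1(t)-\zeta_2^{1/\gamma}(t))=k\Big\}\cap\Big\{\liminf_{t\to\infty}(\zeta_1(t)-\zeta_2^{1/\gamma}(t))=0\Big\};$$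 $$E_k=\Big\{\limsup_{t\to\infty}(\zeta_1(t)-\zeta_2(t))=k\Big\}\cap\{\zeta_1(t)-\zeta_2(t)=0\text{ i.o.}\}\cap\{\zeta_1(t)-\zeta_2(t)=k\text{ i.o.}\};$$ for $\gamma\in(0,1)$, $$B_\gamma=\Big\{\limsup_{t\to\infty}(\zeta_1^{\gamma}(t)-\zeta_2(t))=1\Big\}\cap\Big\{\liminf_{t\to\infty}(\zeta_1^{\gamma}(t)-\zeta_2(t))=0\Big\}.$$ *)

theory Defs
  imports "HOL-Probability.Probability"
begin

type_synonym state = "nat \<times> nat"

text \<open>The naturals of the model start at 1.\<close>

definition Q_dom :: "(nat \<Rightarrow> real) \<Rightarrow> (nat \<Rightarrow> real) \<Rightarrow> state set" where
  "Q_dom \<phi> \<psi> = {(x, y). 1 \<le> x \<and> 1 \<le> y \<and> \<phi> x \<le> real y \<and> real y \<le> \<psi> x}"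

definition interior_state :: "(nat \<Rightarrow> real) \<Rightarrow> (nat \<Rightarrow> real) \<Rightarrow> state \<Rightarrow> bool" where
  "interior_state \<phi> \<psi> = (\<lambda>(x, y). \<phi> (x + 1) \<le> real y \<and> real y \<le> \<psi> x - 1)"

definition lower_reflecting :: "(nat \<Rightarrow> real) \<Rightarrow> state \<Rightarrow> bool" where
  "lower_reflecting \<phi> = (\<lambda>(x, y). \<phi> x \<le> real y \<and> real y < \<phi> (x + 1))"

definition upper_reflecting :: "(nat \<Rightarrow> real) \<Rightarrow> state \<Rightarrow> bool" where
  "upper_reflecting \<psi> = (\<lambda>(x, y). \<psi> x - 1 < real y \<and> real y \<le> \<psi> x)"

text \<open>
  Every state of \<open>Q_dom \<phi> \<psi>\<close> satisfies at least one of the three conditions, and only the two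
  reflecting ones can overlap. The value of the kernel on such an overlap (here: move up) and
  outside the domain (here: stay) is a dummy, irrelevant for chains that are well defined in the
  sense of \<open>well_defined_from\<close>.
\<close>

definition kernel ::
  "(nat \<Rightarrow> real) \<Rightarrow> (nat \<Rightarrow> real) \<Rightarrow> real \<Rightarrow> real \<Rightarrow> state \<Rightarrow> state pmf" where
  "kernel \<phi> \<psi> \<beta>1 \<beta>2 = (\<lambda>(x, y).
     if interior_state \<phi> \<psi> (x, y) then
       map_pmf (\<lambda>right. if right then (x + 1, y) else (x, y + 1))
         (bernoulli_pmf (real x powr \<beta>1 / (real x powr \<beta>1 + real y powr \<beta>2)))
     else if lower_reflecting \<phi> (x, y) then return_pmf (x, y + 1)
     else if upper_reflecting \<psi> (x, y) then return_pmf (x + 1, y)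
     else return_pmf (x, y))"

text \<open>
  A path that meets a state with conflicting reflections follows the genuine transitions up to
  its first such state, so the dummy value of the kernel does not affect this notion.
\<close>

definition well_defined_from ::
  "(nat \<Rightarrow> real) \<Rightarrow> (nat \<Rightarrow> real) \<Rightarrow> real \<Rightarrow> real \<Rightarrow> state \<Rightarrow> bool" where
  "well_defined_from \<phi> \<psi> \<beta>1 \<beta>2 z \<longleftrightarrow>
     (\<forall>s. (z, s) \<in> {(u, v). v \<in> set_pmf (kernel \<phi> \<psi> \<beta>1 \<beta>2 u)}\<^sup>* \<longrightarrow>
        \<not> (lower_reflecting \<phi> s \<and> upper_reflecting \<psi> s))"

definition markov_chain_from ::
  "'a measure \<Rightarrow> ('s \<Rightarrow> 's pmf) \<Rightarrow> 's \<Rightarrow> (nat \<Rightarrow> 'a \<Rightarrow> 's) \<Rightarrow> bool" where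
  "markov_chain_from M K z Z \<longleftrightarrow>
     prob_space M \<and>
     (\<forall>t. Z t \<in> measurable M (count_space UNIV)) \<and>
     (AE \<omega> in M. Z 0 \<omega> = z) \<and>
     (\<forall>t s. \<P>(\<omega> in M. \<forall>i\<le>t. Z i \<omega> = s i) \<noteq> 0 \<longrightarrow>
        \<P>(\<omega> in M. Z (Suc t) \<omega> = s (Suc t) \<bar> \<forall>i\<le>t. Z i \<omega> = s i) = pmf (K (s t)) (s (Suc t)))"

text \<open>
  \<open>Z\<close> is a realisation, on the probability space \<open>M\<close>, of the balls-in-bins model with reflection
  started at \<open>z\<close>.
\<close>

definition balls_in_bins ::
  "'a measure \<Rightarrow> (nat \<Rightarrow> real) \<Rightarrow> (nat \<Rightarrow> real) \<Rightarrow> real \<Rightarrow> real \<Rightarrow> state \<Rightarrow>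
   (nat \<Rightarrow> 'a \<Rightarrow> state) \<Rightarrow> bool" where
  "balls_in_bins M \<phi> \<psi> \<beta>1 \<beta>2 z Z \<longleftrightarrow>
     z \<in> Q_dom \<phi> \<psi> \<and> well_defined_from \<phi> \<psi> \<beta>1 \<beta>2 z \<and>
     markov_chain_from M (kernel \<phi> \<psi> \<beta>1 \<beta>2) z Z"

text \<open>
  The events are sets of trajectories; upper and lower limits are taken in the extended reals, so
  that they always exist. \<open>At_event\<close> is the event written with a tilde over A.
\<close>

definition A_event :: "real \<Rightarrow> int \<Rightarrow> (nat \<Rightarrow> state) set" where
  "A_event \<alpha> k = {\<zeta>.
     limsup (\<lambda>t. ereal (real (snd (\<zeta> t)) - real (fst (\<zeta> t)) powr \<alpha>)) = ereal (of_int k) \<and>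
     liminf (\<lambda>t. ereal (real (snd (\<zeta> t)) - real (fst (\<zeta> t)) powr \<alpha>)) = 0}"

definition At_event :: "real \<Rightarrow> int \<Rightarrow> (nat \<Rightarrow> state) set" where
  "At_event \<gamma> k = {\<zeta>.
     limsup (\<lambda>t. ereal (real (fst (\<zeta> t)) - real (snd (\<zeta> t)) powr (1 / \<gamma>))) = ereal (of_int k) \<and>
     liminf (\<lambda>t. ereal (real (fst (\<zeta> t)) - real (snd (\<zeta> t)) powr (1 / \<gamma>))) = 0}"

definition E_event :: "int \<Rightarrow> (nat \<Rightarrow> state) set" where
  "E_event k = {\<zeta>.
     limsup (\<lambda>t. ereal (real (fst (\<zeta> t)) - real (snd (\<zeta> t)))) = ereal (of_int k) \<and>
     (\<exists>\<^sub>F t in sequentially. int (fst (\<zeta> t)) - int (snd (\<zeta> t)) = 0) \<and>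
     (\<exists>\<^sub>F t in sequentially. int (fst (\<zeta> t)) - int (snd (\<zeta> t)) = k)}"

definition B_event :: "real \<Rightarrow> (nat \<Rightarrow> state) set" where
  "B_event \<gamma> = {\<zeta>.
     limsup (\<lambda>t. ereal (real (fst (\<zeta> t)) powr \<gamma> - real (snd (\<zeta> t)))) = 1 \<and>
     liminf (\<lambda>t. ereal (real (fst (\<zeta> t)) powr \<gamma> - real (snd (\<zeta> t)))) = 0}"

definition alpha_cr :: "real \<Rightarrow> real \<Rightarrow> real" where
  "alpha_cr \<beta>1 \<beta>2 = (\<beta>1 - 1) / (\<beta>2 - 1)"

end

theory Submission
  imports Defs "HOL-Real_Asymp.Real_Asymp"
begin

text \<open>
  Two facts drive the proof: almost surely the walk is reflected infinitely often, and once it keeps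
  being reflected by a boundary it never gets far from it again.

  For the first, compare the walk with two independent pure birth processes of rates
  \<open>x powr \<beta>1\<close> and \<open>y powr \<beta>2\<close>. Both explode in finite time, and the first two conditional
  moments of the difference of the explosion times are martingales of the walk between reflections.
  Without reflection both would tend to 0, which a fourth-moment bound excludes with probability at
  least 1 / 19 from every state (\<open>interior_hit_prob\<close>). A zero-one law turns this into infinitely
  many reflections (\<open>AE_frequently_reflected\<close>).

  For the second, take the lower boundary \<open>y = x powr \<alpha>\<close> with \<open>\<alpha> \<le> 1\<close>. After a reflection at
  level n the walk is at distance about 1 from it and drifts to the right until it is reflected
  again. On the way it may make extra ups, each of which costs a factor \<open>n powr - \<delta>\<close>. By the
  Borel-Cantelli lemmas, j extra ups in one excursion happen infinitely often if and only if the
  series of \<open>n powr - (j * \<delta>)\<close> diverges, that is \<open>j * \<delta> \<le> 1\<close> (\<open>AE_few_ups\<close>,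
  \<open>AE_many_ups\<close>). Hence the distance oscillates between 0 and 1 + j for the largest such j, and
  \<open>1 / \<delta>\<close> is the quantity in the inequality for k1.

  An upper boundary \<open>y = x powr \<gamma>\<close> with \<open>\<gamma> \<ge> 1\<close> becomes such a lower boundary when the
  coordinates are exchanged (\<open>swapped\<close>), which gives k2. For \<open>\<gamma> < 1\<close> the boundary rises by less
  than one unit per column, while an up is made long before the walk has fallen appreciably more than
  1 below it (\<open>AE_upper\<close>). So the distance oscillates between 0 and 1.
\<close>

section \<open>The Markov property\<close>

definition hist :: "(nat \<Rightarrow> 'a \<Rightarrow> 's) \<Rightarrow> nat \<Rightarrow> 'a \<Rightarrow> 's list" where
  "hist Z t \<omega> = map (\<lambda>i. Z i \<omega>) [0..<Suc t]"

lemma hist_Suc: "hist Z (Suc t) \<omega> = hist Z t \<omega> @ [Z (Suc t) \<omega>]"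
  by (simp add: hist_def)

lemma last_hist [simp]: "last (hist Z t \<omega>) = Z t \<omega>"
  by (simp add: hist_def)

lemma length_hist [simp]: "length (hist Z t \<omega>) = Suc t"
  by (simp add: hist_def)

lemma hist_nth: "i \<le> t \<Longrightarrow> hist Z t \<omega> ! i = Z i \<omega>"
  unfolding hist_def by (subst nth_map) (auto simp del: upt_Suc)

lemma hist_eq_iff: "hist Z t \<omega> = h \<longleftrightarrow> length h = Suc t \<and> (\<forall>i\<le>t. Z i \<omega> = h ! i)"
  by (auto simp: list_eq_iff_nth_eq hist_def less_Suc_eq_le simp del: upt_Suc)

primrec hist_pmf :: "('s \<Rightarrow> 's pmf) \<Rightarrow> 's \<Rightarrow> nat \<Rightarrow> 's list pmf" where
  "hist_pmf K z 0 = return_pmf [z]"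
| "hist_pmf K z (Suc t) = bind_pmf (hist_pmf K z t) (\<lambda>h. map_pmf (\<lambda>v. h @ [v]) (K (last h)))"

definition reaches :: "'s set \<Rightarrow> 's set \<Rightarrow> nat \<Rightarrow> (nat \<Rightarrow> 's) \<Rightarrow> bool" where
  "reaches R T n s \<longleftrightarrow> (\<exists>m\<le>n. s m \<in> T \<and> (\<forall>i<m. s i \<in> R))"

lemma reaches_0: "reaches R T 0 s \<longleftrightarrow> s 0 \<in> T"
  by (auto simp: reaches_def)

lemma reaches_Suc:
  "reaches R T (Suc n) s \<longleftrightarrow> s 0 \<in> T \<or> (s 0 \<in> R \<and> reaches R T n (\<lambda>i. s (Suc i)))"
proof
  assume "reaches R T (Suc n) s"
  then obtain m where m: "m \<le> Suc n" "s m \<in> T" "\<forall>i<m. s i \<in> R" by (auto simp: reaches_def)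
  then show "s 0 \<in> T \<or> (s 0 \<in> R \<and> reaches R T n (\<lambda>i. s (Suc i)))"
    by (cases m) (auto simp: reaches_def)
next
  assume "s 0 \<in> T \<or> (s 0 \<in> R \<and> reaches R T n (\<lambda>i. s (Suc i)))"
  then show "reaches R T (Suc n) s"
  proof (elim disjE conjE)
    assume "s 0 \<in> R" "reaches R T n (\<lambda>i. s (Suc i))"
    then obtain m where m: "m \<le> n" "s (Suc m) \<in> T" "\<forall>i<m. s (Suc i) \<in> R" by (auto simp: reaches_def)
    then have "\<forall>i<Suc m. s i \<in> R" using \<open>s 0 \<in> R\<close> by (auto simp: less_Suc_eq_0_disj)
    with m show ?thesis by (auto simp: reaches_def intro!: exI[of _ "Suc m"])
  qed (auto simp: reaches_def)
qed

primrec reach_prob :: "('s \<Rightarrow> 's pmf) \<Rightarrow> 's set \<Rightarrow> 's set \<Rightarrow> nat \<Rightarrow> 's \<Rightarrow> real" where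
  "reach_prob K R T 0 u = (if u \<in> T then 1 else 0)"
| "reach_prob K R T (Suc n) u =
     (if u \<in> T then 1 else if u \<in> R then measure_pmf.expectation (K u) (reach_prob K R T n) else 0)"

lemma expectation_bounds:
  fixes f :: "'s \<Rightarrow> real"
  assumes "\<And>u. 0 \<le> f u \<and> f u \<le> 1"
  shows "0 \<le> measure_pmf.expectation p f \<and> measure_pmf.expectation p f \<le> 1"
proof -
  have i: "integrable (measure_pmf p) f"
    by (rule measure_pmf.integrable_const_bound[where B=1]) (use assms in \<open>auto simp: abs_of_nonneg\<close>)
  have "measure_pmf.expectation p f \<le> measure_pmf.expectation p (\<lambda>_. 1)"
    by (rule integral_mono) (use assms i in auto)
  with assms show ?thesis by (simp add: integral_nonneg_AE)
qed

lemma reach_prob_bounds: "0 \<le> reach_prob K R T n u \<and> reach_prob K R T n u \<le> 1"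
proof (induction n arbitrary: u)
  case (Suc n)
  then show ?case using expectation_bounds[of "reach_prob K R T n" "K u"] by auto
qed auto

lemmas reach_prob_nonneg = reach_prob_bounds[THEN conjunct1]
lemmas reach_prob_le_1 = reach_prob_bounds[THEN conjunct2]

lemma reach_prob_integrable: "integrable (measure_pmf p) (reach_prob K R T n)"
  by (rule measure_pmf.integrable_const_bound[where B=1])
     (use reach_prob_bounds[of K R T n] in \<open>auto simp: abs_of_nonneg\<close>)

lemma reach_prob_mono: "reach_prob K R T n u \<le> reach_prob K R T (Suc n) u"
proof (induction n arbitrary: u)
  case 0
  show ?case by (auto intro!: integral_nonneg_AE)
next
  case (Suc n)
  have "measure_pmf.expectation (K u) (reach_prob K R T n) \<le> measure_pmf.expectation (K u) (reach_prob K R T (Suc n))"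
    by (intro integral_mono reach_prob_integrable Suc)
  then show ?case by (auto simp del: reach_prob.simps simp: reach_prob.simps(2)[of K R T n] reach_prob.simps(2)[of K R T "Suc n"])
qed

lemma reach_prob_mono': "n \<le> m \<Longrightarrow> reach_prob K R T n u \<le> reach_prob K R T m u"
  by (rule lift_Suc_mono_le[of "\<lambda>n. reach_prob K R T n u"]) (rule reach_prob_mono)

locale markov_chain =
  fixes M :: "'a measure" and K :: "'s::countable \<Rightarrow> 's pmf" and z :: 's and Z :: "nat \<Rightarrow> 'a \<Rightarrow> 's"
  assumes chain: "markov_chain_from M K z Z"
begin

sublocale prob_space M using chain by (simp add: markov_chain_from_def)

lemma Z_measurable [measurable]: "Z t \<in> measurable M (count_space UNIV)"
  using chain by (simp add: markov_chain_from_def)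

lemma hist_measurable [measurable]: "hist Z t \<in> measurable M (count_space UNIV)"
proof (subst measurable_count_space_eq2_countable, safe)
  fix h :: "'s list"
  have "hist Z t -` {h} \<inter> space M = {\<omega>\<in>space M. length h = Suc t \<and> (\<forall>i\<le>t. Z i \<omega> = h ! i)}"
    using hist_eq_iff[of Z t _ h] by auto
  also have "\<dots> \<in> sets M" by measurable
  finally show "hist Z t -` {h} \<inter> space M \<in> sets M" .
qed auto

lemma hist_prob_Suc:
  "prob {\<omega>\<in>space M. hist Z (Suc t) \<omega> = h @ [v]} = prob {\<omega>\<in>space M. hist Z t \<omega> = h} * pmf (K (last h)) v"
proof (cases "length h = Suc t \<and> prob {\<omega>\<in>space M. hist Z t \<omega> = h} \<noteq> 0")
  case True
  then have len: "length h = Suc t" by simp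
  define s where "s i = (h @ [v]) ! i" for i
  have s: "s (Suc t) = v" "s t = last h" "\<And>i. i \<le> t \<Longrightarrow> s i = h ! i"
  proof -
    have "h \<noteq> []" using len by auto
    then show "s (Suc t) = v" "s t = last h" "\<And>i. i \<le> t \<Longrightarrow> s i = h ! i"
      using len by (auto simp: s_def nth_append last_conv_nth)
  qed
  have eq: "{\<omega>\<in>space M. \<forall>i\<le>t. Z i \<omega> = s i} = {\<omega>\<in>space M. hist Z t \<omega> = h}"
    using len s(3) by (auto simp: hist_eq_iff)
  have eq2: "{\<omega>\<in>space M. Z (Suc t) \<omega> = s (Suc t) \<and> (\<forall>i\<le>t. Z i \<omega> = s i)} = {\<omega>\<in>space M. hist Z (Suc t) \<omega> = h @ [v]}"
    using eq s(1) by (auto simp: hist_Suc)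
  have "\<P>(\<omega> in M. Z (Suc t) \<omega> = s (Suc t) \<bar> \<forall>i\<le>t. Z i \<omega> = s i) = pmf (K (s t)) (s (Suc t))"
    using chain True eq unfolding markov_chain_from_def by auto
  then show ?thesis using True unfolding cond_prob_def eq eq2 unfolding s by (simp add: field_simps)
next
  case False
  have "prob {\<omega>\<in>space M. hist Z (Suc t) \<omega> = h @ [v]} \<le> prob {\<omega>\<in>space M. hist Z t \<omega> = h}"
    by (rule finite_measure_mono) (auto simp: hist_Suc)
  moreover have "prob {\<omega>\<in>space M. hist Z t \<omega> = h} = 0"
    using False by (cases "length h = Suc t") (auto simp: hist_eq_iff)
  ultimately show ?thesis using measure_nonneg[of M "{\<omega>\<in>space M. hist Z (Suc t) \<omega> = h @ [v]}"] by simp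
qed

lemma distr_hist: "distr M (count_space UNIV) (hist Z t) = measure_pmf (hist_pmf K z t)"
proof -
  have *: "prob {\<omega>\<in>space M. hist Z t \<omega> = l} = pmf (hist_pmf K z t) l" for l
  proof (induction t arbitrary: l)
    case 0
    have z0: "AE \<omega> in M. Z 0 \<omega> = z" using chain by (simp add: markov_chain_from_def)
    have "prob {\<omega>\<in>space M. hist Z 0 \<omega> = l} = prob (if l = [z] then space M else {})"
      by (rule finite_measure_eq_AE) (use z0 in \<open>auto simp: hist_def elim!: eventually_mono\<close>)
    then show ?case by (auto simp: prob_space)
  next
    case (Suc t)
    have len: "length h = Suc t" if "h \<in> set_pmf (hist_pmf K z t)" for h
      using that by (induction t arbitrary: h) auto
    show ?case
    proof (cases "l = []")
      case True
      then show ?thesis by (auto simp: hist_def pmf_eq_0_set_pmf)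
    next
      case False
      then obtain h v where l: "l = h @ [v]" by (metis rev_exhaust)
      have "pmf (map_pmf (\<lambda>v. h' @ [v]) (K (last h'))) (h @ [v]) = indicator {h} h' * pmf (K (last h)) v" for h'
      proof (cases "h' = h")
        case True
        have "pmf (map_pmf (\<lambda>v. h @ [v]) (K (last h))) ((\<lambda>v. h @ [v]) v) = pmf (K (last h)) v"
          by (rule pmf_map_inj') (auto simp: inj_def)
        with True show ?thesis by simp
      qed (auto simp: pmf_eq_0_set_pmf)
      then have "pmf (hist_pmf K z (Suc t)) l = measure_pmf.expectation (hist_pmf K z t) (\<lambda>h'. indicator {h} h' * pmf (K (last h)) v)"
        unfolding l hist_pmf.simps pmf_bind by simp
      also have "\<dots> = pmf (hist_pmf K z t) h * pmf (K (last h)) v" by (simp add: measure_pmf_single)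
      finally show ?thesis unfolding l hist_prob_Suc Suc by simp
    qed
  qed
  show ?thesis
  proof (rule measure_eqI_countable[where A=UNIV])
    fix l
    have "emeasure (distr M (count_space UNIV) (hist Z t)) {l} = emeasure M {\<omega>\<in>space M. hist Z t \<omega> = l}"
      by (subst emeasure_distr) (auto intro!: arg_cong[where f="emeasure M"])
    then show "emeasure (distr M (count_space UNIV) (hist Z t)) {l} = emeasure (measure_pmf (hist_pmf K z t)) {l}"
      by (simp add: emeasure_eq_measure * emeasure_pmf_single)
  qed auto
qed

lemma AE_hist_iff: "(AE \<omega> in M. P (hist Z t \<omega>)) \<longleftrightarrow> (\<forall>h\<in>set_pmf (hist_pmf K z t). P h)"
proof -
  have "(AE \<omega> in M. P (hist Z t \<omega>)) \<longleftrightarrow> (AE h in distr M (count_space UNIV) (hist Z t). P h)"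
    by (subst AE_distr_iff) auto
  then show ?thesis unfolding distr_hist AE_measure_pmf_iff .
qed

lemma nn_integral_hist: "(\<integral>\<^sup>+\<omega>. F (hist Z t \<omega>) \<partial>M) = (\<integral>\<^sup>+h. F h \<partial>hist_pmf K z t)"
  unfolding distr_hist[symmetric] by (rule nn_integral_distr[symmetric]) auto

lemma AE_step: "AE \<omega> in M. Z 0 \<omega> = z \<and> (\<forall>t. Z (Suc t) \<omega> \<in> set_pmf (K (Z t \<omega>)))"
proof -
  have "AE \<omega> in M. Z (Suc t) \<omega> \<in> set_pmf (K (Z t \<omega>))" for t
  proof -
    have ne: "h \<noteq> []" if "h \<in> set_pmf (hist_pmf K z t)" for h
      using that by (cases t) auto
    have "AE \<omega> in M. last (hist Z (Suc t) \<omega>) \<in> set_pmf (K (last (butlast (hist Z (Suc t) \<omega>))))"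
      by (subst AE_hist_iff) (use ne in auto)
    then show ?thesis by (simp add: hist_Suc)
  qed
  then show ?thesis using chain by (simp add: markov_chain_from_def AE_all_countable)
qed

lemma one_step:
  fixes f :: "'s \<Rightarrow> real"
  assumes f: "\<And>u. 0 \<le> f u \<and> f u \<le> 1"
  shows "expectation (\<lambda>\<omega>. if P (hist Z t \<omega>) then f (Z (Suc t) \<omega>) else 0) =
         expectation (\<lambda>\<omega>. if P (hist Z t \<omega>) then measure_pmf.expectation (K (Z t \<omega>)) f else 0)"
proof -
  have int: "integrable (measure_pmf p) f" for p
    by (rule measure_pmf.integrable_const_bound[where B=1]) (use f in \<open>auto simp: abs_of_nonneg\<close>)
  note Kf = expectation_bounds[OF f]
  have ne: "h \<noteq> []" if "h \<in> set_pmf (hist_pmf K z t)" for h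
    using that by (cases t) auto
  have "(\<integral>\<^sup>+\<omega>. ennreal (if P (hist Z t \<omega>) then f (Z (Suc t) \<omega>) else 0) \<partial>M)
      = (\<integral>\<^sup>+\<omega>. (\<lambda>h. ennreal (if P (butlast h) then f (last h) else 0)) (hist Z (Suc t) \<omega>) \<partial>M)"
    by (simp only: hist_Suc butlast_snoc last_snoc)
  also have "\<dots> = (\<integral>\<^sup>+h. ennreal (if P (butlast h) then f (last h) else 0) \<partial>hist_pmf K z (Suc t))"
    by (rule nn_integral_hist)
  also have "\<dots> = (\<integral>\<^sup>+h. \<integral>\<^sup>+v. ennreal (if P h then f v else 0) \<partial>K (last h) \<partial>hist_pmf K z t)"
    by (simp cong: if_cong)
  also have "\<dots> = (\<integral>\<^sup>+h. ennreal (if P h then measure_pmf.expectation (K (last h)) f else 0) \<partial>hist_pmf K z t)"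
    by (intro nn_integral_cong) (use f in \<open>auto simp: nn_integral_eq_integral[OF int]\<close>)
  also have "\<dots> = (\<integral>\<^sup>+\<omega>. ennreal (if P (hist Z t \<omega>) then measure_pmf.expectation (K (Z t \<omega>)) f else 0) \<partial>M)"
    using nn_integral_hist[of "\<lambda>h. ennreal (if P h then measure_pmf.expectation (K (last h)) f else 0)" t]
    unfolding last_hist by (rule sym)
  finally have "enn2real (\<integral>\<^sup>+\<omega>. ennreal (if P (hist Z t \<omega>) then f (Z (Suc t) \<omega>) else 0) \<partial>M)
    = enn2real (\<integral>\<^sup>+\<omega>. ennreal (if P (hist Z t \<omega>) then measure_pmf.expectation (K (Z t \<omega>)) f else 0) \<partial>M)" by simp
  then show ?thesis
    by (subst (1 2) integral_eq_nn_integral) (use f Kf in auto)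
qed

lemma reaches_measurable [measurable]: "Measurable.pred M (\<lambda>\<omega>. reaches R T n (\<lambda>i. Z (t + i) \<omega>))"
  unfolding reaches_def by measurable

text \<open>
  The Markov property in the form used below. The induction moves the present forward: not having
  stopped at time t is an event of the past of t + 1, so the induction hypothesis applies to it.
\<close>

lemma prob_reaches:
  "prob {\<omega>\<in>space M. P (hist Z t \<omega>) \<and> reaches R T n (\<lambda>i. Z (t + i) \<omega>)} =
   expectation (\<lambda>\<omega>. if P (hist Z t \<omega>) then reach_prob K R T n (Z t \<omega>) else 0)"
proof (induction n arbitrary: t P)
  case 0
  have "prob {\<omega>\<in>space M. P (hist Z t \<omega>) \<and> reaches R T 0 (\<lambda>i. Z (t + i) \<omega>)} = prob {\<omega>\<in>space M. P (hist Z t \<omega>) \<and> Z t \<omega> \<in> T}"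
    by (simp add: reaches_0)
  also have "\<dots> = expectation (indicator {\<omega>\<in>space M. P (hist Z t \<omega>) \<and> Z t \<omega> \<in> T})"
    by simp
  also have "\<dots> = expectation (\<lambda>\<omega>. if P (hist Z t \<omega>) then reach_prob K R T 0 (Z t \<omega>) else 0)"
    by (rule Bochner_Integration.integral_cong) (auto simp: indicator_def)
  finally show ?case .
next
  case (Suc n)
  define P' where "P' h = (P (butlast h) \<and> last (butlast h) \<notin> T \<and> last (butlast h) \<in> R)" for h
  have P': "P' (hist Z (Suc t) \<omega>) \<longleftrightarrow> P (hist Z t \<omega>) \<and> Z t \<omega> \<notin> T \<and> Z t \<omega> \<in> R" for \<omega>
    by (simp add: P'_def hist_Suc)
  have split: "{\<omega>\<in>space M. P (hist Z t \<omega>) \<and> reaches R T (Suc n) (\<lambda>i. Z (t + i) \<omega>)} =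
     {\<omega>\<in>space M. P (hist Z t \<omega>) \<and> Z t \<omega> \<in> T} \<union>
     {\<omega>\<in>space M. P' (hist Z (Suc t) \<omega>) \<and> reaches R T n (\<lambda>i. Z (Suc t + i) \<omega>)}"
    unfolding P' by (auto simp: reaches_Suc)
  have "prob {\<omega>\<in>space M. P (hist Z t \<omega>) \<and> reaches R T (Suc n) (\<lambda>i. Z (t + i) \<omega>)} = prob {\<omega>\<in>space M. P (hist Z t \<omega>) \<and> Z t \<omega> \<in> T} +
     prob {\<omega>\<in>space M. P' (hist Z (Suc t) \<omega>) \<and> reaches R T n (\<lambda>i. Z (Suc t + i) \<omega>)}"
    unfolding split
  proof (rule finite_measure_Union)
    show "{\<omega>\<in>space M. P' (hist Z (Suc t) \<omega>) \<and> reaches R T n (\<lambda>i. Z (Suc t + i) \<omega>)} \<in> events" by measurable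
  qed (auto simp: P')
  also have "prob {\<omega>\<in>space M. P' (hist Z (Suc t) \<omega>) \<and> reaches R T n (\<lambda>i. Z (Suc t + i) \<omega>)} =
     expectation (\<lambda>\<omega>. if P' (hist Z (Suc t) \<omega>) then reach_prob K R T n (Z (Suc t) \<omega>) else 0)"
    by (rule Suc)
  also have "\<dots> = expectation (\<lambda>\<omega>. if P (hist Z t \<omega>) \<and> last (hist Z t \<omega>) \<notin> T \<and> last (hist Z t \<omega>) \<in> R then reach_prob K R T n (Z (Suc t) \<omega>) else 0)"
    by (simp add: P')
  also have "\<dots> = expectation (\<lambda>\<omega>. if P (hist Z t \<omega>) \<and> last (hist Z t \<omega>) \<notin> T \<and> last (hist Z t \<omega>) \<in> R then measure_pmf.expectation (K (Z t \<omega>)) (reach_prob K R T n) else 0)"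
    by (rule one_step[OF reach_prob_bounds])
  also have "prob {\<omega>\<in>space M. P (hist Z t \<omega>) \<and> Z t \<omega> \<in> T} = expectation (indicator {\<omega>\<in>space M. P (hist Z t \<omega>) \<and> Z t \<omega> \<in> T})"
    by simp
  also have "expectation (indicator {\<omega>\<in>space M. P (hist Z t \<omega>) \<and> Z t \<omega> \<in> T}) +
    expectation (\<lambda>\<omega>. if P (hist Z t \<omega>) \<and> last (hist Z t \<omega>) \<notin> T \<and> last (hist Z t \<omega>) \<in> R then measure_pmf.expectation (K (Z t \<omega>)) (reach_prob K R T n) else 0)
    = expectation (\<lambda>\<omega>. indicator {\<omega>\<in>space M. P (hist Z t \<omega>) \<and> Z t \<omega> \<in> T} \<omega> +
    (if P (hist Z t \<omega>) \<and> last (hist Z t \<omega>) \<notin> T \<and> last (hist Z t \<omega>) \<in> R then measure_pmf.expectation (K (Z t \<omega>)) (reach_prob K R T n) else 0))"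
  proof (rule Bochner_Integration.integral_add[symmetric])
    show "integrable M (\<lambda>\<omega>. if P (hist Z t \<omega>) \<and> last (hist Z t \<omega>) \<notin> T \<and> last (hist Z t \<omega>) \<in> R then measure_pmf.expectation (K (Z t \<omega>)) (reach_prob K R T n) else 0)"
      by (rule integrable_const_bound[where B=1])
         (use expectation_bounds[of "reach_prob K R T n", OF reach_prob_bounds] in \<open>auto simp: abs_of_nonneg\<close>)
  qed (simp add: emeasure_eq_measure)
  also have "\<dots> = expectation (\<lambda>\<omega>. if P (hist Z t \<omega>) then reach_prob K R T (Suc n) (Z t \<omega>) else 0)"
    by (rule Bochner_Integration.integral_cong) (auto simp: indicator_def)
  finally show ?case .
qed

lemma prob_reaches_le:
  assumes "\<And>u. u \<in> U \<Longrightarrow> reach_prob K R T n u \<le> c" "0 \<le> c"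
  shows "prob {\<omega>\<in>space M. P (hist Z t \<omega>) \<and> Z t \<omega> \<in> U \<and> reaches R T n (\<lambda>i. Z (t + i) \<omega>)}
     \<le> c * prob {\<omega>\<in>space M. P (hist Z t \<omega>) \<and> Z t \<omega> \<in> U}"
proof -
  have "prob {\<omega>\<in>space M. (P (hist Z t \<omega>) \<and> last (hist Z t \<omega>) \<in> U) \<and> reaches R T n (\<lambda>i. Z (t + i) \<omega>)}
     = expectation (\<lambda>\<omega>. if P (hist Z t \<omega>) \<and> last (hist Z t \<omega>) \<in> U then reach_prob K R T n (Z t \<omega>) else 0)"
    by (rule prob_reaches)
  also have "\<dots> \<le> expectation (\<lambda>\<omega>. c * indicator {\<omega>\<in>space M. P (hist Z t \<omega>) \<and> Z t \<omega> \<in> U} \<omega>)"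
  proof (rule integral_mono)
    show "integrable M (\<lambda>\<omega>. if P (hist Z t \<omega>) \<and> last (hist Z t \<omega>) \<in> U then reach_prob K R T n (Z t \<omega>) else 0)"
      by (rule integrable_const_bound[where B=1])
         (auto simp: abs_of_nonneg reach_prob_nonneg reach_prob_le_1)
    show "integrable M (\<lambda>\<omega>. c * indicator {\<omega>\<in>space M. P (hist Z t \<omega>) \<and> Z t \<omega> \<in> U} \<omega>)"
      by (intro integrable_mult_right integrable_real_indicator) (auto simp: emeasure_eq_measure)
  qed (use assms in \<open>auto simp: indicator_def\<close>)
  finally show ?thesis by simp
qed

lemma prob_reaches_ge:
  assumes "\<And>u. u \<in> U \<Longrightarrow> c \<le> reach_prob K R T n u" "0 \<le> c"
  shows "c * prob {\<omega>\<in>space M. P (hist Z t \<omega>) \<and> Z t \<omega> \<in> U} \<le>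
     prob {\<omega>\<in>space M. P (hist Z t \<omega>) \<and> Z t \<omega> \<in> U \<and> reaches R T n (\<lambda>i. Z (t + i) \<omega>)}"
proof -
  have "c * prob {\<omega>\<in>space M. P (hist Z t \<omega>) \<and> Z t \<omega> \<in> U} = expectation (\<lambda>\<omega>. c * indicator {\<omega>\<in>space M. P (hist Z t \<omega>) \<and> Z t \<omega> \<in> U} \<omega>)"
    by simp
  also have "\<dots> \<le> expectation (\<lambda>\<omega>. if P (hist Z t \<omega>) \<and> last (hist Z t \<omega>) \<in> U then reach_prob K R T n (Z t \<omega>) else 0)"
  proof (rule integral_mono)
    show "integrable M (\<lambda>\<omega>. if P (hist Z t \<omega>) \<and> last (hist Z t \<omega>) \<in> U then reach_prob K R T n (Z t \<omega>) else 0)"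
      by (rule integrable_const_bound[where B=1])
         (auto simp: abs_of_nonneg reach_prob_nonneg reach_prob_le_1)
    show "integrable M (\<lambda>\<omega>. c * indicator {\<omega>\<in>space M. P (hist Z t \<omega>) \<and> Z t \<omega> \<in> U} \<omega>)"
      by (intro integrable_mult_right integrable_real_indicator) (auto simp: emeasure_eq_measure)
  qed (use assms in \<open>auto simp: indicator_def\<close>)
  also have "\<dots> = prob {\<omega>\<in>space M. (P (hist Z t \<omega>) \<and> last (hist Z t \<omega>) \<in> U) \<and> reaches R T n (\<lambda>i. Z (t + i) \<omega>)}"
    by (rule prob_reaches[symmetric])
  finally show ?thesis by simp
qed

end

section \<open>Hitting probabilities\<close>

text \<open>
  All upper bounds on hitting probabilities are obtained by exhibiting a supersolution g. The
  invariant set I lets g be specified only where the walk can be.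
\<close>

lemma reach_prob_le_super:
  fixes g :: "'s \<Rightarrow> real"
  assumes fin: "\<And>u. u \<in> I \<Longrightarrow> finite (set_pmf (K u))"
    and closed: "\<And>u. u \<in> I \<Longrightarrow> u \<notin> T \<Longrightarrow> u \<in> R \<Longrightarrow> set_pmf (K u) \<subseteq> I"
    and nonneg: "\<And>u. u \<in> I \<Longrightarrow> 0 \<le> g u"
    and target: "\<And>u. u \<in> I \<Longrightarrow> u \<in> T \<Longrightarrow> 1 \<le> g u"
    and super: "\<And>u. u \<in> I \<Longrightarrow> u \<notin> T \<Longrightarrow> u \<in> R \<Longrightarrow> measure_pmf.expectation (K u) g \<le> g u"
  shows "u \<in> I \<Longrightarrow> reach_prob K R T n u \<le> g u"
proof (induction n arbitrary: u)
  case 0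
  then show ?case using nonneg target by auto
next
  case (Suc n)
  show ?case
  proof (cases "u \<notin> T \<and> u \<in> R")
    case True
    have "measure_pmf.expectation (K u) (reach_prob K R T n) \<le> measure_pmf.expectation (K u) g"
      using closed[OF \<open>u \<in> I\<close>] Suc.IH True
      by (intro integral_mono_AE integrable_measure_pmf_finite fin \<open>u \<in> I\<close>) (auto simp: AE_measure_pmf_iff)
    with super[OF \<open>u \<in> I\<close>] True show ?thesis by auto
  qed (use Suc nonneg target in auto)
qed

definition hit_prob :: "('s \<Rightarrow> 's pmf) \<Rightarrow> 's set \<Rightarrow> 's set \<Rightarrow> 's \<Rightarrow> real" where
  "hit_prob K R T u = (SUP n. reach_prob K R T n u)"

lemma reach_prob_bdd: "bdd_above (range (\<lambda>n. reach_prob K R T n u))"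
  by (rule bdd_aboveI[of _ 1]) (auto simp: reach_prob_le_1)

lemma reach_prob_le_hit_prob: "reach_prob K R T n u \<le> hit_prob K R T u"
  unfolding hit_prob_def by (rule cSUP_upper[OF UNIV_I reach_prob_bdd])

lemma hit_prob_nonneg: "0 \<le> hit_prob K R T u"
  using reach_prob_le_hit_prob[of K R T 0 u] reach_prob_nonneg[of K R T 0 u] by linarith

lemma hit_prob_leI: "(\<And>n. reach_prob K R T n u \<le> c) \<Longrightarrow> hit_prob K R T u \<le> c"
  unfolding hit_prob_def by (rule cSUP_least) auto

lemma hit_prob_le_1: "hit_prob K R T u \<le> 1"
  by (rule hit_prob_leI) (rule reach_prob_le_1)

lemma reach_prob_tendsto: "(\<lambda>n. reach_prob K R T n u) \<longlonglongrightarrow> hit_prob K R T u"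
  unfolding hit_prob_def
  by (rule LIMSEQ_incseq_SUP[OF reach_prob_bdd]) (auto simp: incseq_def intro: reach_prob_mono')

lemma hit_prob_target: "u \<in> T \<Longrightarrow> hit_prob K R T u = 1"
  using reach_prob_le_hit_prob[of K R T 0 u] hit_prob_le_1[of K R T u] by simp

lemma hit_prob_integrable: "integrable (measure_pmf p) (hit_prob K R T)"
  by (rule measure_pmf.integrable_const_bound[where B=1])
     (auto simp: hit_prob_nonneg hit_prob_le_1)

lemma hit_prob_step:
  assumes "u \<notin> T" "u \<in> R"
  shows "hit_prob K R T u = measure_pmf.expectation (K u) (hit_prob K R T)"
proof (rule LIMSEQ_unique)
  show "(\<lambda>n. reach_prob K R T (Suc n) u) \<longlonglongrightarrow> hit_prob K R T u"
    by (rule LIMSEQ_Suc[OF reach_prob_tendsto])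
  have "(\<lambda>n. measure_pmf.expectation (K u) (reach_prob K R T n)) \<longlonglongrightarrow> measure_pmf.expectation (K u) (hit_prob K R T)"
    by (rule integral_dominated_convergence[where w="\<lambda>_. 1"])
       (auto simp: reach_prob_tendsto reach_prob_nonneg reach_prob_le_1)
  then show "(\<lambda>n. reach_prob K R T (Suc n) u) \<longlonglongrightarrow> measure_pmf.expectation (K u) (hit_prob K R T)"
    using assms by simp
qed

text \<open>
  Successive targets: by the Markov property at the first one, the chances multiply.
\<close>

lemma hit_prob_chain:
  assumes closed: "\<And>v. v \<in> I \<Longrightarrow> v \<in> R \<Longrightarrow> set_pmf (K v) \<subseteq> I"
    and b: "0 \<le> b" "b \<le> 1" "\<And>v. v \<in> I \<Longrightarrow> v \<in> T1 \<Longrightarrow> b \<le> hit_prob K R T2 v"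
    and u: "u \<in> I"
  shows "b * hit_prob K R T1 u \<le> hit_prob K R T2 u"
proof -
  have *: "b * reach_prob K R T1 n u \<le> hit_prob K R T2 u" if "u \<in> I" for n u
    using that
  proof (induction n arbitrary: u)
    case 0
    then show ?case using b by (auto simp: hit_prob_nonneg)
  next
    case (Suc n)
    consider "u \<in> T2" | "u \<in> T1" | "u \<notin> T1" "u \<notin> R" | "u \<notin> T1" "u \<notin> T2" "u \<in> R" by blast
    then show ?case
    proof cases
      case 1
      then show ?thesis using b mult_le_one[OF b(2) reach_prob_nonneg reach_prob_le_1] by (simp only: hit_prob_target)
    next
      case 4
      have "b * reach_prob K R T1 (Suc n) u = measure_pmf.expectation (K u) (\<lambda>v. b * reach_prob K R T1 n v)"
        using 4 by simp
      also have "\<dots> \<le> measure_pmf.expectation (K u) (hit_prob K R T2)"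
        using closed[OF \<open>u \<in> I\<close>] Suc.IH 4
        by (intro integral_mono_AE integrable_mult_right reach_prob_integrable hit_prob_integrable)
           (auto simp: AE_measure_pmf_iff)
      also have "\<dots> = hit_prob K R T2 u" using 4 by (simp add: hit_prob_step)
      finally show ?thesis .
    qed (use b Suc in \<open>auto simp: hit_prob_nonneg\<close>)
  qed
  have "(\<lambda>n. b * reach_prob K R T1 n u) \<longlonglongrightarrow> b * hit_prob K R T1 u"
    by (intro tendsto_intros reach_prob_tendsto)
  then show ?thesis by (rule LIMSEQ_le_const2) (use *[OF u] in auto)
qed

text \<open>
  A checkpoint L on the way to T: whoever misses T before L still has a chance b after it.
\<close>

lemma hit_prob_checkpoint:
  assumes closed: "\<And>v. v \<in> I \<Longrightarrow> set_pmf (K v) \<subseteq> I"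
    and b: "0 \<le> b" "b \<le> 1" "\<And>v. v \<in> I \<Longrightarrow> v \<in> L \<Longrightarrow> b \<le> hit_prob K UNIV T v"
    and u: "u \<in> I"
  shows "b * hit_prob K UNIV (T \<union> L) u + (1 - b) * hit_prob K (- L) T u \<le> hit_prob K UNIV T u"
proof -
  have *: "b * reach_prob K UNIV (T \<union> L) n u + (1 - b) * reach_prob K (- L) T n u \<le> hit_prob K UNIV T u"
    if "u \<in> I" for n u
    using that
  proof (induction n arbitrary: u)
    case 0
    then show ?case using b by (auto simp: hit_prob_nonneg hit_prob_target)
  next
    case (Suc n)
    show ?case
    proof (cases "u \<in> T \<union> L")
      case True
      then show ?thesis using b Suc by (auto simp: hit_prob_target)
    next
      case False
      then have "b * reach_prob K UNIV (T \<union> L) (Suc n) u + (1 - b) * reach_prob K (- L) T (Suc n) u =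
        measure_pmf.expectation (K u) (\<lambda>v. b * reach_prob K UNIV (T \<union> L) n v) + measure_pmf.expectation (K u) (\<lambda>v. (1 - b) * reach_prob K (- L) T n v)"
        by simp
      also have "\<dots> = measure_pmf.expectation (K u) (\<lambda>v. b * reach_prob K UNIV (T \<union> L) n v + (1 - b) * reach_prob K (- L) T n v)"
        by (intro Bochner_Integration.integral_add[symmetric] integrable_mult_right reach_prob_integrable)
      also have "\<dots> \<le> measure_pmf.expectation (K u) (hit_prob K UNIV T)"
        using closed[OF \<open>u \<in> I\<close>] Suc.IH
        by (intro integral_mono_AE integrable_mult_right reach_prob_integrable hit_prob_integrable Bochner_Integration.integrable_add)
           (auto simp: AE_measure_pmf_iff)
      also have "\<dots> = hit_prob K UNIV T u" using False by (simp add: hit_prob_step)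
      finally show ?thesis .
    qed
  qed
  have "(\<lambda>n. b * reach_prob K UNIV (T \<union> L) n u + (1 - b) * reach_prob K (- L) T n u)
     \<longlonglongrightarrow> b * hit_prob K UNIV (T \<union> L) u + (1 - b) * hit_prob K (- L) T u"
    by (intro tendsto_intros reach_prob_tendsto)
  then show ?thesis by (rule LIMSEQ_le_const2) (use *[OF u] in auto)
qed

lemma hit_prob_mono_region:
  assumes "R \<subseteq> R'" "T \<subseteq> T'"
  shows "hit_prob K R T u \<le> hit_prob K R' T' u"
proof (rule hit_prob_leI)
  fix n
  show "reach_prob K R T n u \<le> hit_prob K R' T' u"
  proof (induction n arbitrary: u)
    case 0
    then show ?case using assms by (auto simp: hit_prob_nonneg hit_prob_target)
  next
    case (Suc n)
    consider "u \<in> T'" | "u \<notin> T'" "u \<notin> R" | "u \<notin> T'" "u \<in> R" by blast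
    then show ?case
    proof cases
      case 1
      then show ?thesis using reach_prob_le_1 by (simp only: hit_prob_target)
    next
      case 2
      then show ?thesis using assms by (auto simp: hit_prob_nonneg)
    next
      case 3
      have "measure_pmf.expectation (K u) (reach_prob K R T n) \<le> measure_pmf.expectation (K u) (hit_prob K R' T')"
        using Suc by (intro integral_mono reach_prob_integrable hit_prob_integrable)
      with 3 assms show ?thesis by (auto simp: hit_prob_step)
    qed
  qed
qed

context markov_chain begin

text \<open>
  A weak form of Levy's zero-one law. Staying in S for ever is the decreasing limit of staying there
  up to time m. Whatever m is, a fixed fraction of the paths that have stayed up to then still leave;
  so the limit cannot have positive probability.
\<close>

lemma AE_frequently_outside:
  assumes adm: "AE \<omega> in M. \<forall>t. Z t \<omega> \<in> A"
    and c: "0 < c" "\<And>u. u \<in> S \<Longrightarrow> u \<in> A \<Longrightarrow> c \<le> hit_prob K UNIV (- S) u"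
  shows "AE \<omega> in M. \<exists>\<^sub>F t in sequentially. Z t \<omega> \<notin> S"
proof -
  have "prob {\<omega>\<in>space M. \<forall>s\<ge>t. Z s \<omega> \<in> S} = 0" for t
  proof -
    define N where "N = {\<omega>\<in>space M. \<forall>s\<ge>t. Z s \<omega> \<in> S}"
    define G where "G m = {\<omega>\<in>space M. \<forall>s\<in>{t..t+m}. Z s \<omega> \<in> S}" for m
    define U where "U n = {u. u \<in> S \<and> c / 2 \<le> reach_prob K UNIV (- S) n u}" for n
    have [measurable]: "N \<in> events" "G m \<in> events" for m
      unfolding N_def G_def by measurable
    have NG: "N \<subseteq> G m" for m by (auto simp: N_def G_def)
    have exits: "c / 2 * prob (G m) \<le> prob (G m) - prob N" for m
    proof -
      define P where "P h = (\<forall>s\<in>{t..t+m}. h ! s \<in> S)" for h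
      have P: "P (hist Z (t+m) \<omega>) \<longleftrightarrow> (\<forall>s\<in>{t..t+m}. Z s \<omega> \<in> S)" for \<omega>
        by (auto simp: P_def hist_nth)
      have bound: "c / 2 * prob {\<omega>\<in>space M. P (hist Z (t+m) \<omega>) \<and> Z (t+m) \<omega> \<in> U n} \<le> prob (G m) - prob N" for n
      proof -
        have "c / 2 * prob {\<omega>\<in>space M. P (hist Z (t+m) \<omega>) \<and> Z (t+m) \<omega> \<in> U n} \<le>
          prob {\<omega>\<in>space M. P (hist Z (t+m) \<omega>) \<and> Z (t+m) \<omega> \<in> U n \<and> reaches UNIV (- S) n (\<lambda>i. Z (t+m+i) \<omega>)}"
          using c by (intro prob_reaches_ge) (auto simp: U_def)
        also have "\<dots> \<le> prob (G m - N)"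
        proof (rule finite_measure_mono)
          show "{\<omega>\<in>space M. P (hist Z (t+m) \<omega>) \<and> Z (t+m) \<omega> \<in> U n \<and> reaches UNIV (- S) n (\<lambda>i. Z (t+m+i) \<omega>)} \<subseteq> G m - N"
            by (auto simp: P G_def N_def reaches_def)
        qed auto
        also have "\<dots> = prob (G m) - prob N" using NG by (intro finite_measure_Diff) auto
        finally show ?thesis .
      qed
      have "(\<lambda>n. prob {\<omega>\<in>space M. P (hist Z (t+m) \<omega>) \<and> Z (t+m) \<omega> \<in> U n}) \<longlonglongrightarrow>
         prob (\<Union>n. {\<omega>\<in>space M. P (hist Z (t+m) \<omega>) \<and> Z (t+m) \<omega> \<in> U n})"
      proof (rule finite_Lim_measure_incseq)
        show "incseq (\<lambda>n. {\<omega>\<in>space M. P (hist Z (t+m) \<omega>) \<and> Z (t+m) \<omega> \<in> U n})"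
          using reach_prob_mono'[of _ _ K UNIV "- S"] order_trans by (fastforce simp: incseq_def U_def)
      qed auto
      moreover have "prob (\<Union>n. {\<omega>\<in>space M. P (hist Z (t+m) \<omega>) \<and> Z (t+m) \<omega> \<in> U n}) = prob (G m)"
      proof (rule finite_measure_eq_AE)
        have "\<exists>n. u \<in> U n" if "u \<in> S" "u \<in> A" for u
        proof -
          have "c / 2 < hit_prob K UNIV (- S) u" using c that by fastforce
          then have "eventually (\<lambda>n. c / 2 < reach_prob K UNIV (- S) n u) sequentially"
            by (rule order_tendstoD[OF reach_prob_tendsto])
          then obtain n where "c / 2 < reach_prob K UNIV (- S) n u"
            by (auto simp: eventually_sequentially)
          then show ?thesis using that by (auto simp: U_def intro!: exI[of _ n])
        qed
        with adm show "AE \<omega> in M. \<omega> \<in> (\<Union>n. {\<omega>\<in>space M. P (hist Z (t+m) \<omega>) \<and> Z (t+m) \<omega> \<in> U n}) \<longleftrightarrow> \<omega> \<in> G m"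
          by (elim eventually_mono) (auto simp: P G_def)
      qed auto
      ultimately have "(\<lambda>n. c / 2 * prob {\<omega>\<in>space M. P (hist Z (t+m) \<omega>) \<and> Z (t+m) \<omega> \<in> U n}) \<longlonglongrightarrow> c / 2 * prob (G m)"
        by (intro tendsto_intros) simp
      then show ?thesis by (rule LIMSEQ_le_const2) (use bound in auto)
    qed
    have "(\<lambda>m. prob (G m)) \<longlonglongrightarrow> prob (\<Inter>m. G m)"
      by (rule finite_Lim_measure_decseq) (auto simp: decseq_def G_def)
    also have "(\<Inter>m. G m) = N"
    proof (intro equalityI subsetI)
      fix \<omega> assume "\<omega> \<in> (\<Inter>m. G m)"
      then have *: "\<And>m s. s \<in> {t..t+m} \<Longrightarrow> Z s \<omega> \<in> S" "\<omega> \<in> space M" by (auto simp: G_def)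
      have "Z s \<omega> \<in> S" if "s \<ge> t" for s using *(1)[of s "s - t"] that by simp
      then show "\<omega> \<in> N" using *(2) by (simp add: N_def)
    qed (auto simp: N_def G_def)
    finally have lim: "(\<lambda>m. prob (G m)) \<longlonglongrightarrow> prob N" .
    have "c / 2 * prob N \<le> prob N - prob N"
      by (rule LIMSEQ_le[where X="\<lambda>m. c / 2 * prob (G m)" and Y="\<lambda>m. prob (G m) - prob N"])
         (use exits tendsto_mult[OF tendsto_const lim, of "c / 2"] tendsto_diff[OF lim tendsto_const, of "prob N"] in auto)
    then have "prob N \<le> 0" using c by (simp add: mult_le_0_iff)
    then show ?thesis using measure_nonneg[of M N] unfolding N_def by linarith
  qed
  then have "AE \<omega> in M. \<not> (\<forall>s\<ge>t. Z s \<omega> \<in> S)" for t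
    by (subst AE_iff_measurable[OF _ refl]) (auto simp: emeasure_eq_measure)
  then have "AE \<omega> in M. \<forall>t. \<not> (\<forall>s\<ge>t. Z s \<omega> \<in> S)" by (simp add: AE_all_countable)
  then show ?thesis by (auto simp: frequently_sequentially elim!: eventually_mono)
qed

end

section \<open>Reflected walks between two powers\<close>

text \<open>
  Inside the domain the two reflection conditions reduce to one inequality each: a step to the right
  would cross the lower boundary, or a step up would cross the upper one.
\<close>

definition low :: "real \<Rightarrow> state \<Rightarrow> bool" where
  "low \<alpha> = (\<lambda>(x, y). real y < real (x + 1) powr \<alpha>)"

definition upp :: "real \<Rightarrow> state \<Rightarrow> bool" where
  "upp \<gamma> = (\<lambda>(x, y). real x powr \<gamma> < real y + 1)"

definition up_prob :: "real \<Rightarrow> real \<Rightarrow> nat \<Rightarrow> nat \<Rightarrow> real" where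
  "up_prob \<beta>1 \<beta>2 x y = real y powr \<beta>2 / (real x powr \<beta>1 + real y powr \<beta>2)"

text \<open>
  The set A contains the states that the walk can reach. Only the behaviour of the kernel on A is
  prescribed, in a form that survives an exchange of the two coordinates.
\<close>

locale reflected_walk = markov_chain M K z Z
  for M :: "'a measure" and K :: "state \<Rightarrow> state pmf" and z :: state and Z :: "nat \<Rightarrow> 'a \<Rightarrow> state" +
  fixes A :: "state set" and \<alpha> \<gamma> \<beta>1 \<beta>2 :: real
  assumes start: "z \<in> A"
    and closed: "u \<in> A \<Longrightarrow> set_pmf (K u) \<subseteq> A"
    and x_ge_1: "(x, y) \<in> A \<Longrightarrow> 1 \<le> x" and y_ge_1: "(x, y) \<in> A \<Longrightarrow> 1 \<le> y"
    and above: "(x, y) \<in> A \<Longrightarrow> real x powr \<alpha> \<le> real y"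
    and below: "(x, y) \<in> A \<Longrightarrow> real y \<le> real x powr \<gamma>"
    and not_low_upp: "u \<in> A \<Longrightarrow> \<not> (low \<alpha> u \<and> upp \<gamma> u)"
    and K_low: "(x, y) \<in> A \<Longrightarrow> low \<alpha> (x, y) \<Longrightarrow> K (x, y) = return_pmf (x, y + 1)"
    and K_upp: "(x, y) \<in> A \<Longrightarrow> upp \<gamma> (x, y) \<Longrightarrow> K (x, y) = return_pmf (x + 1, y)"
    and K_interior: "(x, y) \<in> A \<Longrightarrow> \<not> low \<alpha> (x, y) \<Longrightarrow> \<not> upp \<gamma> (x, y) \<Longrightarrow>
      K (x, y) = map_pmf (\<lambda>right. if right then (x + 1, y) else (x, y + 1)) (bernoulli_pmf (1 - up_prob \<beta>1 \<beta>2 x y))"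
    and parameters: "0 < \<alpha>" "\<alpha> < \<gamma>" "1 < \<beta>1" "1 < \<beta>2"
begin

abbreviation pu :: "nat \<Rightarrow> nat \<Rightarrow> real" where
  "pu \<equiv> up_prob \<beta>1 \<beta>2"

lemma up_prob_bounds: "0 \<le> pu x y" "pu x y \<le> 1"
proof -
  show "0 \<le> pu x y" by (simp add: up_prob_def)
  show "pu x y \<le> 1"
    unfolding up_prob_def by (rule divide_le_eq_1[THEN iffD2]) (use powr_ge_zero[of "real x" \<beta>1] powr_ge_zero[of "real y" \<beta>2] in linarith)
qed

lemma expectation_interior:
  fixes f :: "state \<Rightarrow> real"
  assumes "(x, y) \<in> A" "\<not> low \<alpha> (x, y)" "\<not> upp \<gamma> (x, y)"
  shows "measure_pmf.expectation (K (x, y)) f = pu x y * f (x, y + 1) + (1 - pu x y) * f (x + 1, y)"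
  using up_prob_bounds[of x y] by (simp add: K_interior[OF assms])

lemma set_K:
  assumes "(x, y) \<in> A"
  shows "set_pmf (K (x, y)) \<subseteq> {(x + 1, y), (x, y + 1)}"
    and "low \<alpha> (x, y) \<Longrightarrow> set_pmf (K (x, y)) = {(x, y + 1)}"
    and "upp \<gamma> (x, y) \<Longrightarrow> set_pmf (K (x, y)) = {(x + 1, y)}"
proof -
  show "low \<alpha> (x, y) \<Longrightarrow> set_pmf (K (x, y)) = {(x, y + 1)}"
    and "upp \<gamma> (x, y) \<Longrightarrow> set_pmf (K (x, y)) = {(x + 1, y)}"
    using assms by (auto simp: K_low K_upp)
  then show "set_pmf (K (x, y)) \<subseteq> {(x + 1, y), (x, y + 1)}"
    using K_interior[OF assms] by (cases "low \<alpha> (x, y) \<or> upp \<gamma> (x, y)") auto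
qed

lemma finite_set_K: "u \<in> A \<Longrightarrow> finite (set_pmf (K u))"
  using set_K(1)[of "fst u" "snd u"] finite_subset by fastforce

lemma powr_le_inverse: "(x, y) \<in> A \<Longrightarrow> real x \<le> real y powr (1 / \<alpha>)"
  using above[of x y] parameters powr_mono2[of "1 / \<alpha>" "real x powr \<alpha>" "real y"] by (simp add: powr_powr)

lemma level_le_x: "(x, y) \<in> A \<Longrightarrow> real x \<le> B \<Longrightarrow> real (x + y) \<le> B + B powr \<gamma>"
  using below[of x y] powr_mono2[of \<gamma> "real x" B] parameters by simp

lemma level_le_y: "(x, y) \<in> A \<Longrightarrow> real y \<le> B \<Longrightarrow> real (x + y) \<le> B powr (1 / \<alpha>) + B"
  using powr_le_inverse[of x y] powr_mono2[of "1 / \<alpha>" "real y" B] parameters by simp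

lemma level_large:
  "\<exists>L. \<forall>x y. (x, y) \<in> A \<longrightarrow> L \<le> x + y \<longrightarrow> B < x \<and> B < y"
proof -
  define b where "b = real B + real B powr \<gamma> + real B powr (1 / \<alpha>)"
  obtain L where "b < real L" using reals_Archimedean2 by blast
  have "B < x \<and> B < y" if "(x, y) \<in> A" "L \<le> x + y" for x y
  proof -
    have "b < real (x + y)" using \<open>b < real L\<close> that(2) by linarith
    moreover have "0 \<le> real B powr \<gamma>" "0 \<le> real B powr (1 / \<alpha>)" by auto
    ultimately have "\<not> real x \<le> real B" "\<not> real y \<le> real B"
      using level_le_x[OF that(1), of B] level_le_y[OF that(1), of B] unfolding b_def by linarith+
    then show ?thesis by simp
  qed
  then show ?thesis by blast
qed

definition valid_path :: "(nat \<Rightarrow> state) \<Rightarrow> bool" where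
  "valid_path s \<longleftrightarrow> s 0 = z \<and> (\<forall>t. s t \<in> A) \<and> (\<forall>t. s (Suc t) \<in> set_pmf (K (s t)))"

lemma AE_valid_path: "AE \<omega> in M. valid_path (\<lambda>t. Z t \<omega>)"
proof (rule eventually_mono[OF AE_step])
  fix \<omega> assume *: "Z 0 \<omega> = z \<and> (\<forall>t. Z (Suc t) \<omega> \<in> set_pmf (K (Z t \<omega>)))"
  have "Z t \<omega> \<in> A" for t
  proof (induction t)
    case (Suc t)
    then show ?case using closed[of "Z t \<omega>"] * by blast
  qed (use * start in simp)
  with * show "valid_path (\<lambda>t. Z t \<omega>)" by (simp add: valid_path_def)
qed

lemma valid_path_A: "valid_path s \<Longrightarrow> s t \<in> A"
  by (simp add: valid_path_def)

lemma valid_path_step: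
  assumes "valid_path s"
  obtains (right) "s (Suc t) = (fst (s t) + 1, snd (s t))" "\<not> low \<alpha> (s t)"
    | (up) "s (Suc t) = (fst (s t), snd (s t) + 1)" "\<not> upp \<gamma> (s t)"
proof -
  have "s t \<in> A" "s (Suc t) \<in> set_pmf (K (s t))" using assms by (auto simp: valid_path_def)
  then have "s (Suc t) \<in> {(fst (s t) + 1, snd (s t)), (fst (s t), snd (s t) + 1)}"
    "low \<alpha> (s t) \<Longrightarrow> s (Suc t) = (fst (s t), snd (s t) + 1)"
    "upp \<gamma> (s t) \<Longrightarrow> s (Suc t) = (fst (s t) + 1, snd (s t))"
    using set_K[of "fst (s t)" "snd (s t)"] unfolding prod.collapse by blast+
  then show ?thesis using that by fastforce
qed

lemma valid_path_level: "valid_path s \<Longrightarrow> fst (s t) + snd (s t) = t + (fst z + snd z)"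
proof (induction t)
  case 0
  then show ?case by (simp add: valid_path_def)
next
  case (Suc t)
  then show ?case by (auto elim: valid_path_step[of s t])
qed

lemma valid_path_mono:
  assumes "valid_path s" "t \<le> t'"
  shows "fst (s t) \<le> fst (s t')" "snd (s t) \<le> snd (s t')"
proof -
  have "fst (s t) \<le> fst (s (Suc t))" "snd (s t) \<le> snd (s (Suc t))" for t
    by (rule valid_path_step[OF assms(1), of t]; simp)+
  then show "fst (s t) \<le> fst (s t')" "snd (s t) \<le> snd (s t')"
    using lift_Suc_mono_le[OF _ assms(2), of "\<lambda>t. fst (s t)"] lift_Suc_mono_le[OF _ assms(2), of "\<lambda>t. snd (s t)"] by auto
qed

lemma valid_path_tendsto:
  assumes "valid_path s"
  shows "filterlim (\<lambda>t. fst (s t)) at_top sequentially" "filterlim (\<lambda>t. snd (s t)) at_top sequentially"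
proof -
  have ev: "eventually (\<lambda>t. B < fst (s t) \<and> B < snd (s t)) sequentially" for B
  proof -
    obtain L where L: "\<And>x y. (x, y) \<in> A \<Longrightarrow> L \<le> x + y \<Longrightarrow> B < x \<and> B < y" using level_large[of B] by blast
    have "B < fst (s t) \<and> B < snd (s t)" if "t \<ge> L" for t
      using L[of "fst (s t)" "snd (s t)"] valid_path_A[OF assms, of t] valid_path_level[OF assms, of t] that by simp
    then show ?thesis by (auto simp: eventually_sequentially)
  qed
  show "filterlim (\<lambda>t. fst (s t)) at_top sequentially"
    unfolding filterlim_at_top
  proof
    fix B show "eventually (\<lambda>t. B \<le> fst (s t)) sequentially"
      using ev[of B] by (rule eventually_mono) simp
  qed
  show "filterlim (\<lambda>t. snd (s t)) at_top sequentially"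
    unfolding filterlim_at_top
  proof
    fix B show "eventually (\<lambda>t. B \<le> snd (s t)) sequentially"
      using ev[of B] by (rule eventually_mono) simp
  qed
qed

end

section \<open>Recurrence of the reflections\<close>

text \<open>
  In Rubin's embedding the coordinates grow as two independent pure birth processes with rates
  \<open>x powr \<beta>1\<close> and \<open>y powr \<beta>2\<close>. The tail sums with exponents \<open>\<beta>1\<close>, \<open>\<beta>2\<close> are the expected times
  that they still need to explode; those with doubled exponents are the variances of these times.
\<close>

definition tail_sum :: "real \<Rightarrow> nat \<Rightarrow> real" where
  "tail_sum b x = (\<Sum>i. real (x + i) powr - b)"

lemma tail_sum:
  assumes "1 < b"
  shows tail_sum_Suc: "tail_sum b x = real x powr - b + tail_sum b (Suc x)"
    and tail_sum_ge: "real x powr - b \<le> tail_sum b x"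
    and tail_sum_nonneg: "0 \<le> tail_sum b x"
    and tail_sum_tendsto: "tail_sum b \<longlonglongrightarrow> 0"
proof -
  have s: "summable (\<lambda>i. real i powr - b)" using assms by (simp add: summable_real_powr_iff)
  have sx: "summable (\<lambda>i. real (x + i) powr - b)" for x
    using summable_ignore_initial_segment[OF s, of x] by (simp add: add.commute)
  show nonneg: "0 \<le> tail_sum b x" for x
    unfolding tail_sum_def by (rule suminf_nonneg[OF sx]) simp
  show Suc: "tail_sum b x = real x powr - b + tail_sum b (Suc x)"
    using suminf_split_head[OF sx[of x]] by (simp add: tail_sum_def)
  show "real x powr - b \<le> tail_sum b x" using Suc nonneg[of "Suc x"] by simp
  have "(\<lambda>n. \<Sum>i. real (i + n) powr - b) \<longlonglongrightarrow> 0"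
  proof (rule LIMSEQ_I)
    fix r :: real assume "0 < r"
    from suminf_exist_split[OF this s] show "\<exists>no. \<forall>n\<ge>no. norm ((\<Sum>i. real (i + n) powr - b) - 0) < r" by auto
  qed
  then show "tail_sum b \<longlonglongrightarrow> 0" unfolding tail_sum_def[abs_def] by (simp add: add.commute)
qed

text \<open>
  Adding a centred Gaussian of variance W to D gives the fourth moment
  \<open>D ^ 4 + 6 * D\<^sup>2 * W + 3 * W\<^sup>2\<close>. Raising the coefficients to 8 and 19 turns this into a
  supermartingale along the walk: the excess of 8 over 6 absorbs the third-moment term by completing
  a square, and 19 absorbs what the square leaves over.
\<close>

lemma fourth_moment_step:
  fixes u v D W :: real
  assumes u: "0 < u" and v: "0 < v" and W: "u\<^sup>2 + v\<^sup>2 \<le> W"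
  defines "p \<equiv> u / (u + v)"
  defines "F \<equiv> \<lambda>D W. D ^ 4 + 8 * D\<^sup>2 * W + 19 * W\<^sup>2"
  shows "p * F (D + v) (W - v\<^sup>2) + (1 - p) * F (D - u) (W - u\<^sup>2) \<le> F D W"
proof -
  have q: "1 - p = v / (u + v)" using u v by (simp add: p_def field_simps)
  have "p * F (D + v) (W - v\<^sup>2) + (1 - p) * F (D - u) (W - u\<^sup>2) - F D W
      = (u * F (D + v) (W - v\<^sup>2) + v * F (D - u) (W - u\<^sup>2) - (u + v) * F D W) / (u + v)"
  proof -
    have "u / (u + v) * a + v / (u + v) * b - c = (u * a + v * b - (u + v) * c) / (u + v)" for a b c
      using u v by (simp add: divide_simps)
    then show ?thesis unfolding q unfolding p_def .
  qed
  also have "u * F (D + v) (W - v\<^sup>2) + v * F (D - u) (W - u\<^sup>2) - (u + v) * F D W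
      = (u + v) * (u * v * (- 2 * D\<^sup>2 - 12 * D * (v - u) + 12 * (u\<^sup>2 - u * v + v\<^sup>2) - 30 * W))"
    unfolding F_def by algebra
  also have "\<dots> / (u + v) = u * v * (- 2 * D\<^sup>2 - 12 * D * (v - u) + 12 * (u\<^sup>2 - u * v + v\<^sup>2) - 30 * W)"
    using u v by simp
  also have "\<dots> \<le> 0"
  proof (rule mult_nonneg_nonpos)
    have "0 \<le> (D + 3 * (v - u))\<^sup>2" by simp
    then have "- 2 * D\<^sup>2 - 12 * D * (v - u) \<le> 18 * (v - u)\<^sup>2"
      by (simp add: power2_eq_square algebra_simps)
    moreover have "0 \<le> u * v" using u v by simp
    ultimately show "- 2 * D\<^sup>2 - 12 * D * (v - u) + 12 * (u\<^sup>2 - u * v + v\<^sup>2) - 30 * W \<le> 0"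
      using W by (simp add: power2_eq_square algebra_simps)
  qed (use u v in simp)
  finally show ?thesis by simp
qed

context reflected_walk begin

text \<open>
  Up to reflection, \<open>clock_gap\<close> and \<open>clock_gap\<^sup>2 + clock_variance\<close> are martingales: the first two
  conditional moments of the difference of the two explosion times.
\<close>

definition clock_gap where "clock_gap = (\<lambda>(x, y). tail_sum \<beta>1 x - tail_sum \<beta>2 y)"
definition clock_variance where "clock_variance = (\<lambda>(x, y). tail_sum (2 * \<beta>1) x + tail_sum (2 * \<beta>2) y)"

text \<open>
  Paley-Zygmund for N, the conditional second moment of the difference of the explosion times: until
  reflection N is a martingale and F a supermartingale with \<open>N\<^sup>2 \<le> F \<le> 19 * N\<^sup>2\<close>. On paths without reflection N tends to 0, since both
  coordinates tend to infinity there; so the mean of N must be carried by the reflected paths, and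
  the bound on the second moment then forces them to have probability at least 1 / 19.
\<close>

lemma interior_hit_prob:
  assumes "u \<in> A"
  shows "1 / 19 \<le> hit_prob K UNIV {u. low \<alpha> u \<or> upp \<gamma> u} u"
proof -
  define T where "T = {u. low \<alpha> u \<or> upp \<gamma> u}"
  define N where "N u = (clock_gap u)\<^sup>2 + clock_variance u" for u
  define F where "F u = clock_gap u ^ 4 + 8 * (clock_gap u)\<^sup>2 * clock_variance u + 19 * (clock_variance u)\<^sup>2" for u
  have b: "1 < \<beta>1" "1 < \<beta>2" "1 < 2 * \<beta>1" "1 < 2 * \<beta>2" using parameters by auto
  have clock_variance_nonneg: "0 \<le> clock_variance u" for u
    using tail_sum_nonneg[OF b(3)] tail_sum_nonneg[OF b(4)] by (auto simp: clock_variance_def split: prod.split)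
  have N_nonneg: "0 \<le> N u" for u using clock_variance_nonneg by (simp add: N_def)
  have NF: "(N u)\<^sup>2 \<le> F u" "F u \<le> 19 * (N u)\<^sup>2" for u
  proof -
    have "0 \<le> (clock_gap u)\<^sup>2 * clock_variance u" "0 \<le> (clock_variance u)\<^sup>2" "0 \<le> clock_gap u ^ 4" using clock_variance_nonneg by auto
    then show "(N u)\<^sup>2 \<le> F u" "F u \<le> 19 * (N u)\<^sup>2"
      unfolding N_def F_def by (auto simp: power2_sum power2_eq_square power4_eq_xxxx algebra_simps)
  qed
  have step: "measure_pmf.expectation (K (x, y)) N = N (x, y)" "measure_pmf.expectation (K (x, y)) F \<le> F (x, y)"
    if xy: "(x, y) \<in> A" "(x, y) \<notin> T" for x y
  proof -
    define a b where "a = real x powr - \<beta>1" and "b = real y powr - \<beta>2"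
    have pos: "0 < a" "0 < b" using x_ge_1[OF xy(1)] y_ge_1[OF xy(1)] by (auto simp: a_def b_def)
    have sq: "a\<^sup>2 = real x powr - (2 * \<beta>1)" "b\<^sup>2 = real y powr - (2 * \<beta>2)"
      by (auto simp: a_def b_def power2_eq_square powr_add[symmetric])
    have p: "pu x y = a / (a + b)"
      using x_ge_1[OF xy(1)] y_ge_1[OF xy(1)] by (simp add: up_prob_def a_def b_def powr_minus field_simps)
    have d: "clock_gap (x + 1, y) = clock_gap (x, y) - a" "clock_gap (x, y + 1) = clock_gap (x, y) + b"
      "clock_variance (x + 1, y) = clock_variance (x, y) - a\<^sup>2" "clock_variance (x, y + 1) = clock_variance (x, y) - b\<^sup>2"
      using tail_sum_Suc[OF \<open>1 < \<beta>1\<close>, of x] tail_sum_Suc[OF \<open>1 < \<beta>2\<close>, of y]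
        tail_sum_Suc[OF \<open>1 < 2 * \<beta>1\<close>, of x] tail_sum_Suc[OF \<open>1 < 2 * \<beta>2\<close>, of y]
      unfolding clock_gap_def clock_variance_def sq by (auto simp: a_def b_def)
    have W: "a\<^sup>2 + b\<^sup>2 \<le> clock_variance (x, y)"
      using tail_sum_ge[OF \<open>1 < 2 * \<beta>1\<close>, of x] tail_sum_ge[OF \<open>1 < 2 * \<beta>2\<close>, of y] by (simp add: clock_variance_def sq)
    note E = expectation_interior[OF xy(1)]
    show "measure_pmf.expectation (K (x, y)) F \<le> F (x, y)"
      using fourth_moment_step[OF pos W, of "clock_gap (x, y)"] xy(2)
      by (subst E) (auto simp: T_def F_def d[simplified] p)
    have "a / (a + b) * ((D + b)\<^sup>2 + (V - b\<^sup>2)) + (1 - a / (a + b)) * ((D - a)\<^sup>2 + (V - a\<^sup>2)) = D\<^sup>2 + V" for D V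
    proof -
      have "1 - a / (a + b) = b / (a + b)" using pos by (simp add: field_simps)
      moreover have "a * ((D + b)\<^sup>2 + (V - b\<^sup>2)) + b * ((D - a)\<^sup>2 + (V - a\<^sup>2)) = (a + b) * (D\<^sup>2 + V)" by algebra
      ultimately show ?thesis using pos by (simp add: add_divide_distrib[symmetric])
    qed
    then show "measure_pmf.expectation (K (x, y)) N = N (x, y)"
      using xy(2) by (subst E) (auto simp: T_def N_def d[simplified] p)
  qed
  have N_pos: "0 < N u" if "u \<in> A" for u
  proof -
    obtain x y where u: "u = (x, y)" by (cases u)
    have pos: "0 < real x powr - (2 * \<beta>1)" using x_ge_1[of x y] that u by simp
    then have "0 < clock_variance u"
      using pos tail_sum_ge[OF b(3), of x] tail_sum_nonneg[OF b(4), of y] unfolding u clock_variance_def prod.case by linarith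
    then show ?thesis by (simp add: N_def add_nonneg_pos)
  qed
  have N_small: "\<exists>L. \<forall>x y. (x, y) \<in> A \<longrightarrow> L \<le> x + y \<longrightarrow> N (x, y) \<le> \<epsilon>" if "0 < \<epsilon>" for \<epsilon>
  proof -
    have lim: "(\<lambda>x. (tail_sum b x)\<^sup>2 + tail_sum (2 * b) x) \<longlonglongrightarrow> 0" if "1 < b" for b
      using tendsto_add[OF tendsto_power[OF tail_sum_tendsto[OF that], of 2] tail_sum_tendsto[of "2 * b"]] that by simp
    have "eventually (\<lambda>x. (tail_sum \<beta>1 x)\<^sup>2 + tail_sum (2 * \<beta>1) x < \<epsilon> / 2 \<and> (tail_sum \<beta>2 x)\<^sup>2 + tail_sum (2 * \<beta>2) x < \<epsilon> / 2) sequentially"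
      using \<open>0 < \<epsilon>\<close> by (intro eventually_conj order_tendstoD[OF lim] b) auto
    then obtain B where B: "\<And>x. B \<le> x \<Longrightarrow> (tail_sum \<beta>1 x)\<^sup>2 + tail_sum (2 * \<beta>1) x < \<epsilon> / 2 \<and> (tail_sum \<beta>2 x)\<^sup>2 + tail_sum (2 * \<beta>2) x < \<epsilon> / 2"
      by (auto simp: eventually_sequentially)
    obtain L where L: "\<And>x y. (x, y) \<in> A \<Longrightarrow> L \<le> x + y \<Longrightarrow> B < x \<and> B < y" using level_large[of B] by blast
    have "N (x, y) \<le> \<epsilon>" if "(x, y) \<in> A" "L \<le> x + y" for x y
    proof -
      have "(clock_gap (x, y))\<^sup>2 \<le> (tail_sum \<beta>1 x)\<^sup>2 + (tail_sum \<beta>2 y)\<^sup>2"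
        using mult_nonneg_nonneg[OF tail_sum_nonneg[OF b(1), of x] tail_sum_nonneg[OF b(2), of y]]
        by (simp add: clock_gap_def power2_diff)
      then show ?thesis using B[of x] B[of y] L[OF that] by (simp add: N_def clock_variance_def)
    qed
    then show ?thesis by blast
  qed
  obtain x0 y0 where u: "u = (x0, y0)" by (cases u)
  define \<theta> where "\<theta> = 1 / (38 * N u)"
  have \<theta>: "0 < \<theta>" using N_pos[OF assms] by (simp add: \<theta>_def)
  \<comment> \<open>The bound \<open>N \<le> \<theta> * N\<^sup>2 + 1 / (4 * \<theta>)\<close> on the target stands in for the Cauchy-Schwarz inequality.\<close>
  have "N u \<le> \<theta> * F u + 1 / (4 * \<theta>) * hit_prob K UNIV T u + \<epsilon>" if \<epsilon>: "0 < \<epsilon>" for \<epsilon>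
  proof -
    obtain L where L: "\<And>x y. (x, y) \<in> A \<Longrightarrow> L \<le> x + y \<Longrightarrow> N (x, y) \<le> \<epsilon>" using N_small[OF \<epsilon>] by blast
    have "N (x, y) \<le> \<theta> * F (x, y) + 1 / (4 * \<theta>) * reach_prob K UNIV T n (x, y) + \<epsilon>"
      if "(x, y) \<in> A" "L \<le> x + y + n" for n x y
      using that
    proof (induction n arbitrary: x y)
      have inT: "N (x, y) \<le> \<theta> * F (x, y) + 1 / (4 * \<theta>) + \<epsilon>" for x y
      proof -
        have "0 \<le> (2 * \<theta> * N (x, y) - 1)\<^sup>2" by simp
        then have "4 * \<theta> * N (x, y) \<le> 4 * \<theta> * (\<theta> * (N (x, y))\<^sup>2 + 1 / (4 * \<theta>))"
          using \<theta> by (simp add: power2_eq_square algebra_simps)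
        then have "N (x, y) \<le> \<theta> * (N (x, y))\<^sup>2 + 1 / (4 * \<theta>)"
          using \<theta> by (metis mult_le_cancel_left_pos zero_less_mult_iff zero_less_numeral)
        moreover have "\<theta> * (N (x, y))\<^sup>2 \<le> \<theta> * F (x, y)" using \<theta> NF(1)[of "(x, y)"] by simp
        ultimately show ?thesis using \<epsilon> by linarith
      qed
      {
        case 0
        have "0 \<le> \<theta> * F (x, y)" using \<theta> NF(1)[of "(x, y)"] by (intro mult_nonneg_nonneg) (auto intro: order_trans[rotated])
        then show ?case using inT[of x y] L[of x y] 0 by auto
      next
        case (Suc n)
        show ?case
        proof (cases "(x, y) \<in> T")
          case True
          then show ?thesis using inT[of x y] by simp
        next
          case False
          let ?E = "measure_pmf.expectation (K (x, y))"
          have int: "integrable (measure_pmf (K (x, y))) f" for f :: "state \<Rightarrow> real"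
            using Suc by (intro integrable_measure_pmf_finite finite_set_K)
          have "N (x, y) = ?E N" using step(1) Suc False by simp
          also have "\<dots> \<le> ?E (\<lambda>v. \<theta> * F v + 1 / (4 * \<theta>) * reach_prob K UNIV T n v + \<epsilon>)"
          proof (rule integral_mono_AE[OF int int])
            have "N v \<le> \<theta> * F v + 1 / (4 * \<theta>) * reach_prob K UNIV T n v + \<epsilon>" if "v \<in> set_pmf (K (x, y))" for v
            proof -
              have v: "v \<in> A" "v \<in> {(x + 1, y), (x, y + 1)}" using closed set_K(1) Suc that by blast+
              then show ?thesis
                using Suc.IH[of "fst v" "snd v"] Suc.prems by (cases v) auto
            qed
            then show "AE v in K (x, y). N v \<le> \<theta> * F v + 1 / (4 * \<theta>) * reach_prob K UNIV T n v + \<epsilon>"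
              by (simp add: AE_measure_pmf_iff)
          qed
          also have "\<dots> = \<theta> * ?E F + 1 / (4 * \<theta>) * ?E (reach_prob K UNIV T n) + \<epsilon>"
            using int by simp
          also have "\<dots> \<le> \<theta> * F (x, y) + 1 / (4 * \<theta>) * reach_prob K UNIV T (Suc n) (x, y) + \<epsilon>"
            using step(2) Suc False \<theta> by simp
          finally show ?thesis .
        qed
      }
    qed
    then have "N u \<le> \<theta> * F u + 1 / (4 * \<theta>) * reach_prob K UNIV T L u + \<epsilon>"
      using assms u by simp
    also have "\<dots> \<le> \<theta> * F u + 1 / (4 * \<theta>) * hit_prob K UNIV T u + \<epsilon>"
      using \<theta> reach_prob_le_hit_prob by (intro add_mono mult_left_mono order_refl) auto
    finally show ?thesis .
  qed
  then have "N u \<le> \<theta> * F u + 1 / (4 * \<theta>) * hit_prob K UNIV T u" by (rule field_le_epsilon)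
  moreover have "\<theta> * F u \<le> N u / 2"
  proof -
    have "\<theta> * F u \<le> \<theta> * (19 * (N u)\<^sup>2)" using \<theta> NF(2) by (intro mult_left_mono) auto
    then show ?thesis using N_pos[OF assms] by (simp add: \<theta>_def power2_eq_square)
  qed
  moreover have "1 / (4 * \<theta>) = 19 / 2 * N u" using N_pos[OF assms] by (simp add: \<theta>_def)
  ultimately have "N u * 1 \<le> N u * (19 * hit_prob K UNIV T u)" by simp
  then show ?thesis using N_pos[OF assms] by (simp add: T_def)
qed

lemma AE_frequently_reflected: "AE \<omega> in M. \<exists>\<^sub>F t in sequentially. low \<alpha> (Z t \<omega>) \<or> upp \<gamma> (Z t \<omega>)"
proof -
  have "AE \<omega> in M. \<exists>\<^sub>F t in sequentially. Z t \<omega> \<notin> - {u. low \<alpha> u \<or> upp \<gamma> u}"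
  proof (rule AE_frequently_outside[where A=A and c="1 / 19"])
    show "AE \<omega> in M. \<forall>t. Z t \<omega> \<in> A" using AE_valid_path by (auto simp: valid_path_def elim: eventually_mono)
  qed (use interior_hit_prob in auto)
  then show ?thesis by simp
qed

end

section \<open>Few extra ups between reflections at the lower boundary\<close>

lemma powr_diff_le:
  fixes a x c :: real
  assumes "1 \<le> a" "0 < x" "0 \<le> c"
  shows "(x + c) powr a - x powr a \<le> a * c * (x + c) powr (a - 1)"
proof (cases "c = 0")
  case False
  have "\<exists>z>x. z < x + c \<and> (x + c) powr a - x powr a = (x + c - x) * (a * z powr (a - 1))"
    using assms False by (intro MVT2) (auto intro!: derivative_eq_intros)
  then obtain y where y: "x < y" "y < x + c" "(x + c) powr a - x powr a = c * (a * y powr (a - 1))" by auto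
  have "y powr (a - 1) \<le> (x + c) powr (a - 1)" using y assms by (intro powr_mono2) auto
  then have "c * (a * y powr (a - 1)) \<le> c * (a * (x + c) powr (a - 1))"
    using assms by (intro mult_left_mono) auto
  then show ?thesis using y by (simp add: mult_ac)
qed simp

lemma powr_concave_diff_le:
  fixes a x c :: real
  assumes "0 \<le> a" "a \<le> 1" "0 < x" "0 \<le> c"
  shows "(x + c) powr a - x powr a \<le> a * c * x powr (a - 1)"
proof (cases "c = 0")
  case False
  have "\<exists>z>x. z < x + c \<and> (x + c) powr a - x powr a = (x + c - x) * (a * z powr (a - 1))"
    using assms False by (intro MVT2) (auto intro!: derivative_eq_intros)
  then obtain y where y: "x < y" "y < x + c" "(x + c) powr a - x powr a = c * (a * y powr (a - 1))" by auto
  have "y powr (a - 1) \<le> x powr (a - 1)" using y assms by (intro powr_mono2') auto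
  then have "c * (a * y powr (a - 1)) \<le> c * (a * x powr (a - 1))"
    using assms by (intro mult_left_mono) auto
  then show ?thesis using y by (simp add: mult_ac)
qed simp

lemma reaches_mono: "n \<le> m \<Longrightarrow> reaches R T n s \<Longrightarrow> reaches R T m s"
  unfolding reaches_def using order_trans by blast

lemma (in markov_chain) prob_ever_reaches_le:
  assumes "\<And>u n. u \<in> U \<Longrightarrow> reach_prob K R T n u \<le> c" "0 \<le> c"
  shows "prob {\<omega>\<in>space M. Z t \<omega> \<in> U \<and> (\<exists>n. reaches R T n (\<lambda>i. Z (t + i) \<omega>))} \<le> c"
proof -
  have "(\<lambda>n. prob {\<omega>\<in>space M. True \<and> Z t \<omega> \<in> U \<and> reaches R T n (\<lambda>i. Z (t + i) \<omega>)}) \<longlonglongrightarrow>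
    prob (\<Union>n. {\<omega>\<in>space M. True \<and> Z t \<omega> \<in> U \<and> reaches R T n (\<lambda>i. Z (t + i) \<omega>)})"
  proof (rule finite_Lim_measure_incseq)
    show "incseq (\<lambda>n. {\<omega>\<in>space M. True \<and> Z t \<omega> \<in> U \<and> reaches R T n (\<lambda>i. Z (t + i) \<omega>)})"
      by (auto simp: incseq_def intro: reaches_mono)
  qed auto
  moreover have "prob {\<omega>\<in>space M. True \<and> Z t \<omega> \<in> U \<and> reaches R T n (\<lambda>i. Z (t + i) \<omega>)} \<le> c" for n
  proof -
    have "prob {\<omega>\<in>space M. True \<and> Z t \<omega> \<in> U \<and> reaches R T n (\<lambda>i. Z (t + i) \<omega>)} \<le> c * prob {\<omega>\<in>space M. True \<and> Z t \<omega> \<in> U}"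
      using assms by (rule prob_reaches_le)
    also have "\<dots> \<le> c" using assms(2) by (intro mult_left_le) auto
    finally show ?thesis .
  qed
  ultimately have "prob (\<Union>n. {\<omega>\<in>space M. True \<and> Z t \<omega> \<in> U \<and> reaches R T n (\<lambda>i. Z (t + i) \<omega>)}) \<le> c"
    by (intro LIMSEQ_le_const2) auto
  also have "(\<Union>n. {\<omega>\<in>space M. True \<and> Z t \<omega> \<in> U \<and> reaches R T n (\<lambda>i. Z (t + i) \<omega>)}) =
    {\<omega>\<in>space M. Z t \<omega> \<in> U \<and> (\<exists>n. reaches R T n (\<lambda>i. Z (t + i) \<omega>))}" by auto
  finally show ?thesis .
qed

lemma (in markov_chain) AE_eventually_not_reaches:
  assumes "\<And>n u m. n \<ge> n0 \<Longrightarrow> u \<in> U n \<Longrightarrow> reach_prob K (R n) (T n) m u \<le> c n"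
    and "summable c" "\<And>n. 0 \<le> c n"
  shows "AE \<omega> in M. eventually (\<lambda>n. \<not> (Z (\<tau> n) \<omega> \<in> U n \<and> (\<exists>m. reaches (R n) (T n) m (\<lambda>i. Z (\<tau> n + i) \<omega>)))) sequentially"
proof -
  define B where "B n = {\<omega>\<in>space M. n \<ge> n0 \<and> Z (\<tau> n) \<omega> \<in> U n \<and> (\<exists>m. reaches (R n) (T n) m (\<lambda>i. Z (\<tau> n + i) \<omega>))}" for n
  have [measurable]: "B n \<in> events" for n unfolding B_def by measurable
  have "prob (B n) \<le> c n" for n
  proof (cases "n \<ge> n0")
    case True
    have "prob {\<omega>\<in>space M. Z (\<tau> n) \<omega> \<in> U n \<and> (\<exists>m. reaches (R n) (T n) m (\<lambda>i. Z (\<tau> n + i) \<omega>))} \<le> c n"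
      by (rule prob_ever_reaches_le) (use assms True in auto)
    then show ?thesis using True by (simp add: B_def)
  qed (use assms in \<open>simp add: B_def\<close>)
  then have "summable (\<lambda>n. prob (B n))"
    by (intro summable_comparison_test'[OF assms(2), of 0]) auto
  then have "AE \<omega> in M. eventually (\<lambda>n. \<omega> \<in> space M - B n) sequentially"
    by (intro borel_cantelli_AE1) (auto simp: emeasure_eq_measure)
  then show ?thesis
  proof (rule eventually_mono)
    fix \<omega> assume "eventually (\<lambda>n. \<omega> \<in> space M - B n) sequentially"
    then show "eventually (\<lambda>n. \<not> (Z (\<tau> n) \<omega> \<in> U n \<and> (\<exists>m. reaches (R n) (T n) m (\<lambda>i. Z (\<tau> n + i) \<omega>)))) sequentially"
      using eventually_ge_at_top[of n0] by eventually_elim (auto simp: B_def)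
  qed
qed

text \<open>
  The abscissa at which the walk is reflected if it stays at level n.
\<close>

definition col :: "real \<Rightarrow> nat \<Rightarrow> nat" where
  "col \<alpha> n = nat \<lfloor>real n powr (1 / \<alpha>)\<rfloor>"

lemma col_le: "real (col \<alpha> n) \<le> real n powr (1 / \<alpha>)"
  and col_gt: "real n powr (1 / \<alpha>) < real (col \<alpha> n) + 1"
  unfolding col_def using of_int_floor_le[of "real n powr (1 / \<alpha>)"] by (auto simp: of_nat_nat)

lemma powr_le_iff_le_powr:
  fixes a x y :: real
  assumes "0 < a" "0 \<le> x" "0 \<le> y"
  shows "x powr a \<le> y \<longleftrightarrow> x \<le> y powr (1 / a)"
proof -
  have y: "(y powr (1 / a)) powr a = y" using assms by (simp add: powr_powr)
  then have "x powr a \<le> y \<longleftrightarrow> x powr a \<le> (y powr (1 / a)) powr a" by (simp only: y)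
  also have "\<dots> \<longleftrightarrow> x \<le> y powr (1 / a)"
    using assms powr_mono2[of a x "y powr (1 / a)"] powr_less_mono2[of a "y powr (1 / a)" x] by fastforce
  finally show ?thesis .
qed

lemma le_col_iff:
  assumes "0 < \<alpha>"
  shows "x \<le> col \<alpha> n \<longleftrightarrow> real x powr \<alpha> \<le> real n"
proof -
  have "real x powr \<alpha> \<le> real n \<longleftrightarrow> real x \<le> real n powr (1 / \<alpha>)"
    using assms by (intro powr_le_iff_le_powr) auto
  also have "\<dots> \<longleftrightarrow> x \<le> col \<alpha> n"
  proof
    assume "real x \<le> real n powr (1 / \<alpha>)"
    with col_gt[of n \<alpha>] have "real x < real (col \<alpha> n + 1)" by simp
    then have "x < col \<alpha> n + 1" by (rule of_nat_less_imp_less)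
    then show "x \<le> col \<alpha> n" by simp
  next
    assume "x \<le> col \<alpha> n"
    then have "real x \<le> real (col \<alpha> n)" by simp
    with col_le[of \<alpha> n] show "real x \<le> real n powr (1 / \<alpha>)" by linarith
  qed
  finally show ?thesis by simp
qed

lemma col_ge_half:
  assumes "0 < \<alpha>" "\<alpha> \<le> 1" "1 \<le> n"
  shows "real n powr (1 / \<alpha>) / 2 \<le> real (col \<alpha> n)" "1 \<le> col \<alpha> n"
proof -
  show 1: "1 \<le> col \<alpha> n" using le_col_iff[OF assms(1), of 1 n] assms(3) by simp
  then show "real n powr (1 / \<alpha>) / 2 \<le> real (col \<alpha> n)" using col_gt[of n \<alpha>] by linarith
qed

context reflected_walk begin

text \<open>
  An excursion from the lower boundary at level n runs to the right for about
  \<open>n powr (1 / \<alpha> - 1)\<close> steps, and each of them is replaced by an up with probability about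
  \<open>n powr (\<beta>2 - \<beta>1 / \<alpha>)\<close>. Thus one extra up costs \<open>n powr - \<delta>\<close>.
\<close>

definition \<delta> :: real where "\<delta> = (\<beta>1 - 1) / \<alpha> - (\<beta>2 - 1)"

lemma low_imp_col: "(x, n) \<in> A \<Longrightarrow> low \<alpha> (x, n) \<Longrightarrow> x = col \<alpha> n"
  using above[of x n] le_col_iff[OF parameters(1), of x n] le_col_iff[OF parameters(1), of "x + 1" n]
  by (auto simp: low_def)

text \<open>
  With p a bound for the probability of an up and X the last column below level k, the function
  \<open>(p * (X + 1 - x)) ^ (k - y)\<close> is a supersolution: each of the \<open>k - y\<close> missing ups has at most
  \<open>X + 1 - x\<close> occasions.
\<close>

lemma excursion_bound:
  assumes n: "1 \<le> n" and k: "n \<le> k" and \<alpha>: "\<alpha> \<le> 1"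
  defines "X \<equiv> real k powr (1 / \<alpha>)"
  defines "p \<equiv> real k powr \<beta>2 / real (col \<alpha> n) powr \<beta>1"
  assumes u: "(x, y) \<in> A" "col \<alpha> n \<le> x" "y \<le> k"
  shows "reach_prob K {u. \<not> low \<alpha> u} {u. snd u = k} m (x, y) \<le> (p * (X + 1 - real x)) ^ (k - y)"
proof -
  define g where "g = (\<lambda>(x, y). (p * (X + 1 - real x)) ^ (k - y))"
  define I where "I = {u \<in> A. col \<alpha> n \<le> fst u \<and> snd u \<le> k}"
  have p: "0 \<le> p" by (simp add: p_def)
  have xX: "real x \<le> X" if "(x, y) \<in> A" "y \<le> k" for x y
    using powr_le_inverse[OF that(1)] powr_mono2[of "1 / \<alpha>" "real y" "real k"] that parameters
    by (simp add: X_def)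
  have "reach_prob K {u. \<not> low \<alpha> u} {u. snd u = k} m (x, y) \<le> g (x, y)"
  proof (rule reach_prob_le_super[where I=I])
    fix v assume v: "v \<in> I"
    then show "finite (set_pmf (K v))" by (simp add: I_def finite_set_K)
    obtain x y where xy: "v = (x, y)" by (cases v)
    with v have A: "(x, y) \<in> A" "col \<alpha> n \<le> x" "y \<le> k" by (auto simp: I_def)
    show "0 \<le> g v" using xX[OF A(1,3)] p by (simp add: g_def xy)
    show "v \<in> {u. snd u = k} \<Longrightarrow> 1 \<le> g v" by (simp add: g_def xy)
    assume T: "v \<notin> {u. snd u = k}" and R: "v \<in> {u. \<not> low \<alpha> u}"
    show "set_pmf (K v) \<subseteq> I"
    proof
      fix w assume w: "w \<in> set_pmf (K v)"
      then have "w \<in> A" "w \<in> {(x + 1, y), (x, y + 1)}" using closed[OF A(1)] set_K(1)[OF A(1)] xy by auto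
      with A T xy show "w \<in> I" by (auto simp: I_def)
    qed
    have "y < k" using T A xy by simp
    have x1: "real x + 1 \<le> X"
    proof -
      have "real (x + 1) powr \<alpha> \<le> real y" using R xy by (simp add: low_def)
      then have "real (x + 1) powr \<alpha> \<le> real k" using \<open>y < k\<close> by linarith
      then have "real (x + 1) \<le> X"
        unfolding X_def using parameters by (subst powr_le_iff_le_powr[symmetric]) auto
      then show ?thesis by simp
    qed
    define L i where "L = X - real x" and "i = k - Suc y"
    have L: "1 \<le> L" using x1 by (simp add: L_def)
    have i: "k - y = Suc i" using \<open>y < k\<close> by (simp add: i_def)
    have g: "g (x, y) = (p * (L + 1)) ^ Suc i" "g (x + 1, y) = (p * L) ^ Suc i" "g (x, y + 1) = (p * (L + 1)) ^ i"
      by (auto simp: g_def i L_def i_def[symmetric] algebra_simps)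
    have gr: "g (x + 1, y) \<le> g (x, y)"
      unfolding g using p L by (intro power_mono mult_left_mono) auto
    show "measure_pmf.expectation (K v) g \<le> g v"
    proof (cases "upp \<gamma> (x, y)")
      case True
      then show ?thesis using gr K_upp[OF A(1)] by (simp add: xy)
    next
      case False
      define q where "q = pu x y"
      have q: "0 \<le> q" "q \<le> p"
      proof -
        have c1: "1 \<le> col \<alpha> n" using parameters \<alpha> n by (intro col_ge_half)
        have "q \<le> real y powr \<beta>2 / real x powr \<beta>1"
          unfolding q_def up_prob_def using c1 A by (intro divide_left_mono mult_pos_pos add_pos_nonneg) auto
        also have "\<dots> \<le> p"
          unfolding p_def using c1 A parameters by (intro frac_le powr_mono2) auto
        finally show "q \<le> p" .
      qed (simp add: q_def up_prob_bounds)
      have q1: "q \<le> 1" by (simp add: q_def up_prob_bounds)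
      have "measure_pmf.expectation (K v) g = q * g (x, y + 1) + (1 - q) * g (x + 1, y)"
        using expectation_interior[OF A(1)] R False by (simp add: xy q_def)
      also have "\<dots> \<le> p * g (x, y + 1) + 1 * g (x + 1, y)"
        using p q q1 L unfolding g by (intro add_mono mult_right_mono) auto
      also have "\<dots> = p ^ Suc i * ((L + 1) ^ i + L ^ i * L)"
      proof -
        have "p * (p * M) ^ i + 1 * (p * L) ^ Suc i = p ^ Suc i * (M ^ i + L ^ i * L)" for M
          by (simp add: power_mult_distrib algebra_simps)
        then show ?thesis unfolding g .
      qed
      also have "\<dots> \<le> p ^ Suc i * ((L + 1) ^ i + (L + 1) ^ i * L)"
        using p L by (intro mult_left_mono add_left_mono mult_right_mono power_mono) auto
      also have "\<dots> = g (x, y)"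
      proof -
        have "p ^ Suc i * (M ^ i + M ^ i * L) = (p * M) ^ i * p * (L + 1)" for M
          by (simp add: power_mult_distrib algebra_simps)
        then show ?thesis unfolding g by (simp only: power_Suc mult_ac)
      qed
      finally show ?thesis by (simp add: xy)
    qed
  qed (use u in \<open>simp add: I_def\<close>)
  then show ?thesis by (simp add: g_def)
qed

definition up_rate :: "nat \<Rightarrow> nat \<Rightarrow> real" where
  "up_rate n k = real k powr \<beta>2 / real (col \<alpha> n) powr \<beta>1 * (real k powr (1 / \<alpha>) + 1 - real (col \<alpha> n))"

lemma up_rate_nonneg:
  assumes "n \<le> k"
  shows "0 \<le> up_rate n k"
proof -
  have "real n powr (1 / \<alpha>) \<le> real k powr (1 / \<alpha>)" using parameters assms by (intro powr_mono2) auto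
  then have "0 \<le> real k powr (1 / \<alpha>) + 1 - real (col \<alpha> n)" using col_le[of \<alpha> n] by linarith
  then show ?thesis unfolding up_rate_def by (intro mult_nonneg_nonneg divide_nonneg_nonneg) auto
qed

lemma excursion_rate:
  assumes \<alpha>: "\<alpha> \<le> 1"
  shows "\<exists>C>0. \<forall>n\<ge>1. up_rate n (n + c) \<le> C * real n powr - \<delta>"
proof -
  define a where "a = 1 / \<alpha>"
  have a: "1 \<le> a" using parameters \<alpha> by (simp add: a_def)
  define B where "B = a * real c * real (c + 1) powr (a - 1) + 2"
  define C where "C = real (c + 1) powr \<beta>2 * 2 powr \<beta>1 * B"
  have B: "0 < B" unfolding B_def using a by (intro add_nonneg_pos mult_nonneg_nonneg) auto
  have "real (n + c) powr \<beta>2 / real (col \<alpha> n) powr \<beta>1 * (real (n + c) powr a + 1 - real (col \<alpha> n)) \<le> C * real n powr - \<delta>"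
    if n: "1 \<le> n" for n
  proof -
    note half = col_ge_half[OF parameters(1) \<alpha> n]
    have nc: "real (n + c) \<le> real (c + 1) * real n" using n mult_left_mono[of 1 "real n" "real c"] by (simp add: algebra_simps)
    have 1: "real (n + c) powr \<beta>2 \<le> real (c + 1) powr \<beta>2 * real n powr \<beta>2"
      using powr_mono2[of \<beta>2, OF _ _ nc] parameters by (simp add: powr_mult)
    have 2: "1 / real (col \<alpha> n) powr \<beta>1 \<le> 2 powr \<beta>1 * real n powr (- a * \<beta>1)"
    proof -
      have "(real n powr a / 2) powr \<beta>1 \<le> real (col \<alpha> n) powr \<beta>1"
        using half parameters unfolding a_def by (intro powr_mono2) auto
      then have "1 / real (col \<alpha> n) powr \<beta>1 \<le> 1 / (real n powr a / 2) powr \<beta>1"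
        using n half by (intro divide_left_mono mult_pos_pos) auto
      also have "\<dots> = 2 powr \<beta>1 * real n powr (- a * \<beta>1)"
        using n by (simp add: powr_divide powr_powr powr_minus field_simps)
      finally show ?thesis .
    qed
    have 3: "real (n + c) powr a + 1 - real (col \<alpha> n) \<le> B * real n powr (a - 1)"
    proof -
      have "real (n + c) powr a - real n powr a \<le> a * real c * real (n + c) powr (a - 1)"
        using powr_diff_le[OF a, of "real n" "real c"] n by simp
      also have "\<dots> \<le> a * real c * (real (c + 1) powr (a - 1) * real n powr (a - 1))"
        using powr_mono2[of "a - 1", OF _ _ nc] a by (intro mult_left_mono) (auto simp: powr_mult)
      finally have "real (n + c) powr a \<le> real n powr a + a * real c * real (c + 1) powr (a - 1) * real n powr (a - 1)"
        by (simp add: algebra_simps)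
      moreover have "real n powr a < real (col \<alpha> n) + 1" using col_gt[of n \<alpha>] by (simp add: a_def)
      moreover have "1 \<le> real n powr (a - 1)" using n a by (intro ge_one_powr_ge_zero) auto
      ultimately show ?thesis unfolding B_def by (simp add: distrib_right)
    qed
    have pos: "0 \<le> real (n + c) powr a + 1 - real (col \<alpha> n)"
    proof -
      have "real n powr a \<le> real (n + c) powr a" using a by (intro powr_mono2) auto
      then show ?thesis using col_le[of \<alpha> n] unfolding a_def by linarith
    qed
    have "real (n + c) powr \<beta>2 / real (col \<alpha> n) powr \<beta>1 * (real (n + c) powr a + 1 - real (col \<alpha> n))
      = real (n + c) powr \<beta>2 * (1 / real (col \<alpha> n) powr \<beta>1) * (real (n + c) powr a + 1 - real (col \<alpha> n))" by simp
    also have "\<dots> \<le> (real (c + 1) powr \<beta>2 * real n powr \<beta>2) * (2 powr \<beta>1 * real n powr (- a * \<beta>1)) * (B * real n powr (a - 1))"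
      using 1 2 3 pos by (intro mult_mono) auto
    also have "\<dots> = C * (real n powr \<beta>2 * real n powr (- a * \<beta>1) * real n powr (a - 1))"
      by (simp add: C_def)
    also have "real n powr \<beta>2 * real n powr (- a * \<beta>1) * real n powr (a - 1) = real n powr - \<delta>"
      unfolding powr_add[symmetric] by (rule arg_cong[where f="\<lambda>e. real n powr e"]) (simp add: \<delta>_def a_def diff_divide_distrib)
    finally show ?thesis .
  qed
  moreover have "0 < C" using B by (simp add: C_def)
  ultimately show ?thesis unfolding up_rate_def a_def by blast
qed

text \<open>
  At late times the walk is at most j + 1 levels above some state, behind it or level with it, at
  which the lower boundary reflects; one of these levels is due to the reflection itself.
\<close>

definition few_ups :: "nat \<Rightarrow> (nat \<Rightarrow> state) \<Rightarrow> bool" where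
  "few_ups j s \<longleftrightarrow> (\<forall>\<^sub>F t in sequentially. \<exists>x n. (x, n) \<in> A \<and> low \<alpha> (x, n) \<and>
     x \<le> fst (s t) \<and> n \<le> snd (s t) \<and> snd (s t) \<le> n + j + 1)"

text \<open>
  Look at the last reflection before time t. If the level has since risen by more than j + 1, then the
  walk has passed through the level n + j + 2 on the way, unreflected: a failed excursion.
\<close>

lemma few_ups_path:
  assumes s: "valid_path s" and low: "\<exists>\<^sub>F t in sequentially. low \<alpha> (s t)"
    and fin: "eventually (\<lambda>n. \<forall>t. s t = (col \<alpha> n, n + 1) \<longrightarrow>
      \<not> (\<exists>m. reaches {u. \<not> low \<alpha> u} {u. snd u = n + j + 2} m (\<lambda>i. s (t + i)))) sequentially"
  shows "few_ups j s"
proof -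
  obtain N where N: "\<And>n t m. n \<ge> N \<Longrightarrow> s t = (col \<alpha> n, n + 1) \<Longrightarrow>
      \<not> reaches {u. \<not> low \<alpha> u} {u. snd u = n + j + 2} m (\<lambda>i. s (t + i))"
    using fin by (auto simp: eventually_sequentially)
  have "eventually (\<lambda>t. N \<le> snd (s t)) sequentially"
    using valid_path_tendsto(2)[OF s] by (auto simp: filterlim_at_top)
  then obtain t0 where t0: "low \<alpha> (s t0)" "N \<le> snd (s t0)"
    using frequently_ex[OF frequently_eventually_frequently[OF low]] by blast
  have "\<exists>x n. (x, n) \<in> A \<and> low \<alpha> (x, n) \<and> x \<le> fst (s t) \<and> n \<le> snd (s t) \<and> snd (s t) \<le> n + j + 1" if t: "t0 \<le> t" for t
  proof -
    define r where "r = (GREATEST r. r \<le> t \<and> low \<alpha> (s r))"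
    have r: "r \<le> t" "low \<alpha> (s r)"
      using GreatestI_nat[of "\<lambda>r. r \<le> t \<and> low \<alpha> (s r)" t0 t] t t0 by (auto simp: r_def)
    have r_max: "r' \<le> r" if "r' \<le> t" "low \<alpha> (s r')" for r'
      unfolding r_def by (rule Greatest_le_nat[where b=t]) (use that in auto)
    obtain x n where xn: "s r = (x, n)" by (cases "s r")
    have xnA: "(x, n) \<in> A" using valid_path_A[OF s, of r] xn by simp
    have nN: "N \<le> n" using valid_path_mono(2)[OF s r_max[OF t t0(1)]] t0(2) xn by simp
    have "snd (s t) \<le> n + j + 1"
    proof (rule ccontr)
      assume far: "\<not> snd (s t) \<le> n + j + 1"
      have nxt: "s (Suc r) = (x, n + 1)"
        by (rule valid_path_step[OF s, of r]) (use r xn in auto)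
      define m where "m = (LEAST m. n + j + 2 \<le> snd (s (Suc r + m)))"
      have "r \<noteq> t" using far xn by auto
      then have ex: "n + j + 2 \<le> snd (s (Suc r + (t - Suc r)))" using r(1) far by simp
      have m: "n + j + 2 \<le> snd (s (Suc r + m))" unfolding m_def by (rule LeastI[of _ "t - Suc r"]) (rule ex)
      have m_le: "m \<le> t - Suc r" unfolding m_def by (rule Least_le) (rule ex)
      have "m \<noteq> 0" using m nxt by (intro notI) simp
      then obtain m' where m': "m = Suc m'" by (cases m) auto
      have "\<not> n + j + 2 \<le> snd (s (Suc r + m'))" 
        unfolding not_le using not_less_Least[of m' "\<lambda>m. n + j + 2 \<le> snd (s (Suc r + m))"] m' m_def by auto
      then have "snd (s (Suc r + m)) = n + j + 2"
        using m by (cases rule: valid_path_step[OF s, of "Suc r + m'"]) (auto simp: m')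
      moreover have "\<not> low \<alpha> (s (Suc r + i))" if "i < m" for i
      proof
        assume "low \<alpha> (s (Suc r + i))"
        moreover have "Suc r + i \<le> t" using that m_le by linarith
        ultimately have "Suc r + i \<le> r" by (intro r_max)
        then show False by simp
      qed
      ultimately have "reaches {u. \<not> low \<alpha> u} {u. snd u = n + j + 2} m (\<lambda>i. s (Suc r + i))"
        unfolding reaches_def by (intro exI[of _ m]) simp
      moreover have "x = col \<alpha> n" using low_imp_col[OF xnA] r(2) xn by simp
      ultimately show False using N[OF nN, of "Suc r" m] nxt by auto
    qed
    moreover have "x \<le> fst (s t)" "n \<le> snd (s t)"
      using valid_path_mono[OF s r(1)] xn by auto
    ultimately show ?thesis using xnA r(2) xn by (intro exI[of _ x] exI[of _ n]) simp
  qed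
  then show ?thesis by (auto simp: few_ups_def eventually_sequentially)
qed

text \<open>
  A state is visited at most once, at a time that its coordinates determine. So a bound for one
  attempt from each of the states p n is all that the Borel-Cantelli lemma needs.
\<close>

lemma AE_eventually_no_excursion:
  assumes bound: "\<And>n m. n0 \<le> n \<Longrightarrow> p n \<in> A \<Longrightarrow> reach_prob K (R n) (T n) m (p n) \<le> c n"
    and c: "summable c" "\<And>n. 0 \<le> c n"
  shows "AE \<omega> in M. \<forall>\<^sub>F n in sequentially. \<forall>t. Z t \<omega> = p n \<longrightarrow>
    \<not> (\<exists>m. reaches (R n) (T n) m (\<lambda>i. Z (t + i) \<omega>))"
proof -
  define \<tau> where "\<tau> n = fst (p n) + snd (p n) - (fst z + snd z)" for n
  have "AE \<omega> in M. \<forall>\<^sub>F n in sequentially. \<not> (Z (\<tau> n) \<omega> \<in> A \<inter> {p n} \<and>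
      (\<exists>m. reaches (R n) (T n) m (\<lambda>i. Z (\<tau> n + i) \<omega>)))"
    by (rule AE_eventually_not_reaches[where c=c and ?n0.0=n0]) (use bound c in auto)
  with AE_valid_path show ?thesis
  proof eventually_elim
    fix \<omega> assume v: "valid_path (\<lambda>t. Z t \<omega>)"
      and ev: "\<forall>\<^sub>F n in sequentially. \<not> (Z (\<tau> n) \<omega> \<in> A \<inter> {p n} \<and>
        (\<exists>m. reaches (R n) (T n) m (\<lambda>i. Z (\<tau> n + i) \<omega>)))"
    have time: "t = \<tau> n" if "Z t \<omega> = p n" for t n
      using valid_path_level[OF v, of t] that by (simp add: \<tau>_def)
    from ev show "\<forall>\<^sub>F n in sequentially. \<forall>t. Z t \<omega> = p n \<longrightarrow>
      \<not> (\<exists>m. reaches (R n) (T n) m (\<lambda>i. Z (t + i) \<omega>))"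
    proof (rule eventually_mono, intro allI impI)
      fix n t assume "\<not> (Z (\<tau> n) \<omega> \<in> A \<inter> {p n} \<and> (\<exists>m. reaches (R n) (T n) m (\<lambda>i. Z (\<tau> n + i) \<omega>)))"
        and t: "Z t \<omega> = p n"
      then show "\<not> (\<exists>m. reaches (R n) (T n) m (\<lambda>i. Z (t + i) \<omega>))"
        using time[OF t] valid_path_A[OF v, of t] by auto
    qed
  qed
qed

text \<open>
  An excursion with more than j extra ups has a probability at most of order \<open>n powr - (\<delta> * (j + 1))\<close>,
  which is summable over the levels.
\<close>

lemma AE_few_ups:
  assumes \<alpha>: "\<alpha> \<le> 1" and j: "1 < real (j + 1) * \<delta>"
  shows "AE \<omega> in M. (\<exists>\<^sub>F t in sequentially. low \<alpha> (Z t \<omega>)) \<longrightarrow> few_ups j (\<lambda>t. Z t \<omega>)"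
proof -
  obtain C where C: "0 < C" "\<And>n. 1 \<le> n \<Longrightarrow> up_rate n (n + (j + 2)) \<le> C * real n powr - \<delta>"
    using excursion_rate[OF \<alpha>, of "j + 2"] by blast
  define c where "c n = C ^ (j + 1) * real n powr - (\<delta> * real (j + 1))" for n
  have bound: "reach_prob K {u. \<not> low \<alpha> u} {u. snd u = n + j + 2} m (col \<alpha> n, n + 1) \<le> c n"
    if n: "1 \<le> n" and A: "(col \<alpha> n, n + 1) \<in> A" for n m
  proof -
    have j1: "n + (j + 2) - (n + 1) = j + 1" by simp
    have "reach_prob K {u. \<not> low \<alpha> u} {u. snd u = n + (j + 2)} m (col \<alpha> n, n + 1)
      \<le> up_rate n (n + (j + 2)) ^ (n + (j + 2) - (n + 1))"
      unfolding up_rate_def using n A \<alpha> by (intro excursion_bound) auto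
    also have "\<dots> \<le> (C * real n powr - \<delta>) ^ (n + (j + 2) - (n + 1))"
      by (intro power_mono C(2) n up_rate_nonneg) simp
    also have "\<dots> = c n"
      unfolding j1 using n powr_power[where z="real n" and n="j + 1" and u="- \<delta>"]
      by (simp only: c_def power_mult_distrib) (simp add: mult.commute)
    finally show ?thesis by (simp add: add.assoc)
  qed
  have sum: "summable c"
    unfolding c_def using j by (intro summable_mult) (simp add: summable_real_powr_iff mult.commute)
  have "AE \<omega> in M. \<forall>\<^sub>F n in sequentially. \<forall>t. Z t \<omega> = (col \<alpha> n, n + 1) \<longrightarrow>
      \<not> (\<exists>m. reaches {u. \<not> low \<alpha> u} {u. snd u = n + j + 2} m (\<lambda>i. Z (t + i) \<omega>))"
    by (rule AE_eventually_no_excursion[where c=c and ?n0.0=1]) (use bound sum C(1) in \<open>auto simp: c_def\<close>)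
  with AE_valid_path show ?thesis
    by eventually_elim (use few_ups_path in blast)
qed

section \<open>Bursts of ups recur\<close>

lemma up_prob_strict:
  assumes "(x, y) \<in> A"
  shows "0 < pu x y" "pu x y < 1"
proof -
  have "0 < real x powr \<beta>1" "0 < real y powr \<beta>2" using x_ge_1[OF assms] y_ge_1[OF assms] by auto
  then show "0 < pu x y" "pu x y < 1"
    by (auto simp: up_prob_def add_pos_pos)
qed

lemma interior_closed:
  assumes "(x, y) \<in> A" "\<not> low \<alpha> (x, y)" "\<not> upp \<gamma> (x, y)"
  shows "(x + 1, y) \<in> A" "(x, y + 1) \<in> A"
proof -
  have "set_pmf (K (x, y)) = {(x + 1, y), (x, y + 1)}"
    using up_prob_strict[OF assms(1)] by (auto simp: K_interior[OF assms] UNIV_bool)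
  then show "(x + 1, y) \<in> A" "(x, y + 1) \<in> A" using closed[OF assms(1)] by auto
qed

lemma hit_prob_interior:
  assumes "(x, y) \<in> A" "\<not> low \<alpha> (x, y)" "\<not> upp \<gamma> (x, y)" "(x, y) \<in> R" "(x, y) \<notin> T"
  shows "hit_prob K R T (x, y) = pu x y * hit_prob K R T (x, y + 1) +
    (1 - pu x y) * hit_prob K R T (x + 1, y)"
  using assms by (subst hit_prob_step) (auto simp: expectation_interior)

text \<open>
  A union bound over the d steps at which an up could interfere.
\<close>

lemma run_right:
  assumes "(x, y) \<in> A" "0 \<le> p"
    and "\<And>x'. x \<le> x' \<Longrightarrow> x' < x + d \<Longrightarrow> (x', y) \<in> R \<and> \<not> low \<alpha> (x', y) \<and> \<not> upp \<gamma> (x', y) \<and> pu x' y \<le> p"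
  shows "1 - real d * p \<le> hit_prob K R {(x + d, y)} (x, y)"
  using assms
proof (induction d arbitrary: x)
  case 0
  then show ?case by (simp add: hit_prob_target)
next
  case (Suc d)
  define q where "q = pu x y"
  have x: "(x, y) \<in> R" "\<not> low \<alpha> (x, y)" "\<not> upp \<gamma> (x, y)" "q \<le> p" using Suc.prems(3)[of x] by (auto simp: q_def)
  have q: "0 \<le> q" "q \<le> 1" by (auto simp: q_def up_prob_bounds)
  have IH: "1 - real d * p \<le> hit_prob K R {(x + 1 + d, y)} (x + 1, y)"
    using Suc.prems(2,3) interior_closed[OF Suc.prems(1) x(2,3)] by (intro Suc.IH) auto
  have "1 - real (Suc d) * p \<le> (1 - q) * hit_prob K R {(x + Suc d, y)} (x + 1, y)"
  proof -
    have "(1 - q) * (1 - hit_prob K R {(x + Suc d, y)} (x + 1, y)) \<le> 1 * (1 - hit_prob K R {(x + Suc d, y)} (x + 1, y))"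
      using q hit_prob_le_1 by (intro mult_right_mono) auto
    then show ?thesis using IH x(4) by (simp add: algebra_simps)
  qed
  also have "\<dots> \<le> hit_prob K R {(x + Suc d, y)} (x, y)"
    using q hit_prob_nonneg[of K R "{(x + Suc d, y)}" "(x, y + 1)"]
    by (subst (2) hit_prob_interior) (use x Suc.prems(1) in \<open>auto simp: q_def[symmetric]\<close>)
  finally show ?case .
qed

lemma run_up:
  assumes "(x, y) \<in> A" "0 \<le> p" "p \<le> 1"
    and "\<And>x'. x \<le> x' \<Longrightarrow> x' < x + d \<Longrightarrow> (x', y) \<in> R \<and> \<not> low \<alpha> (x', y) \<and> \<not> upp \<gamma> (x', y) \<and> p \<le> pu x' y"
    and "\<And>x'. x \<le> x' \<Longrightarrow> x' < x + d \<Longrightarrow> (x', y + 1) \<in> T"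
  shows "1 - (1 - p) ^ d \<le> hit_prob K R T (x, y)"
  using assms
proof (induction d arbitrary: x)
  case 0
  then show ?case by (simp add: hit_prob_nonneg)
next
  case (Suc d)
  show ?case
  proof (cases "(x, y) \<in> T")
    case True
    then show ?thesis using Suc.prems(3) by (simp add: hit_prob_target)
  next
    case False
    define q where "q = pu x y"
    have x: "(x, y) \<in> R" "\<not> low \<alpha> (x, y)" "\<not> upp \<gamma> (x, y)" "p \<le> q" using Suc.prems(4)[of x] by (auto simp: q_def)
    have q: "0 \<le> q" "q \<le> 1" by (auto simp: q_def up_prob_bounds)
    have IH: "1 - (1 - p) ^ d \<le> hit_prob K R T (x + 1, y)"
      using Suc.prems interior_closed[OF Suc.prems(1) x(2,3)] by (intro Suc.IH) auto
    have "1 - (1 - p) ^ Suc d \<le> 1 - (1 - q) * (1 - p) ^ d"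
      using x(4) Suc.prems(3) by (simp add: mult_right_mono)
    also have "\<dots> = q * 1 + (1 - q) * (1 - (1 - p) ^ d)" by (simp add: algebra_simps)
    also have "\<dots> \<le> q * hit_prob K R T (x, y + 1) + (1 - q) * hit_prob K R T (x + 1, y)"
      using q IH Suc.prems(5)[of x] by (intro add_mono mult_left_mono) (auto simp: hit_prob_target)
    also have "\<dots> = hit_prob K R T (x, y)"
      unfolding q_def by (rule hit_prob_interior[symmetric]) (use x Suc.prems(1) False in auto)
    finally show ?thesis .
  qed
qed

text \<open>
  A number of steps to the right that lower the distance to the boundary by at most \<open>\<epsilon>\<close>. It is
  rounded so as to vanish for \<open>\<alpha> = 1\<close>, \<open>\<epsilon> < 1\<close>, where a single step already costs a full unit.
\<close>

definition stride :: "real \<Rightarrow> nat \<Rightarrow> nat" where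
  "stride \<epsilon> n = nat (\<lceil>\<epsilon> * real n powr (1 / \<alpha> - 1)\<rceil> - 1)"

text \<open>
  The states in which j further ups have followed a reflection at level n so quickly that the steps
  to the right between them are negligible.
\<close>

definition burst :: "real \<Rightarrow> nat \<Rightarrow> nat \<Rightarrow> state set" where
  "burst \<epsilon> j n = {(x, y). y = n + 1 + j \<and> x \<le> col \<alpha> n + j * stride \<epsilon> n}"

lemma stride_bounds:
  assumes "0 < \<epsilon>"
  shows "real (stride \<epsilon> n) \<le> \<epsilon> * real n powr (1 / \<alpha> - 1)" "\<epsilon> * real n powr (1 / \<alpha> - 1) \<le> real (stride \<epsilon> n) + 1"
proof -
  have "0 \<le> \<epsilon> * real n powr (1 / \<alpha> - 1)" using assms by simp
  then show "real (stride \<epsilon> n) \<le> \<epsilon> * real n powr (1 / \<alpha> - 1)" "\<epsilon> * real n powr (1 / \<alpha> - 1) \<le> real (stride \<epsilon> n) + 1"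
    unfolding stride_def by linarith+
qed

text \<open>
  Concavity of the boundary: over a few strides it rises by only \<open>j * \<epsilon>\<close>.
\<close>

lemma burst_powr_le:
  assumes "\<alpha> \<le> 1" "0 < \<epsilon>" "1 \<le> n" "0 \<le> r"
  shows "(real (col \<alpha> n + j * stride \<epsilon> n) + r) powr \<alpha> \<le> real n + real j * \<epsilon> + r * real n powr (1 - 1 / \<alpha>)"
proof -
  define \<nu> where "\<nu> = real n powr (1 / \<alpha>)"
  have \<nu>: "0 < \<nu>" "\<nu> powr \<alpha> = real n" "\<nu> powr (\<alpha> - 1) = real n powr (1 - 1 / \<alpha>)"
    using assms parameters by (auto simp: \<nu>_def powr_powr field_simps)
  define s where "s = real j * (\<epsilon> * real n powr (1 / \<alpha> - 1)) + r"
  have s: "0 \<le> s" using assms by (simp add: s_def)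
  have "real (col \<alpha> n + j * stride \<epsilon> n) + r \<le> \<nu> + s"
    using col_le[of \<alpha> n] mult_left_mono[OF stride_bounds(1)[OF assms(2), of n], of "real j"]
    by (simp add: \<nu>_def s_def)
  then have "(real (col \<alpha> n + j * stride \<epsilon> n) + r) powr \<alpha> \<le> (\<nu> + s) powr \<alpha>"
    using parameters assms by (intro powr_mono2) auto
  also have "\<dots> \<le> \<nu> powr \<alpha> + \<alpha> * s * \<nu> powr (\<alpha> - 1)"
    using powr_concave_diff_le[of \<alpha> \<nu> s] parameters assms \<nu> s by simp
  also have "\<dots> \<le> \<nu> powr \<alpha> + 1 * s * \<nu> powr (\<alpha> - 1)"
    using assms s by (intro add_left_mono mult_right_mono) auto
  also have "\<dots> = real n + real j * \<epsilon> * (real n powr (1 / \<alpha> - 1) * real n powr (1 - 1 / \<alpha>)) + r * real n powr (1 - 1 / \<alpha>)"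
    unfolding \<nu> s_def by (simp add: algebra_simps)
  also have "real n powr (1 / \<alpha> - 1) * real n powr (1 - 1 / \<alpha>) = 1"
    using assms by (simp add: powr_add[symmetric])
  finally show ?thesis by simp
qed

lemma burst_far:
  assumes "\<alpha> \<le> 1" "0 < \<epsilon>" "1 \<le> n" "(x, y) \<in> burst \<epsilon> j n"
  shows "1 + real j - real j * \<epsilon> \<le> real y - real x powr \<alpha>"
proof -
  have "real x powr \<alpha> \<le> (real (col \<alpha> n + j * stride \<epsilon> n) + 0) powr \<alpha>"
    using assms parameters by (intro powr_mono2) (auto simp: burst_def simp flip: of_nat_add of_nat_mult)
  also have "\<dots> \<le> real n + real j * \<epsilon>" using burst_powr_le[OF assms(1-3), of 0 j] by simp
  finally show ?thesis using assms(4) by (simp add: burst_def)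
qed

lemma col_low: "low \<alpha> (col \<alpha> n, n)"
  using le_col_iff[OF parameters(1), of "col \<alpha> n + 1" n] by (auto simp: low_def)

lemma eventually_not_upp:
  "eventually (\<lambda>n. \<forall>x y. real n \<le> real x powr \<alpha> + c \<longrightarrow> real y \<le> real x powr \<alpha> + c \<longrightarrow> \<not> upp \<gamma> (x, y)) sequentially"
proof -
  have "filterlim (\<lambda>x::real. x powr \<gamma> - x powr \<alpha>) at_top at_top"
    using parameters by real_asymp
  then have "eventually (\<lambda>x. c + 1 \<le> x powr \<gamma> - x powr \<alpha>) at_top"
    by (simp add: filterlim_at_top)
  then obtain X where X: "\<And>x. X \<le> x \<Longrightarrow> c + 1 \<le> x powr \<gamma> - x powr \<alpha>" by (auto simp: eventually_at_top_linorder)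
  have "eventually (\<lambda>n. \<bar>X\<bar> powr \<alpha> + c < real n) sequentially"
    using filterlim_real_sequentially by (simp add: filterlim_at_top_dense)
  then show ?thesis
  proof (rule eventually_mono, safe)
    fix n x y assume "\<bar>X\<bar> powr \<alpha> + c < real n" "real n \<le> real x powr \<alpha> + c" "real y \<le> real x powr \<alpha> + c" "upp \<gamma> (x, y)"
    moreover from this have "\<not> real x < \<bar>X\<bar>"
      using powr_mono2[of \<alpha> "real x" "\<bar>X\<bar>"] parameters by auto
    moreover from this have "X \<le> real x" by linarith
    ultimately show False using X[of "real x"] by (auto simp: upp_def)
  qed
qed

text \<open>
  From a state of level n near the lower boundary, the expected number of ups before the reflection
  at level n is at most of order \<open>n powr - \<delta>\<close>, so with probability at least one half there is none.
\<close>

lemma eventually_reach_boundary: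
  assumes \<alpha>: "\<alpha> \<le> 1" and \<delta>: "0 < \<delta>" and \<kappa>: "0 \<le> \<kappa>"
  shows "eventually (\<lambda>n. \<forall>x L. (x, n) \<in> A \<longrightarrow> real n \<le> real x powr \<alpha> + \<kappa> \<longrightarrow> n < L \<longrightarrow>
    1 / 2 \<le> hit_prob K {u. snd u < L} {(col \<alpha> n, n)} (x, n)) sequentially"
proof -
  define a where "a = 1 / \<alpha>"
  have a: "1 \<le> a" using parameters \<alpha> by (simp add: a_def)
  define C where "C = 2 powr (a * \<beta>1) * (a * \<kappa>)"
  have "((\<lambda>n. C * real n powr - \<delta>) \<longlongrightarrow> 0) sequentially" using \<delta> by real_asymp
  then have ev1: "eventually (\<lambda>n. C * real n powr - \<delta> < 1 / 2) sequentially"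
    by (rule order_tendstoD) simp
  have ev2: "eventually (\<lambda>n. 2 * \<kappa> + 1 \<le> real n) sequentially" by real_asymp
  show ?thesis
    using ev1 ev2 eventually_not_upp[of \<kappa>] eventually_ge_at_top[of 1]
  proof (eventually_elim, safe)
    fix n x L
    assume small: "C * real n powr - \<delta> < 1 / 2" and n: "2 * \<kappa> + 1 \<le> real n" "1 \<le> n"
      and nu: "\<forall>x y. real n \<le> real x powr \<alpha> + \<kappa> \<longrightarrow> real y \<le> real x powr \<alpha> + \<kappa> \<longrightarrow> \<not> upp \<gamma> (x, y)"
      and x: "(x, n) \<in> A" "real n \<le> real x powr \<alpha> + \<kappa>" and L: "n < L"
    have xc: "x \<le> col \<alpha> n" using above[OF x(1)] le_col_iff[OF parameters(1)] by simp
    define d where "d = col \<alpha> n - x"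
    define p where "p = 2 powr (a * \<beta>1) * real n powr (\<beta>2 - a * \<beta>1)"
    have pow: "real n - \<kappa> \<le> real x powr \<alpha>" using x by simp
    have xa: "(real n - \<kappa>) powr a \<le> real x"
    proof -
      have "(real n - \<kappa>) powr a \<le> (real x powr \<alpha>) powr a"
        using pow n \<kappa> a by (intro powr_mono2) auto
      then show ?thesis using parameters by (simp add: a_def powr_powr)
    qed
    have up: "pu x' n \<le> p" if "x \<le> x'" for x'
    proof -
      have half: "(real n / 2) powr a \<le> real x'"
        using xa powr_mono2[of a "real n / 2" "real n - \<kappa>"] n \<kappa> a that by simp
      have "pu x' n \<le> real n powr \<beta>2 / ((real n / 2) powr a) powr \<beta>1"
        unfolding up_prob_def
      proof (rule frac_le)
        show "((real n / 2) powr a) powr \<beta>1 \<le> real x' powr \<beta>1 + real n powr \<beta>2"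
          using powr_mono2[of \<beta>1 "(real n / 2) powr a" "real x'"] half parameters by (simp add: add_increasing2)
      qed (use n in auto)
      also have "\<dots> = p"
        using n by (simp add: p_def powr_powr powr_divide powr_diff field_simps)
      finally show ?thesis .
    qed
    have "1 - real d * p \<le> hit_prob K {u. snd u < L} {(x + d, n)} (x, n)"
    proof (rule run_right[OF x(1)])
      fix x' assume x': "x \<le> x'" "x' < x + d"
      then have "x' + 1 \<le> col \<alpha> n" by (simp add: d_def)
      then have "\<not> low \<alpha> (x', n)" using le_col_iff[OF parameters(1), of "x' + 1" n] by (auto simp: low_def)
      moreover have "\<not> upp \<gamma> (x', n)"
      proof -
        have "real x powr \<alpha> \<le> real x' powr \<alpha>" using x' parameters by (intro powr_mono2) auto
        then show ?thesis using nu x by auto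
      qed
      ultimately show "(x', n) \<in> {u. snd u < L} \<and> \<not> low \<alpha> (x', n) \<and> \<not> upp \<gamma> (x', n) \<and> pu x' n \<le> p"
        using up x' L by simp
    qed (simp add: p_def)
    moreover have "real d * p \<le> C * real n powr - \<delta>"
    proof -
      have "real d \<le> real n powr a - (real n - \<kappa>) powr a"
        using xa xc col_le[of \<alpha> n] by (simp add: d_def a_def)
      also have "\<dots> \<le> a * \<kappa> * real n powr (a - 1)"
        using powr_diff_le[OF a, of "real n - \<kappa>" \<kappa>] n \<kappa> by simp
      finally have "real d * p \<le> (a * \<kappa> * real n powr (a - 1)) * p"
        by (rule mult_right_mono) (simp add: p_def)
      also have "\<dots> = C * (real n powr (a - 1) * real n powr (\<beta>2 - a * \<beta>1))"
        by (simp add: C_def p_def)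
      also have "real n powr (a - 1) * real n powr (\<beta>2 - a * \<beta>1) = real n powr - \<delta>"
        unfolding powr_add[symmetric]
        by (rule arg_cong[where f="\<lambda>e. real n powr e"]) (simp add: \<delta>_def a_def diff_divide_distrib)
      finally show ?thesis .
    qed
    moreover have "x + d = col \<alpha> n" using xc by (simp add: d_def)
    ultimately show "1 / 2 \<le> hit_prob K {u. snd u < L} {(col \<alpha> n, n)} (x, n)" using small by simp
  qed
qed

lemma one_minus_power_ge:
  fixes p :: real
  assumes "0 \<le> p" "p \<le> 1" "l \<le> real d * p" "0 \<le> l"
  shows "l / (1 + l) \<le> 1 - (1 - p) ^ d"
proof -
  have "(1 - p) ^ d * (1 + real d * p) \<le> (1 - p) ^ d * (1 + p) ^ d"
    using assms by (intro mult_left_mono Bernoulli_inequality) auto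
  also have "\<dots> = (1 - p\<^sup>2) ^ d" by (simp add: power_mult_distrib[symmetric] power2_eq_square algebra_simps)
  also have "\<dots> \<le> 1" using assms by (intro power_le_one) (auto simp: power_le_one)
  finally have "(1 - p) ^ d * (1 + real d * p) \<le> 1" .
  moreover have "(1 - p) ^ d * (1 + l) \<le> (1 - p) ^ d * (1 + real d * p)"
    using assms by (intro mult_left_mono) auto
  ultimately have "(1 - p) ^ d * (1 + l) \<le> 1" by linarith
  then show ?thesis using assms by (simp add: field_simps)
qed

text \<open>
  After the reflection at level n, each of the j ups has \<open>stride + 1\<close> occasions, hence a chance of
  order \<open>n powr - \<delta>\<close>; and \<open>j * \<delta> \<le> 1\<close> makes the product of these chances at least of order 1 / n.
\<close>

lemma eventually_burst:
  assumes \<alpha>: "\<alpha> \<le> 1" and \<delta>: "0 < \<delta>" "real j * \<delta> \<le> 1" and \<epsilon>: "0 < \<epsilon>" "\<epsilon> < 1" "real j * \<epsilon> \<le> 1 / 2"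
  shows "\<exists>C>0. eventually (\<lambda>n. (col \<alpha> n, n) \<in> A \<longrightarrow>
    C / real n \<le> hit_prob K {u. snd u < n + j + 2} (burst \<epsilon> j n) (col \<alpha> n, n)) sequentially"
proof -
  define a where "a = 1 / \<alpha>"
  have a: "1 \<le> a" using parameters \<alpha> by (simp add: a_def)
  define c where "c = \<epsilon> / (3 powr \<beta>1 + 1)"
  have c: "0 < c" using \<epsilon> by (simp add: c_def add_pos_pos)
  define C where "C = (c / (1 + c)) ^ j"
  have C: "0 < C" using c by (simp add: C_def)
  have ev: "eventually (\<lambda>n. a = 1 \<or> real n powr (1 - a) \<le> 1 / 2) sequentially"
  proof (cases "a = 1")
    case False
    then have "((\<lambda>n. real n powr (1 - a)) \<longlongrightarrow> 0) sequentially" using a by real_asymp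
    then have "eventually (\<lambda>n. real n powr (1 - a) < 1 / 2) sequentially" by (rule order_tendstoD) simp
    then show ?thesis by eventually_elim auto
  qed simp
  have "eventually (\<lambda>n. (col \<alpha> n, n) \<in> A \<longrightarrow>
    C / real n \<le> hit_prob K {u. snd u < n + j + 2} (burst \<epsilon> j n) (col \<alpha> n, n)) sequentially"
    using ev eventually_not_upp[of "real j + 2"] eventually_ge_at_top[of 1]
  proof (eventually_elim, intro impI)
    fix n assume na: "a = 1 \<or> real n powr (1 - a) \<le> 1 / 2" and n: "1 \<le> n"
      and nu: "\<forall>x y. real n \<le> real x powr \<alpha> + (real j + 2) \<longrightarrow> real y \<le> real x powr \<alpha> + (real j + 2) \<longrightarrow> \<not> upp \<gamma> (x, y)"
      and cA: "(col \<alpha> n, n) \<in> A"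
    define w where "w = stride \<epsilon> n"
    define X where "X = col \<alpha> n + j * w"
    define R where "R = {u::state. snd u < n + j + 2}"
    have X1: "real (X + 1) powr \<alpha> \<le> real n + 1"
    proof (cases "a = 1")
      case True
      then have "\<alpha> = 1" using parameters by (simp add: a_def)
      then have "w = 0" using stride_bounds(1)[OF \<epsilon>(1), of n] n \<epsilon>(2) by (simp add: w_def)
      then show ?thesis using \<open>\<alpha> = 1\<close> by (simp add: X_def col_def)
    next
      case False
      then have "real n powr (1 - 1 / \<alpha>) \<le> 1 / 2" using na unfolding a_def by blast
      then show ?thesis using burst_powr_le[OF \<alpha> \<epsilon>(1) n, of 1 j] \<epsilon>(3) unfolding X_def w_def by (simp add: ac_simps)
    qed
    have interior: "(x, y) \<in> R \<and> \<not> low \<alpha> (x, y) \<and> \<not> upp \<gamma> (x, y)"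
      if x: "col \<alpha> n \<le> x" "x \<le> X" and y: "n + 1 \<le> y" "y < n + 1 + j" for x y
    proof -
      have "real (x + 1) powr \<alpha> \<le> real (X + 1) powr \<alpha>" using x parameters by (intro powr_mono2) auto
      then have "\<not> low \<alpha> (x, y)" using X1 y by (simp add: low_def)
      moreover have "\<not> upp \<gamma> (x, y)"
      proof -
        note c1 = col_ge_half(2)[OF parameters(1) \<alpha> n]
        have "real n < (real (col \<alpha> n) + 1) powr \<alpha>" using col_low[of n] by (simp add: low_def add.commute)
        also have "\<dots> \<le> real (col \<alpha> n) powr \<alpha> + \<alpha> * 1 * real (col \<alpha> n) powr (\<alpha> - 1)"
          using powr_concave_diff_le[of \<alpha> "real (col \<alpha> n)" 1] c1 parameters \<alpha> by simp
        also have "\<dots> \<le> real (col \<alpha> n) powr \<alpha> + 1 * 1 * real (col \<alpha> n) powr 0"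
          using \<alpha> parameters c1 by (intro add_left_mono mult_mono powr_mono) auto
        finally have "real n \<le> real (col \<alpha> n) powr \<alpha> + 1" using c1 by simp
        moreover have "real (col \<alpha> n) powr \<alpha> \<le> real x powr \<alpha>" using x parameters by (intro powr_mono2) auto
        ultimately show ?thesis using nu y by auto
      qed
      ultimately show ?thesis using y by (simp add: R_def)
    qed
    define p where "p = real n powr (\<beta>2 - a * \<beta>1) / (3 powr \<beta>1 + 1)"
    define l where "l = c * real n powr - \<delta>"
    have X3: "real X \<le> 3 * real n powr a"
    proof -
      have "real j * real w \<le> real j * \<epsilon> * real n powr (a - 1)"
        using mult_left_mono[OF stride_bounds(1)[OF \<epsilon>(1), of n], of "real j"] by (simp add: w_def a_def)
      also have "\<dots> \<le> 1 * real n powr a" using \<epsilon> n a by (intro mult_mono powr_mono) auto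
      finally show ?thesis using col_le[of \<alpha> n] by (simp add: X_def a_def)
    qed
    have up: "p \<le> pu x y" if x: "col \<alpha> n \<le> x" "x \<le> X" and y: "n \<le> y" for x y
    proof -
      have x1: "1 \<le> x" using x col_ge_half(2)[OF parameters(1) \<alpha> n] by simp
      have le: "real x powr \<beta>1 \<le> 3 powr \<beta>1 * real n powr (a * \<beta>1)"
      proof -
        have "real x powr \<beta>1 \<le> (3 * real n powr a) powr \<beta>1" using x X3 parameters by (intro powr_mono2) auto
        then show ?thesis by (simp add: powr_mult powr_powr)
      qed
      have "\<beta>2 \<le> a * \<beta>1"
      proof -
        have "0 < a * (\<beta>1 - 1) - (\<beta>2 - 1)" using \<delta> by (simp add: \<delta>_def a_def)
        then show ?thesis using a by (simp add: algebra_simps)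
      qed
      then have nb: "real n powr \<beta>2 \<le> real n powr (a * \<beta>1)" using n by (intro powr_mono) auto
      have "p = real n powr \<beta>2 / ((3 powr \<beta>1 + 1) * real n powr (a * \<beta>1))"
        using n by (simp add: p_def powr_diff field_simps)
      also have "\<dots> \<le> real n powr \<beta>2 / (real x powr \<beta>1 + real n powr \<beta>2)"
        using le nb n x1 by (intro divide_left_mono mult_pos_pos add_pos_pos) (auto simp: algebra_simps)
      also have "\<dots> \<le> pu x y"
      proof -
        have "real n powr \<beta>2 \<le> real y powr \<beta>2" using y parameters by (intro powr_mono2) auto
        then have "real n powr \<beta>2 * real x powr \<beta>1 \<le> real y powr \<beta>2 * real x powr \<beta>1" by (intro mult_right_mono) auto
        then show ?thesis unfolding up_prob_def using n x1 y
          by (simp add: divide_simps add_pos_pos) (simp add: algebra_simps)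
      qed
      finally show ?thesis .
    qed
    have p: "0 \<le> p" "p \<le> 1"
    proof -
      show "0 \<le> p" by (simp add: p_def add_nonneg_nonneg)
      show "p \<le> 1" using up[of "col \<alpha> n" n] up_prob_bounds(2)[of "col \<alpha> n" n] by (simp add: X_def)
    qed
    have l: "0 \<le> l" "l \<le> real (w + 1) * p"
    proof -
      show "0 \<le> l" using c by (simp add: l_def)
      have "l = \<epsilon> * real n powr (a - 1) * p"
      proof -
        have "real n powr - \<delta> = real n powr (a - 1) * real n powr (\<beta>2 - a * \<beta>1)"
          unfolding powr_add[symmetric]
          by (rule arg_cong[where f="\<lambda>e. real n powr e"]) (simp add: \<delta>_def a_def diff_divide_distrib)
        then show ?thesis by (simp add: l_def c_def p_def)
      qed
      also have "\<dots> \<le> real (w + 1) * p"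
        using stride_bounds(2)[OF \<epsilon>(1), of n] p by (intro mult_right_mono) (auto simp: w_def a_def)
      finally show "l \<le> real (w + 1) * p" .
    qed
    define b where "b = l / (1 + l)"
    have b: "0 \<le> b" "b \<le> 1" using l(1) by (auto simp: b_def)
    have climb: "b ^ k \<le> hit_prob K R (burst \<epsilon> j n) (x, y)"
      if "k \<le> j" "(x, y) \<in> A" "y = n + 1 + (j - k)" "col \<alpha> n \<le> x" "x \<le> col \<alpha> n + (j - k) * w" for k x y
      using that
    proof (induction k arbitrary: x y)
      case 0
      then have "(x, y) \<in> burst \<epsilon> j n" by (simp add: burst_def w_def)
      then show ?case by (simp add: hit_prob_target)
    next
      case (Suc k)
      define i where "i = j - Suc k"
      have i: "j - k = Suc i" "i < j" using Suc.prems by (auto simp: i_def)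
      define T where "T = {(x', y'). y' = y + 1 \<and> x \<le> x' \<and> x' < x + (w + 1)}"
      have xX: "x' \<le> X" if "x' < x + (w + 1)" for x'
      proof -
        have "x' \<le> col \<alpha> n + (i + 1) * w" using that Suc.prems(5) by (simp add: i_def[symmetric])
        also have "\<dots> \<le> X" unfolding X_def using i by (intro add_left_mono mult_right_mono) auto
        finally show ?thesis .
      qed
      have "b \<le> 1 - (1 - p) ^ (w + 1)"
        unfolding b_def using l p by (intro one_minus_power_ge) auto
      also have "\<dots> \<le> hit_prob K R T (x, y)"
      proof (rule run_up[OF Suc.prems(2) p])
        fix x' assume x': "x \<le> x'" "x' < x + (w + 1)"
        show "(x', y) \<in> R \<and> \<not> low \<alpha> (x', y) \<and> \<not> upp \<gamma> (x', y) \<and> p \<le> pu x' y"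
          using interior[of x' y] up[of x' y] xX[of x'] x' Suc.prems i by (simp add: i_def[symmetric])
      qed (simp add: T_def)
      finally have first: "b \<le> hit_prob K R T (x, y)" .
      have "b ^ k * hit_prob K R T (x, y) \<le> hit_prob K R (burst \<epsilon> j n) (x, y)"
      proof (rule hit_prob_chain[where I=A])
        fix v assume v: "v \<in> A" "v \<in> T"
        obtain x' y' where v': "v = (x', y')" by (cases v)
        show "b ^ k \<le> hit_prob K R (burst \<epsilon> j n) v"
          unfolding v' by (rule Suc.IH) (use v v' Suc.prems i in \<open>auto simp: T_def i_def[symmetric]\<close>)
      qed (use closed b Suc.prems power_le_one[of b k] in auto)
      moreover have "b ^ Suc k \<le> b ^ k * hit_prob K R T (x, y)"
        using mult_left_mono[OF first, of "b ^ k"] b by (simp add: mult.commute)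
      ultimately show ?case by linarith
    qed
    have nA: "(col \<alpha> n, n + 1) \<in> A" using closed[OF cA] set_K(2)[OF cA col_low] by auto
    have "b ^ j \<le> hit_prob K R (burst \<epsilon> j n) (col \<alpha> n, n + 1)"
      using nA by (intro climb) auto
    also have "\<dots> = hit_prob K R (burst \<epsilon> j n) (col \<alpha> n, n)"
      by (subst (2) hit_prob_step) (auto simp: burst_def R_def K_low[OF cA col_low])
    finally have hit: "b ^ j \<le> hit_prob K R (burst \<epsilon> j n) (col \<alpha> n, n)" .
    have "c / (1 + c) * real n powr - \<delta> \<le> b"
    proof -
      have "l \<le> c * 1" unfolding l_def using c n \<delta> by (intro mult_left_mono) (auto simp: powr_minus_divide divide_le_eq ge_one_powr_ge_zero)
      then have "l / (1 + c) \<le> b" unfolding b_def using l c by (intro divide_left_mono) auto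
      then show ?thesis by (simp add: l_def)
    qed
    then have "(c / (1 + c) * real n powr - \<delta>) ^ j \<le> b ^ j" using c by (intro power_mono) auto
    moreover have "C / real n \<le> (c / (1 + c) * real n powr - \<delta>) ^ j"
    proof -
      have "real n powr - 1 \<le> real n powr (real j * - \<delta>)" using \<delta> n by (intro powr_mono) auto
      also have "\<dots> = (real n powr - \<delta>) ^ j" using n by (simp add: powr_power)
      finally have "C * real n powr - 1 \<le> C * (real n powr - \<delta>) ^ j" using C by (intro mult_left_mono) auto
      moreover have "C * real n powr - 1 = C / real n" using n by (simp add: powr_minus_divide)
      moreover have "C * (real n powr - \<delta>) ^ j = (c / (1 + c) * real n powr - \<delta>) ^ j"
        by (simp only: power_mult_distrib C_def)
      ultimately show ?thesis by simp
    qed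
    ultimately show "C / real n \<le> hit_prob K {u. snd u < n + j + 2} (burst \<epsilon> j n) (col \<alpha> n, n)"
      using hit unfolding R_def by linarith
  qed
  with C show ?thesis by blast
qed

lemma expectation_one:
  "(\<And>v. v \<in> set_pmf p \<Longrightarrow> f v = 1) \<Longrightarrow> measure_pmf.expectation p f = (1::real)"
  using integral_cong_AE[of f "measure_pmf p" "\<lambda>_. 1"] by (simp add: AE_measure_pmf_iff)

text \<open>
  On the sum of the coordinates the walk is deterministic, and in the domain a large sum forces a
  high level.
\<close>

lemma hit_level:
  assumes "(x, y) \<in> A" "y \<le> L" "{u. snd u = L} \<subseteq> T"
  shows "hit_prob K UNIV T (x, y) = 1"
proof -
  obtain N where N: "\<And>x y. (x, y) \<in> A \<Longrightarrow> N \<le> x + y \<Longrightarrow> L < x \<and> L < y" using level_large[of L] by blast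
  have "reach_prob K UNIV T n (x, y) = 1" if "(x, y) \<in> A" "y \<le> L" "N \<le> x + y + n" for n x y
    using that
  proof (induction n arbitrary: x y)
    case 0
    then show ?case using N[of x y] by simp
  next
    case (Suc n)
    show ?case
    proof (cases "(x, y) \<in> T")
      case False
      then have "y < L" using subsetD[OF assms(3), of "(x, y)"] Suc.prems(2) by (cases "y = L") auto
      have "reach_prob K UNIV T n v = 1" if "v \<in> set_pmf (K (x, y))" for v
      proof -
        have v: "v \<in> A" "v \<in> {(x + 1, y), (x, y + 1)}" using closed set_K(1) Suc.prems(1) that by blast+
        then show ?thesis using Suc.IH[of "fst v" "snd v"] Suc.prems \<open>y < L\<close> by (cases v) auto
      qed
      then show ?thesis using False by (simp add: expectation_one)
    qed simp
  qed
  from this[OF assms(1,2), of N] show ?thesis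
    using reach_prob_le_hit_prob[of K UNIV T N "(x, y)"] hit_prob_le_1[of K UNIV T "(x, y)"] by simp
qed

lemma harmonic_product_small:
  fixes C :: real and d :: nat
  assumes "0 < C" "C \<le> real n" "0 < n"
  shows "\<exists>k. (\<Prod>l<k. 1 - C / real (n + l * d)) \<le> 1 / 2"
proof -
  define D where "D = C / real (n + d)"
  have D: "0 < D" using assms by (simp add: D_def)
  define k where "k = nat \<lceil>exp (1 / D)\<rceil>"
  have "1 / D \<le> ln (real k + 1)"
  proof -
    have "exp (1 / D) \<le> real k + 1" unfolding k_def by linarith
    then have "ln (exp (1 / D)) \<le> ln (real k + 1)" by (subst ln_le_cancel_iff) auto
    then show ?thesis by simp
  qed
  also have "\<dots> \<le> harm k" by (rule ln_le_harm)
  finally have "1 \<le> D * harm k" using D by (simp add: field_simps)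
  also have "\<dots> = (\<Sum>l<k. D / real (l + 1))"
  proof -
    have "harm k = (\<Sum>l<k. 1 / real (l + 1))"
      by (simp add: harm_def sum.atLeast1_atMost_eq inverse_eq_divide)
    then show ?thesis by (simp add: sum_distrib_left)
  qed
  also have "\<dots> \<le> (\<Sum>l<k. C / real (n + l * d))"
  proof (rule sum_mono)
    fix l
    have "real (n + l * d) \<le> real (n + d) * real (l + 1)"
      unfolding of_nat_mult[symmetric] of_nat_le_iff by (simp add: algebra_simps)
    then have "C / (real (n + d) * real (l + 1)) \<le> C / real (n + l * d)"
      using assms by (intro divide_left_mono mult_pos_pos) (auto simp: add_pos_nonneg)
    then show "D / real (l + 1) \<le> C / real (n + l * d)" by (simp add: D_def)
  qed
  finally have sum: "1 \<le> (\<Sum>l<k. C / real (n + l * d))" .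
  have "(\<Prod>l<k. 1 - C / real (n + l * d)) \<le> (\<Prod>l<k. exp (- (C / real (n + l * d))))"
  proof (rule prod_mono)
    fix l
    have "real n \<le> real (n + l * d)" by (rule of_nat_mono) simp
    then have "C \<le> real (n + l * d)" "0 < real (n + l * d)" using assms by linarith+
    then have "C / real (n + l * d) \<le> 1" by (subst divide_le_eq_1_pos)
    then show "0 \<le> 1 - C / real (n + l * d) \<and> 1 - C / real (n + l * d) \<le> exp (- (C / real (n + l * d)))"
      using exp_ge_add_one_self[of "- (C / real (n + l * d))"] by simp
  qed
  also have "\<dots> = exp (- (\<Sum>l<k. C / real (n + l * d)))"
    by (simp add: exp_sum sum_negf[symmetric])
  also have "\<dots> \<le> exp (- 1)" using sum by simp
  also have "\<dots> \<le> 1 / 2"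
    using exp_ge_add_one_self[of 1] by (simp add: exp_minus inverse_eq_divide divide_le_eq)
  finally show ?thesis by blast
qed

text \<open>
  Second Borel-Cantelli. As long as the walk stays within \<open>\<kappa>\<close> of the boundary, it gets a new attempt
  at a burst every j + 2 levels, with a chance of order 1 / n each time. The harmonic series
  diverges, so from any high level the walk leaves the strip or succeeds with probability at least
  one half, and the zero-one law applies.
\<close>

lemma AE_many_ups:
  assumes \<alpha>: "\<alpha> \<le> 1" and \<delta>: "0 < \<delta>" "real j * \<delta> \<le> 1" and \<kappa>: "0 \<le> \<kappa>" and e: "0 < e" "e \<le> 1 / 2"
  shows "AE \<omega> in M. eventually (\<lambda>t. real (snd (Z t \<omega>)) \<le> real (fst (Z t \<omega>)) powr \<alpha> + \<kappa>) sequentially \<longrightarrow>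
    (\<exists>\<^sub>F t in sequentially. 1 + real j - e \<le> real (snd (Z t \<omega>)) - real (fst (Z t \<omega>)) powr \<alpha>)"
proof -
  define \<epsilon> where "\<epsilon> = e / (real j + 1)"
  have \<epsilon>: "0 < \<epsilon>" "\<epsilon> < 1" "real j * \<epsilon> \<le> e"
    using e by (auto simp: \<epsilon>_def divide_less_eq field_simps)
  obtain C0 where C0: "0 < C0" "eventually (\<lambda>n. (col \<alpha> n, n) \<in> A \<longrightarrow>
    C0 / real n \<le> hit_prob K {u. snd u < n + j + 2} (burst \<epsilon> j n) (col \<alpha> n, n)) sequentially"
    using eventually_burst[OF \<alpha> \<delta> \<epsilon>(1,2), of ] \<epsilon>(3) e by fastforce
  define C where "C = C0 / 2"
  have C: "0 < C" using C0 by (simp add: C_def)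
  have "eventually (\<lambda>n. C0 \<le> real n) sequentially" by real_asymp
  then have "eventually (\<lambda>n. 1 \<le> n \<and> C0 \<le> real n \<and> (\<forall>x. (x, n) \<in> A \<longrightarrow> real n \<le> real x powr \<alpha> + \<kappa> \<longrightarrow>
      C / real n \<le> hit_prob K {u. snd u < n + j + 2} (burst \<epsilon> j n) (x, n))) sequentially"
    using C0(2) eventually_reach_boundary[OF \<alpha> \<delta>(1) \<kappa>] eventually_ge_at_top[of 1]
  proof (eventually_elim, intro conjI allI impI)
    fix n x assume burst: "(col \<alpha> n, n) \<in> A \<longrightarrow> C0 / real n \<le> hit_prob K {u. snd u < n + j + 2} (burst \<epsilon> j n) (col \<alpha> n, n)"
      and bd: "\<forall>x L. (x, n) \<in> A \<longrightarrow> real n \<le> real x powr \<alpha> + \<kappa> \<longrightarrow> n < L \<longrightarrow>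
          1 / 2 \<le> hit_prob K {u. snd u < L} {(col \<alpha> n, n)} (x, n)"
      and n: "C0 \<le> real n" "1 \<le> n" and x: "(x, n) \<in> A" "real n \<le> real x powr \<alpha> + \<kappa>"
    have n': "0 \<le> C0 / real n" "C0 / real n \<le> 1" using C0 n by auto
    have "C0 / real n * hit_prob K {u. snd u < n + j + 2} {(col \<alpha> n, n)} (x, n)
        \<le> hit_prob K {u. snd u < n + j + 2} (burst \<epsilon> j n) (x, n)"
      by (rule hit_prob_chain[where I=A]) (use closed n' x burst in auto)
    moreover have "C0 / real n * (1 / 2) \<le> C0 / real n * hit_prob K {u. snd u < n + j + 2} {(col \<alpha> n, n)} (x, n)"
      using bd x n' by (intro mult_left_mono) auto
    ultimately show "C / real n \<le> hit_prob K {u. snd u < n + j + 2} (burst \<epsilon> j n) (x, n)" by (simp add: C_def)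
  qed auto
  then obtain N where N: "\<And>n. N \<le> n \<Longrightarrow> 1 \<le> n \<and> C0 \<le> real n" "\<And>n x. N \<le> n \<Longrightarrow> (x, n) \<in> A \<Longrightarrow> real n \<le> real x powr \<alpha> + \<kappa> \<Longrightarrow>
      C / real n \<le> hit_prob K {u. snd u < n + j + 2} (burst \<epsilon> j n) (x, n)"
    by (auto simp: eventually_sequentially)
  define T where "T = (\<Union>n\<in>{N..}. burst \<epsilon> j n) \<union> {(x, y). real x powr \<alpha> + \<kappa> < real y}"
  have CN: "C \<le> real n" "0 < n" if "N \<le> n" for n using N(1)[OF that] C0 by (auto simp: C_def)
  have attempts: "1 - (\<Prod>l<k. 1 - C / real (n + l * (j + 2))) \<le> hit_prob K UNIV T (x, n)"
    if "N \<le> n" "(x, n) \<in> A" for k n x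
    using that
  proof (induction k arbitrary: n x)
    case 0
    then show ?case by (simp add: hit_prob_nonneg)
  next
    case (Suc k)
    define b where "b = 1 - (\<Prod>l<k. 1 - C / real (n + (j + 2) + l * (j + 2)))"
    define L where "L = {u::state. snd u = n + j + 2}"
    have fac: "0 \<le> 1 - C / real (n + l) \<and> 1 - C / real (n + l) \<le> 1" for l
      using C CN[of "n + l"] Suc.prems(1) by simp
    have fac': "0 \<le> (\<Prod>l<k. 1 - C / real (n + (j + 2) + l * (j + 2)))" "(\<Prod>l<k. 1 - C / real (n + (j + 2) + l * (j + 2))) \<le> 1"
      using fac[of "j + 2 + l * (j + 2)" for l] by (auto intro!: prod_nonneg prod_le_1 simp only: add.assoc)
    then have b: "0 \<le> b" "b \<le> 1" by (auto simp: b_def)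
    have prod: "(\<Prod>l<Suc k. 1 - C / real (n + l * (j + 2))) = (1 - C / real n) * (1 - b)"
      unfolding b_def prod.lessThan_Suc_shift by (simp add: algebra_simps)
    show ?case
    proof (cases "(x, n) \<in> T")
      case True
      have "0 \<le> (1 - C / real n) * (1 - b)" using fac[of 0] b by simp
      then show ?thesis unfolding prod using True by (simp add: hit_prob_target)
    next
      case False
      then have near: "real n \<le> real x powr \<alpha> + \<kappa>" by (auto simp: T_def)
      have "b * hit_prob K UNIV (T \<union> L) (x, n) + (1 - b) * hit_prob K (- L) T (x, n) \<le> hit_prob K UNIV T (x, n)"
      proof (rule hit_prob_checkpoint[where I=A])
        fix v assume v: "v \<in> A" "v \<in> L"
        then have "v = (fst v, n + (j + 2))" by (cases v) (auto simp: L_def)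
        then show "b \<le> hit_prob K UNIV T v"
          using Suc.IH[of "n + (j + 2)" "fst v"] v Suc.prems unfolding b_def by simp
      qed (use closed b Suc.prems in auto)
      moreover have "hit_prob K UNIV (T \<union> L) (x, n) = 1"
        by (rule hit_level[where L="n + j + 2"]) (use Suc.prems in \<open>auto simp: L_def\<close>)
      moreover have "C / real n \<le> hit_prob K (- L) T (x, n)"
      proof -
        have "C / real n \<le> hit_prob K {u. snd u < n + j + 2} (burst \<epsilon> j n) (x, n)"
          using N(2) Suc.prems near by blast
        also have "\<dots> \<le> hit_prob K (- L) T (x, n)"
          by (rule hit_prob_mono_region) (use Suc.prems in \<open>auto simp: L_def T_def\<close>)
        finally show ?thesis .
      qed
      then have "(1 - b) * (C / real n) \<le> (1 - b) * hit_prob K (- L) T (x, n)"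
        using b by (intro mult_left_mono) auto
      ultimately show ?thesis unfolding prod by (simp add: algebra_simps)
    qed
  qed
  have half: "1 / 2 \<le> hit_prob K UNIV T u" if u: "u \<in> A" "N \<le> snd u" for u
  proof -
    obtain x n where xn: "u = (x, n)" by (cases u)
    obtain k where k: "(\<Prod>l<k. 1 - C / real (n + l * (j + 2))) \<le> 1 / 2"
      using harmonic_product_small[OF C CN(1)[of n] CN(2)[of n], of "j + 2"] u xn by auto
    show ?thesis using attempts[of n x k] k u xn by simp
  qed
  define S where "S = {u. u \<notin> T \<and> N \<le> snd u}"
  have "AE \<omega> in M. \<exists>\<^sub>F t in sequentially. Z t \<omega> \<notin> S"
  proof (rule AE_frequently_outside[where A=A and c="1 / 2"])
    show "AE \<omega> in M. \<forall>t. Z t \<omega> \<in> A" using AE_valid_path by (auto simp: valid_path_def elim: eventually_mono)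
    fix u assume "u \<in> S" "u \<in> A"
    then have "1 / 2 \<le> hit_prob K UNIV T u" using half by (simp add: S_def)
    also have "\<dots> \<le> hit_prob K UNIV (- S) u" by (rule hit_prob_mono_region) (auto simp: S_def)
    finally show "1 / 2 \<le> hit_prob K UNIV (- S) u" .
  qed simp
  with AE_valid_path show ?thesis
  proof (eventually_elim, intro impI)
    fix \<omega> assume v: "valid_path (\<lambda>t. Z t \<omega>)" and fr: "\<exists>\<^sub>F t in sequentially. Z t \<omega> \<notin> S"
      and near: "eventually (\<lambda>t. real (snd (Z t \<omega>)) \<le> real (fst (Z t \<omega>)) powr \<alpha> + \<kappa>) sequentially"
    have "eventually (\<lambda>t. N \<le> snd (Z t \<omega>)) sequentially"
      using valid_path_tendsto(2)[OF v] by (simp add: filterlim_at_top)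
    with near have "\<exists>\<^sub>F t in sequentially. Z t \<omega> \<notin> S \<and> N \<le> snd (Z t \<omega>) \<and> real (snd (Z t \<omega>)) \<le> real (fst (Z t \<omega>)) powr \<alpha> + \<kappa>"
      by (intro frequently_eventually_frequently[OF fr]) (rule eventually_conj)
    then show "\<exists>\<^sub>F t in sequentially. 1 + real j - e \<le> real (snd (Z t \<omega>)) - real (fst (Z t \<omega>)) powr \<alpha>"
    proof (rule frequently_elim1)
      fix t assume t: "Z t \<omega> \<notin> S \<and> N \<le> snd (Z t \<omega>) \<and> real (snd (Z t \<omega>)) \<le> real (fst (Z t \<omega>)) powr \<alpha> + \<kappa>"
      then obtain n where n: "N \<le> n" "Z t \<omega> \<in> burst \<epsilon> j n" by (auto simp: S_def T_def split: prod.splits)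
      then have "1 + real j - real j * \<epsilon> \<le> real (snd (Z t \<omega>)) - real (fst (Z t \<omega>)) powr \<alpha>"
        using burst_far[OF \<alpha> \<epsilon>(1), of n "fst (Z t \<omega>)" "snd (Z t \<omega>)" j] N(1)[OF n(1)] by simp
      then show "1 + real j - e \<le> real (snd (Z t \<omega>)) - real (fst (Z t \<omega>)) powr \<alpha>" using \<epsilon>(3) by linarith
    qed
  qed
qed

end

section \<open>Upper boundaries below the diagonal\<close>

lemma limsup_eqI:
  fixes f :: "nat \<Rightarrow> real"
  assumes "\<And>e. 0 < e \<Longrightarrow> eventually (\<lambda>t. f t \<le> l + e) sequentially"
    and "\<And>e. 0 < e \<Longrightarrow> \<exists>\<^sub>F t in sequentially. l - e \<le> f t"
  shows "limsup (\<lambda>t. ereal (f t)) = ereal l"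
proof (rule antisym)
  show "limsup (\<lambda>t. ereal (f t)) \<le> ereal l"
  proof (rule ereal_le_epsilon2)
    fix e :: real assume "0 < e"
    then have "limsup (\<lambda>t. ereal (f t)) \<le> ereal (l + e)"
      by (intro Limsup_bounded) (auto intro: eventually_mono[OF assms(1)])
    then show "limsup (\<lambda>t. ereal (f t)) \<le> ereal l + ereal e" by simp
  qed
  show "ereal l \<le> limsup (\<lambda>t. ereal (f t))"
  proof (rule ereal_le_epsilon2)
    fix e :: real assume e: "0 < e"
    have "ereal (l - e) \<le> limsup (\<lambda>t. ereal (f t))"
    proof (rule ccontr)
      assume "\<not> ereal (l - e) \<le> limsup (\<lambda>t. ereal (f t))"
      then have "limsup (\<lambda>t. ereal (f t)) < ereal (l - e)" by simp
      then have "eventually (\<lambda>t. ereal (f t) < ereal (l - e)) sequentially"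
        by (rule Limsup_lessD)
      then have "\<not> (\<exists>\<^sub>F t in sequentially. l - e \<le> f t)"
        by (auto simp: frequently_def not_le elim: eventually_mono)
      then show False using assms(2)[OF e] by simp
    qed
    then show "ereal l \<le> limsup (\<lambda>t. ereal (f t)) + ereal e"
      by (cases "limsup (\<lambda>t. ereal (f t))") auto
  qed
qed

lemma liminf_eqI:
  fixes f :: "nat \<Rightarrow> real"
  assumes "\<And>e. 0 < e \<Longrightarrow> eventually (\<lambda>t. l - e \<le> f t) sequentially"
    and "\<And>e. 0 < e \<Longrightarrow> \<exists>\<^sub>F t in sequentially. f t \<le> l + e"
  shows "liminf (\<lambda>t. ereal (f t)) = ereal l"
proof -
  have "limsup (\<lambda>t. ereal (- f t)) = ereal (- l)"
  proof (rule limsup_eqI)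
    show "eventually (\<lambda>t. - f t \<le> - l + e) sequentially" if "0 < e" for e
      using assms(1)[OF that] by (rule eventually_mono) simp
    show "\<exists>\<^sub>F t in sequentially. - l - e \<le> - f t" if "0 < e" for e
      using assms(2)[OF that] by (rule frequently_elim1) simp
  qed
  moreover have "limsup (\<lambda>t. ereal (- f t)) = - liminf (\<lambda>t. ereal (f t))"
    using ereal_Limsup_uminus[of sequentially "\<lambda>t. ereal (f t)"] by simp
  ultimately have "- liminf (\<lambda>t. ereal (f t)) = - ereal l" by simp
  then show ?thesis by (simp only: ereal_uminus_eq_iff)
qed

lemma summable_exp_powr:
  fixes c \<eta> :: real
  assumes "0 < c" "0 < \<eta>"
  shows "summable (\<lambda>n. exp (- (c * real n powr \<eta>)))"
proof (rule summable_comparison_test_bigo)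
  show "(\<lambda>n. exp (- (c * real n powr \<eta>))) \<in> O(\<lambda>n. real n powr - 2)"
    using assms by real_asymp
  show "summable (\<lambda>n. norm (real n powr - 2))" by (simp add: summable_real_powr_iff)
qed

context reflected_walk begin

text \<open>
  The first column in which the walk at level y is no longer reflected by the upper boundary.
\<close>

definition first_free :: "nat \<Rightarrow> nat" where
  "first_free y = (LEAST x. real y + 1 \<le> real x powr \<gamma>)"

lemma first_free:
  shows first_free_ge: "real y + 1 \<le> real (first_free y) powr \<gamma>"
    and first_free_le: "real y + 1 \<le> real x powr \<gamma> \<Longrightarrow> first_free y \<le> x"
    and first_free_bound: "real (first_free y) \<le> (real y + 1) powr (1 / \<gamma>) + 1"
proof -
  define x0 where "x0 = nat \<lceil>(real y + 1) powr (1 / \<gamma>)\<rceil>"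
  have \<gamma>: "0 < \<gamma>" using parameters by simp
  have "((real y + 1) powr (1 / \<gamma>)) powr \<gamma> \<le> real x0 powr \<gamma>"
    using \<gamma> unfolding x0_def by (intro powr_mono2) (auto simp: real_nat_ceiling_ge)
  then have x0: "real y + 1 \<le> real x0 powr \<gamma>" using \<gamma> by (simp add: powr_powr)
  show "real y + 1 \<le> real (first_free y) powr \<gamma>"
    unfolding first_free_def by (rule LeastI) (rule x0)
  show le: "real y + 1 \<le> real x powr \<gamma> \<Longrightarrow> first_free y \<le> x" for x
    unfolding first_free_def by (rule Least_le)
  have "0 \<le> (real y + 1) powr (1 / \<gamma>)" by simp
  then have "real x0 \<le> (real y + 1) powr (1 / \<gamma>) + 1" unfolding x0_def by linarith
  moreover have "real (first_free y) \<le> real x0" using le[OF x0] by simp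
  ultimately show "real (first_free y) \<le> (real y + 1) powr (1 / \<gamma>) + 1" by linarith
qed

lemma frequently_up:
  assumes s: "valid_path s"
  shows "\<exists>\<^sub>F t in sequentially. s (Suc t) = (fst (s t), snd (s t) + 1) \<and> \<not> upp \<gamma> (s t)"
proof (rule ccontr)
  assume "\<not> ?thesis"
  then obtain N where N: "\<And>t. N \<le> t \<Longrightarrow> \<not> (s (Suc t) = (fst (s t), snd (s t) + 1) \<and> \<not> upp \<gamma> (s t))"
    by (auto simp: frequently_def eventually_sequentially)
  have "snd (s (N + t)) = snd (s N)" for t
  proof (induction t)
    case (Suc t)
    then show ?case using N[of "N + t"] by (cases rule: valid_path_step[OF s, of "N + t"]) auto
  qed simp
  moreover have "eventually (\<lambda>t. snd (s N) + 1 \<le> snd (s t)) sequentially"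
    using valid_path_tendsto(2)[OF s] by (simp add: filterlim_at_top)
  then obtain t where "snd (s N) + 1 \<le> snd (s t)" "N \<le> t"
    by (auto simp: eventually_sequentially) (meson nat_le_linear order_refl)
  moreover from this have "t = N + (t - N)" by simp
  ultimately show False by (metis Suc_eq_plus1 not_less_eq_eq order_refl)
qed

definition beyond :: "real \<Rightarrow> nat \<Rightarrow> state set" where
  "beyond e y = {u. snd u = y \<and> real y + 1 + e < real (fst u) powr \<gamma>}"

definition cap :: "real \<Rightarrow> nat \<Rightarrow> nat" where
  "cap e y = nat \<lfloor>(real y + 1 + e) powr (1 / \<gamma>)\<rfloor>"

text \<open>
  To get 1 + e below the boundary at level y, the walk must resist an up in every column from
  \<open>first_free y\<close> to \<open>cap e y\<close>, and among these the chance of an up is smallest in the last one.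
\<close>

lemma upper_overshoot_bound:
  assumes e: "0 < e" "1 \<le> y" and A: "(first_free y, y) \<in> A"
  shows "reach_prob K {u. snd u = y} (beyond e y) m (first_free y, y)
    \<le> (1 - pu (cap e y) y) ^ (cap e y + 1 - first_free y)"
proof -
  define X where "X = cap e y"
  define p where "p = pu X y"
  define g where "g = (\<lambda>(x, y'). if y' = y then (1 - p) ^ (X + 1 - x) else 0)"
  define I where "I = {u \<in> A. first_free y \<le> fst u}"
  have \<gamma>0: "0 < \<gamma>" using parameters by simp
  have y: "0 < real y powr \<beta>2" using e by simp
  have p: "0 \<le> p" "p \<le> 1" by (simp_all add: p_def up_prob_bounds)
  have X: "real x powr \<gamma> \<le> real y + 1 + e \<longleftrightarrow> x \<le> X" for x
  proof -
    have "real x powr \<gamma> \<le> real y + 1 + e \<longleftrightarrow> real x \<le> (real y + 1 + e) powr (1 / \<gamma>)"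
      using \<gamma>0 e by (intro powr_le_iff_le_powr) auto
    also have "\<dots> \<longleftrightarrow> x \<le> X" unfolding X_def cap_def by (simp add: le_nat_floor le_floor_iff le_nat_iff)
    finally show ?thesis .
  qed
  have "reach_prob K {u. snd u = y} (beyond e y) m (first_free y, y) \<le> g (first_free y, y)"
  proof (rule reach_prob_le_super[where I=I])
    fix v assume v: "v \<in> I"
    then show "finite (set_pmf (K v))" by (simp add: I_def finite_set_K)
    obtain x y' where xy: "v = (x, y')" by (cases v)
    have xA: "(x, y') \<in> A" "first_free y \<le> x" using v xy by (auto simp: I_def)
    show "0 \<le> g v" using p by (simp add: g_def xy)
    show "v \<in> beyond e y \<Longrightarrow> 1 \<le> g v"
      using X[of x] by (simp add: g_def xy beyond_def)
    assume T: "v \<notin> beyond e y" and R: "v \<in> {u. snd u = y}"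
    show "set_pmf (K v) \<subseteq> I"
    proof
      fix w assume w: "w \<in> set_pmf (K v)"
      then have "w \<in> A" "w \<in> {(x + 1, y'), (x, y' + 1)}" using closed[OF xA(1)] set_K(1)[OF xA(1)] xy by auto
      with xA show "w \<in> I" by (auto simp: I_def)
    qed
    have y': "y' = y" using R xy by simp
    have xX: "x \<le> X" using T X[of x] xy y' by (auto simp: beyond_def)
    show "measure_pmf.expectation (K v) g \<le> g v"
    proof (cases "low \<alpha> (x, y)")
      case True
      then show ?thesis using K_low xA xy y' p by (simp add: g_def)
    next
      case False
      have "real (first_free y) powr \<gamma> \<le> real x powr \<gamma>" using xA(2) \<gamma>0 by (intro powr_mono2) auto
      then have nu: "\<not> upp \<gamma> (x, y)" using first_free_ge[of y] by (simp add: upp_def)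
      have "p \<le> pu x y"
      proof -
        have "real x powr \<beta>1 \<le> real X powr \<beta>1" using xX parameters by (intro powr_mono2) auto
        then show ?thesis unfolding p_def up_prob_def using y by (intro divide_left_mono mult_pos_pos add_nonneg_pos) auto
      qed
      then have "(1 - pu x y) * (1 - p) ^ (X - x) \<le> (1 - p) * (1 - p) ^ (X - x)"
        using p by (intro mult_right_mono) auto
      also have "\<dots> = (1 - p) ^ (X + 1 - x)" using xX by (simp add: Suc_diff_le)
      finally show ?thesis
        using expectation_interior[of x y g] xA nu False by (simp add: xy y' g_def)
    qed
  qed (use A in \<open>simp add: I_def\<close>)
  then show ?thesis by (simp add: g_def p_def X_def)
qed

text \<open>
  The number of such columns is at least of order \<open>y powr (1 / \<gamma> - 1)\<close>, and the chance of an up in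
  each at least of order \<open>y powr - max 0 (\<beta>1 / \<gamma> - \<beta>2)\<close>. The product of the two is a positive power
  of y because \<open>\<gamma>\<close> lies below 1 and above the critical exponent.
\<close>

lemma upper_overshoot_rate:
  assumes \<gamma>: "\<gamma> < 1" and fast: "\<beta>1 - 1 < \<gamma> * (\<beta>2 - 1)" and e: "0 < e"
  shows "\<exists>c>0. \<exists>\<eta>>0. eventually (\<lambda>y. (1 - pu (cap e y) y) ^ (cap e y + 1 - first_free y) \<le> exp (- (c * real y powr \<eta>))) sequentially"
proof -
  define X where "X = cap e"
  define p where "p y = pu (X y) y" for y
  define b where "b = 1 / \<gamma>"
  have \<gamma>0: "0 < \<gamma>" using parameters by simp
  have b: "1 < b" using \<gamma> \<gamma>0 by (simp add: b_def)
  define \<mu> where "\<mu> = max 0 (b * \<beta>1 - \<beta>2)"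
  define \<eta> where "\<eta> = b - 1 - \<mu>"
  have "\<gamma> * b = 1" using \<gamma>0 by (simp add: b_def)
  have "b * (\<beta>1 - 1) < b * (\<gamma> * (\<beta>2 - 1))" using fast b by (intro mult_strict_left_mono) auto
  then have "b * (\<beta>1 - 1) < \<beta>2 - 1" using \<open>\<gamma> * b = 1\<close> by (metis mult.assoc mult.commute mult_1)
  then have \<eta>: "0 < \<eta>" using b by (auto simp: \<eta>_def \<mu>_def algebra_simps)
  define E where "E = (2 + e) powr (b * \<beta>1) + 1"
  have E: "0 < E" by (auto simp: E_def intro: add_nonneg_pos)
  define c where "c = e / 2 / E"
  have c: "0 < c" using e E by (simp add: c_def)
  have "eventually (\<lambda>y. 1 \<le> e / 2 * real y powr (b - 1)) sequentially"
    using b e by real_asymp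
  then have "eventually (\<lambda>y. (1 - p y) ^ (X y + 1 - first_free y) \<le> exp (- (c * real y powr \<eta>))) sequentially"
    using eventually_ge_at_top[of 1]
  proof eventually_elim
    fix y :: nat assume y1: "1 \<le> e / 2 * real y powr (b - 1)" and y: "1 \<le> y"
    define d where "d = X y + 1 - first_free y"
    have ypos: "0 < real y powr \<beta>2" using y by simp
    have XL: "real (X y) \<le> (real y + 1 + e) powr b" "(real y + 1 + e) powr b < real (X y) + 1"
    proof -
      have "0 \<le> (real y + 1 + e) powr b" by simp
      then show "real (X y) \<le> (real y + 1 + e) powr b" "(real y + 1 + e) powr b < real (X y) + 1"
        unfolding X_def cap_def b_def[symmetric] by linarith+
    qed
    have "e * real y powr (b - 1) \<le> (real y + 1 + e) powr b - (real y + 1) powr b"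
    proof -
      have "\<exists>z>real y + 1. z < real y + 1 + e \<and> (real y + 1 + e) powr b - (real y + 1) powr b = (real y + 1 + e - (real y + 1)) * (b * z powr (b - 1))"
        using e by (intro MVT2) (auto intro!: derivative_eq_intros)
      then obtain w where w: "real y + 1 < w" "(real y + 1 + e) powr b - (real y + 1) powr b = e * (b * w powr (b - 1))" by auto
      have "1 * real y powr (b - 1) \<le> b * w powr (b - 1)" using w b by (intro mult_mono powr_mono2) auto
      then show ?thesis unfolding w using e by (simp add: mult_left_mono)
    qed
    then have d: "e / 2 * real y powr (b - 1) \<le> real d"
      using XL first_free_bound[of y] y1 unfolding d_def b_def[symmetric] by linarith
    have "real (X y) powr \<beta>1 \<le> (2 + e) powr (b * \<beta>1) * real y powr (b * \<beta>1)"
    proof -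
      have "real y + 1 + e \<le> (2 + e) * real y" using y e mult_left_mono[of 1 "real y" "1 + e"] by (simp add: algebra_simps)
      then have "(real y + 1 + e) powr b \<le> ((2 + e) * real y) powr b" using e b by (intro powr_mono2) auto
      then have "real (X y) \<le> ((2 + e) * real y) powr b" using XL by linarith
      then have "real (X y) powr \<beta>1 \<le> (((2 + e) * real y) powr b) powr \<beta>1" using parameters by (intro powr_mono2) auto
      then show ?thesis using e by (simp add: powr_powr powr_mult)
    qed
    moreover have "real y powr (b * \<beta>1) \<le> real y powr (\<beta>2 + \<mu>)" using y by (intro powr_mono) (auto simp: \<mu>_def)
    then have "(2 + e) powr (b * \<beta>1) * real y powr (b * \<beta>1) \<le> (2 + e) powr (b * \<beta>1) * real y powr (\<beta>2 + \<mu>)"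
      by (intro mult_left_mono) auto
    moreover have "real y powr \<beta>2 \<le> real y powr (\<beta>2 + \<mu>)" using y by (intro powr_mono) (auto simp: \<mu>_def)
    ultimately have "real (X y) powr \<beta>1 + real y powr \<beta>2 \<le> E * real y powr (\<beta>2 + \<mu>)" by (simp add: E_def algebra_simps)
    then have "real y powr \<beta>2 / (E * real y powr (\<beta>2 + \<mu>)) \<le> p y"
      unfolding p_def up_prob_def using ypos E y by (intro divide_left_mono mult_pos_pos add_nonneg_pos) auto
    moreover have "real y powr \<beta>2 / (E * real y powr (\<beta>2 + \<mu>)) = real y powr - \<mu> / E"
      using ypos E by (simp add: powr_add powr_minus field_simps)
    ultimately have p: "real y powr - \<mu> / E \<le> p y" by simp
    have p1: "p y \<le> 1" by (simp add: p_def up_prob_bounds)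
    have "c * real y powr \<eta> = (e / 2 * real y powr (b - 1)) * (real y powr - \<mu> / E)"
    proof -
      have "real y powr \<eta> = real y powr (b - 1) * real y powr - \<mu>" by (simp add: \<eta>_def powr_add[symmetric])
      then show ?thesis by (simp add: c_def)
    qed
    also have "\<dots> \<le> real d * p y" using d p e E by (intro mult_mono) auto
    finally have cd: "c * real y powr \<eta> \<le> real d * p y" .
    have "(1 - p y) ^ d \<le> exp (- p y) ^ d"
      using p1 exp_ge_add_one_self[of "- p y"] by (intro power_mono) auto
    also have "\<dots> = exp (- (real d * p y))" by (simp add: exp_of_nat_mult[symmetric])
    also have "\<dots> \<le> exp (- (c * real y powr \<eta>))" using cd by simp
    finally show "(1 - p y) ^ (X y + 1 - first_free y) \<le> exp (- (c * real y powr \<eta>))" by (simp add: d_def)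
  qed
  with c \<eta> show ?thesis unfolding p_def X_def by blast
qed

text \<open>
  Barring overshoots, the situation repeats at every level: if the walk enters a level while
  reflected, or passes through its first free column, then it goes up before it is 1 + e below the boundary, and so enters the next level within
  e of the boundary, where it is reflected again.
\<close>

lemma upper_path:
  assumes s: "valid_path s" and e: "0 < e" "e < 1" and upp: "\<exists>\<^sub>F t in sequentially. upp \<gamma> (s t)"
    and fin: "eventually (\<lambda>y. \<forall>t. s t = (first_free y, y) \<longrightarrow>
      \<not> (\<exists>m. reaches {u. snd u = y} (beyond e y) m (\<lambda>i. s (t + i)))) sequentially"
  shows "eventually (\<lambda>t. real (fst (s t)) powr \<gamma> - real (snd (s t)) \<le> 1 + e) sequentially"
proof -
  obtain N where N: "\<And>y t m. y \<ge> N \<Longrightarrow> s t = (first_free y, y) \<Longrightarrow>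
      \<not> reaches {u. snd u = y} (beyond e y) m (\<lambda>i. s (t + i))"
    using fin by (auto simp: eventually_sequentially)
  have "eventually (\<lambda>t. N \<le> snd (s t)) sequentially"
    using valid_path_tendsto(2)[OF s] by (auto simp: filterlim_at_top)
  then obtain t0 where t0: "upp \<gamma> (s t0)" "N \<le> snd (s t0)"
    using frequently_ex[OF frequently_eventually_frequently[OF upp]] by blast
  \<comment> \<open>J says that the current level has been met at, or before, its first free column.\<close>
  define J where "J t \<longleftrightarrow> upp \<gamma> (s t) \<or> (\<exists>r\<le>t. s r = (first_free (snd (s t)), snd (s t)))" for t
  have J_near: "real (fst (s t)) powr \<gamma> \<le> real (snd (s t)) + 1 + e" if "J t" "t0 \<le> t" for t
  proof (cases "upp \<gamma> (s t)")
    case True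
    then show ?thesis using e by (cases "s t") (simp add: upp_def)
  next
    case False
    then obtain r where r: "r \<le> t" "s r = (first_free (snd (s t)), snd (s t))" using \<open>J t\<close> by (auto simp: J_def)
    have lev: "snd (s (r + i)) = snd (s t)" if "i \<le> t - r" for i
      using valid_path_mono(2)[OF s, of r "r + i"] valid_path_mono(2)[OF s, of "r + i" t] that r by simp
    show ?thesis
    proof (rule ccontr)
      assume "\<not> ?thesis"
      then have "reaches {u. snd u = snd (s t)} (beyond e (snd (s t))) (t - r) (\<lambda>i. s (r + i))"
        unfolding reaches_def beyond_def using lev r(1) by (intro exI[of _ "t - r"]) auto
      moreover have "N \<le> snd (s t)" using valid_path_mono(2)[OF s \<open>t0 \<le> t\<close>] t0(2) by simp
      ultimately show False using N r(2) by blast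
    qed
  qed
  have J: "J t" if "t0 \<le> t" for t
    using that
  proof (induction t rule: dec_induct)
    case base
    then show ?case using t0 by (simp add: J_def)
  next
    case (step t)
    show ?case
    proof (rule valid_path_step[OF s, of t])
      assume right: "s (Suc t) = (fst (s t) + 1, snd (s t))"
      consider (a) r where "r \<le> t" "s r = (first_free (snd (s t)), snd (s t))" | (b) "upp \<gamma> (s t)"
        using step.IH by (auto simp: J_def)
      then show ?thesis
      proof cases
        case a
        then show ?thesis using right by (auto simp: J_def intro!: exI[of _ r])
      next
        case b
        show ?thesis
        proof (cases "upp \<gamma> (s (Suc t))")
          case False
          then have free: "real (snd (s t)) + 1 \<le> real (fst (s t) + 1) powr \<gamma>" using right by (simp add: upp_def)
          have "\<not> first_free (snd (s t)) \<le> fst (s t)"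
          proof
            assume "first_free (snd (s t)) \<le> fst (s t)"
            then have "real (first_free (snd (s t))) powr \<gamma> \<le> real (fst (s t)) powr \<gamma>"
              using parameters by (intro powr_mono2) auto
            then show False using first_free_ge[of "snd (s t)"] b by (cases "s t") (simp add: upp_def)
          qed
          with first_free_le[OF free] have "first_free (snd (s t)) = fst (s t) + 1" by simp
          then show ?thesis using right by (auto simp: J_def intro!: exI[of _ "Suc t"])
        qed (simp add: J_def)
      qed
    next
      assume up: "s (Suc t) = (fst (s t), snd (s t) + 1)"
      have "real (fst (s t)) powr \<gamma> \<le> real (snd (s t)) + 1 + e" using J_near step by simp
      then have "upp \<gamma> (s (Suc t))" using up e by (simp add: upp_def)
      then show ?thesis by (simp add: J_def)
    qed
  qed
  have "real (fst (s t)) powr \<gamma> - real (snd (s t)) \<le> 1 + e" if "t0 \<le> t" for t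
    using J_near[OF J[OF that] that] by simp
  then show ?thesis by (auto simp: eventually_sequentially)
qed

lemma AE_upper:
  assumes \<gamma>: "\<gamma> < 1" and fast: "\<beta>1 - 1 < \<gamma> * (\<beta>2 - 1)" and e: "0 < e" "e < 1"
  shows "AE \<omega> in M. (\<exists>\<^sub>F t in sequentially. upp \<gamma> (Z t \<omega>)) \<longrightarrow>
    eventually (\<lambda>t. real (fst (Z t \<omega>)) powr \<gamma> - real (snd (Z t \<omega>)) \<le> 1 + e) sequentially"
proof -
  obtain c \<eta> where c: "0 < c" "0 < \<eta>" "eventually (\<lambda>y. (1 - pu (cap e y) y) ^ (cap e y + 1 - first_free y) \<le> exp (- (c * real y powr \<eta>))) sequentially"
    using upper_overshoot_rate[OF \<gamma> fast e(1)] by blast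
  then obtain n0 where n0: "\<And>y. n0 \<le> y \<Longrightarrow> (1 - pu (cap e y) y) ^ (cap e y + 1 - first_free y) \<le> exp (- (c * real y powr \<eta>))"
    by (auto simp: eventually_sequentially)
  have "AE \<omega> in M. \<forall>\<^sub>F y in sequentially. \<forall>t. Z t \<omega> = (first_free y, y) \<longrightarrow>
      \<not> (\<exists>m. reaches {u. snd u = y} (beyond e y) m (\<lambda>i. Z (t + i) \<omega>))"
  proof (rule AE_eventually_no_excursion[where c="\<lambda>y. exp (- (c * real y powr \<eta>))" and ?n0.0="max n0 1"])
    fix y m assume "max n0 1 \<le> y" "(first_free y, y) \<in> A"
    then show "reach_prob K {u. snd u = y} (beyond e y) m (first_free y, y) \<le> exp (- (c * real y powr \<eta>))"
      using order_trans[OF upper_overshoot_bound[OF e(1), of y m] n0[of y]] by simp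
  qed (use summable_exp_powr c in auto)
  with AE_valid_path show ?thesis
    by eventually_elim (use upper_path[OF _ e] in blast)
qed

end

section \<open>Limits of the distance to the boundary\<close>

text \<open>
  The walk returns to the boundary and its greatest distance from it is c, up to the rise \<open>\<theta>\<close> of the
  boundary between two columns. That rise tends to 0 for \<open>\<alpha> < 1\<close> but equals 1 for \<open>\<alpha> = 1\<close>; the
  strict inequalities are what makes the second case usable.
\<close>

definition hovers :: "real \<Rightarrow> real \<Rightarrow> (nat \<Rightarrow> state) \<Rightarrow> bool" where
  "hovers \<alpha> c s \<longleftrightarrow>
     (\<forall>\<theta>. (\<forall>\<^sub>F x in sequentially. real (x + 1) powr \<alpha> - real x powr \<alpha> \<le> \<theta>) \<longrightarrow>
        (\<forall>\<^sub>F t in sequentially. real (snd (s t)) - real (fst (s t)) powr \<alpha> < c + \<theta>) \<and>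
        (\<exists>\<^sub>F t in sequentially. real (snd (s t)) - real (fst (s t)) powr \<alpha> < \<theta>)) \<and>
     (\<forall>e>0. \<exists>\<^sub>F t in sequentially. c - e \<le> real (snd (s t)) - real (fst (s t)) powr \<alpha>)"

context reflected_walk begin

lemma AE_lower:
  assumes \<alpha>: "\<alpha> \<le> 1" and j: "real j * \<delta> \<le> 1" "1 < real (j + 1) * \<delta>"
  shows "AE \<omega> in M. (\<exists>\<^sub>F t in sequentially. low \<alpha> (Z t \<omega>)) \<longrightarrow>
    hovers \<alpha> (1 + real j) (\<lambda>t. Z t \<omega>)"
proof -
  have \<delta>: "0 < \<delta>" 
  proof (rule ccontr)
    assume "\<not> 0 < \<delta>"
    then have "real (j + 1) * \<delta> \<le> 0" by (intro mult_nonneg_nonpos) auto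
    with j(2) show False by linarith
  qed
  have many: "AE \<omega> in M. \<forall>n. eventually (\<lambda>t. real (snd (Z t \<omega>)) \<le> real (fst (Z t \<omega>)) powr \<alpha> + (real j + 2)) sequentially \<longrightarrow>
    (\<exists>\<^sub>F t in sequentially. 1 + real j - 1 / (real n + 2) \<le> real (snd (Z t \<omega>)) - real (fst (Z t \<omega>)) powr \<alpha>)"
    unfolding AE_all_countable
  proof (intro allI AE_many_ups[OF \<alpha> \<delta> j(1)])
    show "1 / (real n + 2) \<le> 1 / 2" for n by (intro divide_left_mono) auto
  qed auto
  show ?thesis
    using AE_valid_path AE_few_ups[OF \<alpha> j(2)] many
  proof (eventually_elim, intro impI)
    fix \<omega>
    define s where "s = (\<lambda>t. Z t \<omega>)"
    define dist where "dist t = real (snd (s t)) - real (fst (s t)) powr \<alpha>" for t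
    assume v: "valid_path (\<lambda>t. Z t \<omega>)" and low: "\<exists>\<^sub>F t in sequentially. low \<alpha> (Z t \<omega>)"
      and few: "(\<exists>\<^sub>F t in sequentially. low \<alpha> (Z t \<omega>)) \<longrightarrow>
        few_ups j (\<lambda>t. Z t \<omega>)"
      and many: "\<forall>n. eventually (\<lambda>t. real (snd (Z t \<omega>)) \<le> real (fst (Z t \<omega>)) powr \<alpha> + (real j + 2)) sequentially \<longrightarrow>
        (\<exists>\<^sub>F t in sequentially. 1 + real j - 1 / (real n + 2) \<le> real (snd (Z t \<omega>)) - real (fst (Z t \<omega>)) powr \<alpha>)"
    have v: "valid_path s" using v by (simp add: s_def)
    have low: "\<exists>\<^sub>F t in sequentially. low \<alpha> (s t)" using low by (simp add: s_def)
    have few: "few_ups j s"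
      using few low by (simp add: s_def)
    have gap: "eventually (\<lambda>t. dist t < 1 + real j + \<theta>) sequentially \<and> (\<exists>\<^sub>F t in sequentially. dist t < \<theta>)"
      if \<theta>: "eventually (\<lambda>x. real (x + 1) powr \<alpha> - real x powr \<alpha> \<le> \<theta>) sequentially" for \<theta>
    proof
      obtain X where X: "\<And>x. X \<le> x \<Longrightarrow> real (x + 1) powr \<alpha> - real x powr \<alpha> \<le> \<theta>"
        using \<theta> by (auto simp: eventually_sequentially)
      obtain L where L: "\<And>x y. (x, y) \<in> A \<Longrightarrow> L \<le> x + y \<Longrightarrow> X < x \<and> X < y" using level_large[of X] by blast
      have "eventually (\<lambda>t. L + j + 1 \<le> snd (s t)) sequentially"
        using valid_path_tendsto(2)[OF v] by (simp add: filterlim_at_top)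
      with few[unfolded few_ups_def] show "eventually (\<lambda>t. dist t < 1 + real j + \<theta>) sequentially"
      proof eventually_elim
        case (elim t)
        then obtain x n where xn: "(x, n) \<in> A" "low \<alpha> (x, n)" "x \<le> fst (s t)" "snd (s t) \<le> n + j + 1" by blast
        have "real x powr \<alpha> \<le> real (fst (s t)) powr \<alpha>" using xn(3) parameters by (intro powr_mono2) auto
        moreover have "real (x + 1) powr \<alpha> - real x powr \<alpha> \<le> \<theta>" using L[OF xn(1)] xn(4) elim(2) by (intro X) simp
        moreover have "real n < real (x + 1) powr \<alpha>" using xn(2) by (simp add: low_def)
        moreover have "real (snd (s t)) \<le> real n + real j + 1" using xn(4) by linarith
        ultimately show ?case unfolding dist_def by linarith
      qed
      have "eventually (\<lambda>t. X \<le> fst (s t)) sequentially"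
        using valid_path_tendsto(1)[OF v] by (simp add: filterlim_at_top)
      from frequently_eventually_frequently[OF low this]
      show "\<exists>\<^sub>F t in sequentially. dist t < \<theta>"
      proof (rule frequently_elim1)
        fix t assume t: "low \<alpha> (s t) \<and> X \<le> fst (s t)"
        then have "real (snd (s t)) < real (fst (s t) + 1) powr \<alpha>" by (cases "s t") (simp add: low_def)
        then show "dist t < \<theta>" using X[of "fst (s t)"] t unfolding dist_def by linarith
      qed
    qed
    have "real (x + 1) powr \<alpha> - real x powr \<alpha> \<le> 1" if "1 \<le> x" for x
    proof -
      have "real (x + 1) powr \<alpha> - real x powr \<alpha> \<le> \<alpha> * 1 * real x powr (\<alpha> - 1)"
        using powr_concave_diff_le[of \<alpha> "real x" 1] parameters \<alpha> that by (simp add: add.commute)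
      also have "\<dots> \<le> 1 * 1 * real x powr 0"
        using \<alpha> parameters that by (intro mult_mono powr_mono) auto
      finally show ?thesis using that by simp
    qed
    then have "eventually (\<lambda>x. real (x + 1) powr \<alpha> - real x powr \<alpha> \<le> 1) sequentially"
      by (auto simp: eventually_sequentially)
    from gap[OF this] have "eventually (\<lambda>t. real (snd (s t)) \<le> real (fst (s t)) powr \<alpha> + (real j + 2)) sequentially"
      by (auto simp: dist_def elim!: eventually_mono)
    then have many: "\<exists>\<^sub>F t in sequentially. 1 + real j - 1 / (real n + 2) \<le> dist t" for n
      using many by (simp add: s_def dist_def)
    have "\<exists>\<^sub>F t in sequentially. 1 + real j - e \<le> dist t" if e: "0 < e" for e
    proof -
      obtain n where n: "1 / e < real n" using reals_Archimedean2 by blast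
      then have "1 / (real n + 2) \<le> e" using e by (simp add: field_simps)
      then show ?thesis by (intro frequently_elim1[OF many[of n]]) simp
    qed
    with gap show "hovers \<alpha> (1 + real j) (\<lambda>t. Z t \<omega>)"
      unfolding hovers_def dist_def s_def by blast
  qed
qed

lemma valid_path_above: "valid_path s \<Longrightarrow> real (fst (s t)) powr \<alpha> \<le> real (snd (s t))"
  and valid_path_below: "valid_path s \<Longrightarrow> real (snd (s t)) \<le> real (fst (s t)) powr \<gamma>"
  using valid_path_A[of s t] above[of "fst (s t)" "snd (s t)"] below[of "fst (s t)" "snd (s t)"] by auto

lemma AE_lower_limits:
  assumes \<alpha>: "\<alpha> < 1" and j: "real j * \<delta> \<le> 1" "1 < real (j + 1) * \<delta>"
  shows "AE \<omega> in M. (\<exists>\<^sub>F t in sequentially. low \<alpha> (Z t \<omega>)) \<longrightarrow> (\<lambda>t. Z t \<omega>) \<in> A_event \<alpha> (int j + 1)"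
  using AE_valid_path AE_lower[OF less_imp_le[OF \<alpha>] j]
proof (eventually_elim, intro impI)
  fix \<omega> assume v: "valid_path (\<lambda>t. Z t \<omega>)" and low: "\<exists>\<^sub>F t in sequentially. low \<alpha> (Z t \<omega>)"
  define d where "d t = real (snd (Z t \<omega>)) - real (fst (Z t \<omega>)) powr \<alpha>" for t
  assume "(\<exists>\<^sub>F t in sequentially. low \<alpha> (Z t \<omega>)) \<longrightarrow>
    hovers \<alpha> (1 + real j) (\<lambda>t. Z t \<omega>)"
  with low have gap: "\<And>\<theta>. eventually (\<lambda>x. real (x + 1) powr \<alpha> - real x powr \<alpha> \<le> \<theta>) sequentially \<Longrightarrow>
      eventually (\<lambda>t. d t < 1 + real j + \<theta>) sequentially \<and> (\<exists>\<^sub>F t in sequentially. d t < \<theta>)"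
    and many: "\<And>e. 0 < e \<Longrightarrow> \<exists>\<^sub>F t in sequentially. 1 + real j - e \<le> d t"
    by (auto simp: d_def hovers_def)
  have small: "eventually (\<lambda>x. real (x + 1) powr \<alpha> - real x powr \<alpha> \<le> \<theta>) sequentially" if "0 < \<theta>" for \<theta>
  proof -
    have "((\<lambda>x. (real x + 1) powr \<alpha> - real x powr \<alpha>) \<longlongrightarrow> 0) sequentially"
      using parameters(1) \<alpha> by real_asymp
    then have "eventually (\<lambda>x. (real x + 1) powr \<alpha> - real x powr \<alpha> < \<theta>) sequentially"
      using that by (rule order_tendstoD)
    then show ?thesis by (rule eventually_mono) (simp add: add.commute)
  qed
  have "limsup (\<lambda>t. ereal (d t)) = ereal (1 + real j)"
  proof (rule limsup_eqI)
    fix e :: real assume e: "0 < e"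
    show "eventually (\<lambda>t. d t \<le> 1 + real j + e) sequentially"
      using gap[OF small[OF e]] by (auto elim: eventually_mono)
  qed (rule many)
  moreover have "liminf (\<lambda>t. ereal (d t)) = ereal 0"
  proof (rule liminf_eqI)
    fix e :: real assume e: "0 < e"
    have "0 - e \<le> d t" for t using valid_path_above[OF v, of t] e by (simp add: d_def)
    then show "eventually (\<lambda>t. 0 - e \<le> d t) sequentially" by simp
    from gap[OF small[OF e]] show "\<exists>\<^sub>F t in sequentially. d t \<le> 0 + e" by (auto elim: frequently_elim1)
  qed
  ultimately show "(\<lambda>t. Z t \<omega>) \<in> A_event \<alpha> (int j + 1)"
    by (simp add: A_event_def d_def zero_ereal_def add.commute)
qed

lemma AE_diagonal_limits:
  assumes \<alpha>: "\<alpha> = 1" and j: "real j * \<delta> \<le> 1" "1 < real (j + 1) * \<delta>"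
  shows "AE \<omega> in M. (\<exists>\<^sub>F t in sequentially. low \<alpha> (Z t \<omega>)) \<longrightarrow> (\<lambda>t. prod.swap (Z t \<omega>)) \<in> E_event (int j + 1)"
  using AE_valid_path AE_lower[OF eq_refl[OF \<alpha>] j]
proof (eventually_elim, intro impI)
  fix \<omega> assume v: "valid_path (\<lambda>t. Z t \<omega>)" and low: "\<exists>\<^sub>F t in sequentially. low \<alpha> (Z t \<omega>)"
    and "(\<exists>\<^sub>F t in sequentially. low \<alpha> (Z t \<omega>)) \<longrightarrow> hovers \<alpha> (1 + real j) (\<lambda>t. Z t \<omega>)"
  then have hov: "hovers 1 (1 + real j) (\<lambda>t. Z t \<omega>)" using \<alpha> by simp
  define d where "d t = int (snd (Z t \<omega>)) - int (fst (Z t \<omega>))" for t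
  have dr: "real (snd (Z t \<omega>)) - real (fst (Z t \<omega>)) = real_of_int (d t)" for t by (simp add: d_def)
  \<comment> \<open>Here \<theta> = 1 is admissible; the strict bounds become exact values because d is an integer.\<close>
  have gap: "(\<forall>\<^sub>F t in sequentially. real_of_int (d t) < 1 + real j + 1) \<and> (\<exists>\<^sub>F t in sequentially. real_of_int (d t) < 1)"
    using hov[unfolded hovers_def, THEN conjunct1, THEN spec, THEN mp, of 1] by (simp add: dr)
  have many: "\<exists>\<^sub>F t in sequentially. 1 + real j - 1 / 2 \<le> real_of_int (d t)"
    using hov[unfolded hovers_def, THEN conjunct2, THEN spec, THEN mp, of "1 / 2"] by (simp add: dr)
  have d_le: "\<forall>\<^sub>F t in sequentially. d t \<le> int j + 1"
    using gap[THEN conjunct1] by (rule eventually_mono) linarith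
  have d0: "0 \<le> d t" for t using valid_path_above[OF v, of t] \<alpha> by (simp add: d_def)
  have zero: "\<exists>\<^sub>F t in sequentially. d t = 0"
    using gap[THEN conjunct2] d0 by (auto elim!: frequently_elim1 intro: antisym)
  have top: "\<exists>\<^sub>F t in sequentially. d t = int j + 1"
    using frequently_eventually_frequently[OF many d_le] by (rule frequently_elim1) linarith
  have "limsup (\<lambda>t. ereal (real_of_int (d t))) = ereal (real j + 1)"
  proof (rule limsup_eqI)
    fix e :: real assume e: "0 < e"
    show "\<forall>\<^sub>F t in sequentially. real_of_int (d t) \<le> real j + 1 + e"
      using d_le by (rule eventually_mono) (use e in linarith)
    show "\<exists>\<^sub>F t in sequentially. real j + 1 - e \<le> real_of_int (d t)"
      using top by (rule frequently_elim1) (use e in simp)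
  qed
  with zero top show "(\<lambda>t. prod.swap (Z t \<omega>)) \<in> E_event (int j + 1)"
    unfolding E_event_def mem_Collect_eq fst_swap snd_swap dr d_def[symmetric] by simp
qed

lemma AE_upper_limits:
  assumes \<gamma>: "\<gamma> < 1" and fast: "\<beta>1 - 1 < \<gamma> * (\<beta>2 - 1)"
  shows "AE \<omega> in M. (\<exists>\<^sub>F t in sequentially. upp \<gamma> (Z t \<omega>)) \<longrightarrow> (\<lambda>t. Z t \<omega>) \<in> B_event \<gamma>"
proof -
  have "AE \<omega> in M. \<forall>n. (\<exists>\<^sub>F t in sequentially. upp \<gamma> (Z t \<omega>)) \<longrightarrow>
    eventually (\<lambda>t. real (fst (Z t \<omega>)) powr \<gamma> - real (snd (Z t \<omega>)) \<le> 1 + 1 / (real n + 2)) sequentially"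
    unfolding AE_all_countable by (intro allI AE_upper \<gamma> fast) (auto simp: field_simps)
  with AE_valid_path show ?thesis
  proof (eventually_elim, intro impI)
    fix \<omega> assume v: "valid_path (\<lambda>t. Z t \<omega>)" and upp: "\<exists>\<^sub>F t in sequentially. upp \<gamma> (Z t \<omega>)"
    define d where "d t = real (fst (Z t \<omega>)) powr \<gamma> - real (snd (Z t \<omega>))" for t
    assume "\<forall>n. (\<exists>\<^sub>F t in sequentially. upp \<gamma> (Z t \<omega>)) \<longrightarrow>
      eventually (\<lambda>t. real (fst (Z t \<omega>)) powr \<gamma> - real (snd (Z t \<omega>)) \<le> 1 + 1 / (real n + 2)) sequentially"
    with upp have near': "\<And>n. eventually (\<lambda>t. d t \<le> 1 + 1 / (real n + 2)) sequentially" by (simp add: d_def)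
    have near: "eventually (\<lambda>t. d t \<le> 1 + e) sequentially" if e: "0 < e" for e
    proof -
      obtain n where n: "1 / e < real n" using reals_Archimedean2 by blast
      then have "1 / (real n + 2) \<le> e" using e by (simp add: field_simps)
      then show ?thesis by (intro eventually_mono[OF near'[of n]]) simp
    qed
    note up = frequently_up[OF v]
    have "limsup (\<lambda>t. ereal (d t)) = ereal 1"
    proof (rule limsup_eqI)
      fix e :: real assume e: "0 < e"
      show "\<exists>\<^sub>F t in sequentially. 1 - e \<le> d t"
      proof (rule frequently_elim1[OF up])
        fix t assume "Z (Suc t) \<omega> = (fst (Z t \<omega>), snd (Z t \<omega>) + 1) \<and> \<not> upp \<gamma> (Z t \<omega>)"
        then show "1 - e \<le> d t" using e by (cases "Z t \<omega>") (simp add: d_def upp_def)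
      qed
    qed (rule near)
    moreover have "liminf (\<lambda>t. ereal (d t)) = ereal 0"
    proof (rule liminf_eqI)
      fix e :: real assume e: "0 < e"
      have "0 - e \<le> d t" for t using valid_path_below[OF v, of t] e by (simp add: d_def)
      then show "eventually (\<lambda>t. 0 - e \<le> d t) sequentially" by simp
      have "\<exists>\<^sub>F t in sequentially. d (Suc t) \<le> e"
        using frequently_eventually_frequently[OF up near[OF e]]
      proof (rule frequently_elim1)
        fix t assume "(Z (Suc t) \<omega> = (fst (Z t \<omega>), snd (Z t \<omega>) + 1) \<and> \<not> upp \<gamma> (Z t \<omega>)) \<and> d t \<le> 1 + e"
        then show "d (Suc t) \<le> e" by (simp add: d_def)
      qed
      then show "\<exists>\<^sub>F t in sequentially. d t \<le> 0 + e"
        unfolding frequently_sequentially by (metis add_0 le_Suc_eq)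
    qed
    ultimately show "(\<lambda>t. Z t \<omega>) \<in> B_event \<gamma>"
      by (simp add: B_event_def d_def zero_ereal_def one_ereal_def)
  qed
qed

end

section \<open>Exchanging the coordinates\<close>

lemma map_pmf_Not_bernoulli:
  assumes "0 \<le> p" "p \<le> 1"
  shows "map_pmf Not (bernoulli_pmf p) = bernoulli_pmf (1 - p)"
proof (rule pmf_eqI)
  fix b
  have "pmf (map_pmf Not (bernoulli_pmf p)) (Not (\<not> b)) = pmf (bernoulli_pmf p) (\<not> b)"
    by (rule pmf_map_inj') (auto simp: inj_def)
  then show "pmf (map_pmf Not (bernoulli_pmf p)) b = pmf (bernoulli_pmf (1 - p)) b"
    using assms by (cases b) auto
qed

text \<open>
  The upper boundary \<open>x powr \<gamma>\<close> is the lower boundary \<open>y powr (1 / \<gamma>)\<close> of the walk with exchanged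
  coordinates, so that for \<open>\<gamma> \<ge> 1\<close> it needs no separate treatment.
\<close>

lemma markov_chain_from_swap:
  assumes "markov_chain_from M K z Z"
  shows "markov_chain_from M (\<lambda>u. map_pmf prod.swap (K (prod.swap u))) (prod.swap z) (\<lambda>t \<omega>. prod.swap (Z t \<omega>))"
proof -
  have eq: "prod.swap u = v \<longleftrightarrow> u = prod.swap v" for u :: "'b \<times> 'c" and v by (cases u; cases v) auto
  note m = assms[unfolded markov_chain_from_def]
  have pmf: "pmf (map_pmf prod.swap p) u = pmf p (prod.swap u)" for p :: "('b \<times> 'c) pmf" and u
    using pmf_map_inj'[of prod.swap p "prod.swap u"] by simp
  have meas: "(\<lambda>\<omega>. prod.swap (Z t \<omega>)) \<in> measurable M (count_space UNIV)" for t
    by (rule measurable_compose[OF m[THEN conjunct2, THEN conjunct1, rule_format]]) simp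
  have chain: "\<P>(\<omega> in M. \<forall>i\<le>t. Z i \<omega> = s i) \<noteq> 0 \<Longrightarrow>
    \<P>(\<omega> in M. Z (Suc t) \<omega> = s (Suc t) \<bar> \<forall>i\<le>t. Z i \<omega> = s i) = pmf (K (s t)) (s (Suc t))" for t s
    by (rule m[THEN conjunct2, THEN conjunct2, THEN conjunct2, rule_format])
  show ?thesis
    unfolding markov_chain_from_def eq pmf
  proof (intro conjI allI impI)
    show "prob_space M" and "AE \<omega> in M. Z 0 \<omega> = prod.swap (prod.swap z)"
      using m[THEN conjunct1] m[THEN conjunct2, THEN conjunct2, THEN conjunct1] by (simp_all only: swap_swap)
    fix t and s :: "nat \<Rightarrow> 'c \<times> 'b"
    assume "\<P>(\<omega> in M. \<forall>i\<le>t. Z i \<omega> = prod.swap (s i)) \<noteq> 0"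
    then show "\<P>(\<omega> in M. Z (Suc t) \<omega> = prod.swap (s (Suc t)) \<bar> \<forall>i\<le>t. Z i \<omega> = prod.swap (s i)) =
      pmf (K (prod.swap (s t))) (prod.swap (s (Suc t)))"
      by (rule chain[of t "\<lambda>i. prod.swap (s i)"])
  qed (rule meas)
qed

lemma (in reflected_walk) swapped:
  "reflected_walk M (\<lambda>u. map_pmf prod.swap (K (prod.swap u))) (prod.swap z) (\<lambda>t \<omega>. prod.swap (Z t \<omega>))
     (prod.swap ` A) (1 / \<gamma>) (1 / \<alpha>) \<beta>2 \<beta>1"
proof -
  have pos: "0 < \<alpha>" "0 < \<gamma>" using parameters by auto
  have low: "low (1 / \<gamma>) (y, x) \<longleftrightarrow> upp \<gamma> (x, y)" for x y
    using powr_le_iff_le_powr[of "1 / \<gamma>" "real (y + 1)" "real x"] pos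
    unfolding low_def upp_def prod.case not_le[symmetric] by (simp add: add.commute)
  have upp: "upp (1 / \<alpha>) (y, x) \<longleftrightarrow> low \<alpha> (x, y)" for x y
    using powr_le_iff_le_powr[of \<alpha> "real (x + 1)" "real y"] pos
    unfolding low_def upp_def prod.case not_le[symmetric] by (simp add: add.commute)
  have up: "1 - up_prob \<beta>1 \<beta>2 x y = up_prob \<beta>2 \<beta>1 y x" if "(x, y) \<in> A" for x y
  proof -
    have "0 < real x powr \<beta>1" using x_ge_1[OF that] by simp
    then have "0 < real x powr \<beta>1 + real y powr \<beta>2" by (simp add: add_pos_nonneg)
    then show ?thesis by (simp add: up_prob_def field_simps)
  qed
  interpret markov_chain M "\<lambda>u. map_pmf prod.swap (K (prod.swap u))" "prod.swap z" "\<lambda>t \<omega>. prod.swap (Z t \<omega>)"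
    by standard (rule markov_chain_from_swap[OF chain])
  show ?thesis
  proof
    show "prod.swap z \<in> prod.swap ` A" using start by simp
    show "set_pmf (map_pmf prod.swap (K (prod.swap u))) \<subseteq> prod.swap ` A" if "u \<in> prod.swap ` A" for u
    proof -
      have "prod.swap u \<in> A" using that by auto
      from image_mono[OF closed[OF this], of prod.swap] show ?thesis by simp
    qed
    show "\<not> (low (1 / \<gamma>) u \<and> upp (1 / \<alpha>) u)" if "u \<in> prod.swap ` A" for u
      using that not_low_upp low upp by (cases u) auto
    fix y x
    assume "(y, x) \<in> prod.swap ` A"
    then have A: "(x, y) \<in> A" by simp
    show "1 \<le> y" "1 \<le> x" using x_ge_1[OF A] y_ge_1[OF A] by auto
    show "real y powr (1 / \<gamma>) \<le> real x"
      using below[OF A] pos powr_le_iff_le_powr[of "1 / \<gamma>" "real y" "real x"] by simp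
    show "real x \<le> real y powr (1 / \<alpha>)" by (rule powr_le_inverse[OF A])
    show "low (1 / \<gamma>) (y, x) \<Longrightarrow> map_pmf prod.swap (K (prod.swap (y, x))) = return_pmf (y, x + 1)"
      using K_upp[OF A] low by simp
    show "upp (1 / \<alpha>) (y, x) \<Longrightarrow> map_pmf prod.swap (K (prod.swap (y, x))) = return_pmf (y + 1, x)"
      using K_low[OF A] upp by simp
    assume "\<not> low (1 / \<gamma>) (y, x)" "\<not> upp (1 / \<alpha>) (y, x)"
    then have "map_pmf prod.swap (K (prod.swap (y, x))) =
      map_pmf (\<lambda>r. if r then (y, x + 1) else (y + 1, x)) (bernoulli_pmf (up_prob \<beta>2 \<beta>1 y x))"
      using K_interior[OF A] low upp by (simp add: map_pmf_comp up[OF A] if_distrib cong: if_cong)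
    also have "bernoulli_pmf (up_prob \<beta>2 \<beta>1 y x) = map_pmf Not (bernoulli_pmf (1 - up_prob \<beta>2 \<beta>1 y x))"
      using map_pmf_Not_bernoulli[of "1 - up_prob \<beta>2 \<beta>1 y x"] up[OF A] up_prob_bounds[of x y] by simp
    also have "map_pmf (\<lambda>r. if r then (y, x + 1) else (y + 1, x)) \<dots> =
      map_pmf (\<lambda>right. if right then (y + 1, x) else (y, x + 1)) (bernoulli_pmf (1 - up_prob \<beta>2 \<beta>1 y x))"
      unfolding map_pmf_comp by (rule map_pmf_cong) auto
    finally show "map_pmf prod.swap (K (prod.swap (y, x))) =
      map_pmf (\<lambda>right. if right then (y + 1, x) else (y, x + 1)) (bernoulli_pmf (1 - up_prob \<beta>2 \<beta>1 y x))" .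
  qed (use parameters in \<open>auto simp: field_simps\<close>)
qed

lemma balls_in_bins_reflected_walk:
  assumes model: "balls_in_bins M (\<lambda>x. real x powr \<alpha>) (\<lambda>x. real x powr \<gamma>) \<beta>1 \<beta>2 z Z"
    and par: "0 < \<alpha>" "\<alpha> < \<gamma>" "1 < \<beta>1" "1 < \<beta>2"
  obtains A where "reflected_walk M (kernel (\<lambda>x. real x powr \<alpha>) (\<lambda>x. real x powr \<gamma>) \<beta>1 \<beta>2) z Z A \<alpha> \<gamma> \<beta>1 \<beta>2"
proof -
  define \<phi> \<psi> :: "nat \<Rightarrow> real" where "\<phi> x = real x powr \<alpha>" and "\<psi> x = real x powr \<gamma>" for x
  define K where "K = kernel \<phi> \<psi> \<beta>1 \<beta>2"
  define A where "A = {s. (z, s) \<in> {(u, v). v \<in> set_pmf (K u)}\<^sup>*}"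
  have model: "z \<in> Q_dom \<phi> \<psi>" "\<And>s. s \<in> A \<Longrightarrow> \<not> (lower_reflecting \<phi> s \<and> upper_reflecting \<psi> s)" "markov_chain_from M K z Z"
    using model unfolding balls_in_bins_def well_defined_from_def A_def K_def \<phi>_def[abs_def] \<psi>_def[abs_def] by auto
  have mono: "\<phi> x \<le> \<phi> (x + 1)" "\<psi> x \<le> \<psi> (x + 1)" for x
    using par by (auto simp: \<phi>_def \<psi>_def intro!: powr_mono2)
  have lower: "lower_reflecting \<phi> (x, y) \<longleftrightarrow> low \<alpha> (x, y)" and upper: "upper_reflecting \<psi> (x, y) \<longleftrightarrow> upp \<gamma> (x, y)"
    and int: "interior_state \<phi> \<psi> (x, y) \<longleftrightarrow> \<not> low \<alpha> (x, y) \<and> \<not> upp \<gamma> (x, y)"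
    if "(x, y) \<in> Q_dom \<phi> \<psi>" for x y
    using that by (auto simp: lower_reflecting_def upper_reflecting_def interior_state_def low_def upp_def \<phi>_def \<psi>_def Q_dom_def)
  have closed: "v \<in> A" if "u \<in> A" "v \<in> set_pmf (K u)" for u v
    using that unfolding A_def by (auto intro: rtrancl_into_rtrancl)
  have K_interior: "K (x, y) = map_pmf (\<lambda>right. if right then (x + 1, y) else (x, y + 1)) (bernoulli_pmf (1 - up_prob \<beta>1 \<beta>2 x y))"
    if "(x, y) \<in> Q_dom \<phi> \<psi>" "\<not> low \<alpha> (x, y)" "\<not> upp \<gamma> (x, y)" for x y
  proof -
    have "0 < real x powr \<beta>1" using that(1) by (simp add: Q_dom_def)
    then have "0 < real x powr \<beta>1 + real y powr \<beta>2" by (simp add: add_pos_nonneg)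
    then have "real x powr \<beta>1 / (real x powr \<beta>1 + real y powr \<beta>2) = 1 - up_prob \<beta>1 \<beta>2 x y"
      by (simp add: up_prob_def field_simps)
    then show ?thesis using int[OF that(1)] that by (simp add: K_def kernel_def)
  qed
  have K_low: "K (x, y) = return_pmf (x, y + 1)" if "(x, y) \<in> Q_dom \<phi> \<psi>" "low \<alpha> (x, y)" for x y
    using int[OF that(1)] lower[OF that(1)] that by (simp add: K_def kernel_def)
  have K_upp: "K (x, y) = return_pmf (x + 1, y)" if "(x, y) \<in> Q_dom \<phi> \<psi>" "upp \<gamma> (x, y)" "\<not> low \<alpha> (x, y)" for x y
    using int[OF that(1)] lower[OF that(1)] upper[OF that(1)] that by (simp add: K_def kernel_def)
  have Q: "u \<in> Q_dom \<phi> \<psi>" if "u \<in> A" for u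
    using that[unfolded A_def mem_Collect_eq]
  proof (induction rule: rtrancl_induct)
    case (step u v)
    then have uA: "u \<in> A" by (simp add: A_def)
    obtain x y where u: "u = (x, y)" by (cases u)
    with step have Q: "(x, y) \<in> Q_dom \<phi> \<psi>" and v: "v \<in> set_pmf (K (x, y))" by auto
    have excl: "\<not> (low \<alpha> (x, y) \<and> upp \<gamma> (x, y))" using model(2)[OF uA] lower[OF Q] upper[OF Q] u by simp
    have r: "(x + 1, y) \<in> Q_dom \<phi> \<psi>" if "\<not> low \<alpha> (x, y)"
      using Q that order_trans[OF _ mono(2)] by (auto simp: Q_dom_def low_def \<phi>_def)
    have up: "(x, y + 1) \<in> Q_dom \<phi> \<psi>" if "\<not> upp \<gamma> (x, y)"
      using Q that by (auto simp: Q_dom_def upp_def \<psi>_def)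
    show ?case
      using v K_interior[OF Q] K_low[OF Q] K_upp[OF Q] excl r up
      by (cases "low \<alpha> (x, y)"; cases "upp \<gamma> (x, y)") (auto split: if_splits)
  qed (rule model(1))
  have excl: "\<not> (low \<alpha> u \<and> upp \<gamma> u)" if "u \<in> A" for u
    using model(2)[OF that] Q[OF that] lower[of "fst u" "snd u"] upper[of "fst u" "snd u"] by simp
  interpret markov_chain M K z Z by standard (rule model(3))
  have "reflected_walk M K z Z A \<alpha> \<gamma> \<beta>1 \<beta>2"
  proof
    show "z \<in> A" by (simp add: A_def)
    show "set_pmf (K u) \<subseteq> A" if "u \<in> A" for u using closed that by blast
    show "\<not> (low \<alpha> u \<and> upp \<gamma> u)" if "u \<in> A" for u using excl that .
    fix x y assume A: "(x, y) \<in> A"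
    note xy = Q[OF A]
    show "1 \<le> x" "1 \<le> y" "real x powr \<alpha> \<le> real y" "real y \<le> real x powr \<gamma>"
      using xy by (auto simp: Q_dom_def \<phi>_def \<psi>_def)
    show "low \<alpha> (x, y) \<Longrightarrow> K (x, y) = return_pmf (x, y + 1)" by (rule K_low[OF xy])
    show "upp \<gamma> (x, y) \<Longrightarrow> K (x, y) = return_pmf (x + 1, y)" using K_upp[OF xy] excl[OF A] by blast
    show "\<not> low \<alpha> (x, y) \<Longrightarrow> \<not> upp \<gamma> (x, y) \<Longrightarrow>
      K (x, y) = map_pmf (\<lambda>right. if right then (x + 1, y) else (x, y + 1)) (bernoulli_pmf (1 - up_prob \<beta>1 \<beta>2 x y))"
      by (rule K_interior[OF xy])
  qed (use par in auto)
  then show ?thesis by (intro that) (simp add: K_def \<phi>_def[abs_def] \<psi>_def[abs_def])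
qed

section \<open>The dichotomy\<close>

lemma (in prob_space) prob_add_eq_1:
  assumes "{\<omega>\<in>space M. P \<omega>} \<in> events" "{\<omega>\<in>space M. Q \<omega>} \<in> events"
    and "AE \<omega> in M. P \<omega> \<or> Q \<omega>" "AE \<omega> in M. \<not> (P \<omega> \<and> Q \<omega>)"
  shows "\<P>(\<omega> in M. P \<omega>) + \<P>(\<omega> in M. Q \<omega>) = 1"
proof -
  have "prob {\<omega>\<in>space M. Q \<omega>} = prob (space M - {\<omega>\<in>space M. P \<omega>})"
  proof (rule finite_measure_eq_AE)
    show "AE \<omega> in M. \<omega> \<in> {\<omega>\<in>space M. Q \<omega>} \<longleftrightarrow> \<omega> \<in> space M - {\<omega>\<in>space M. P \<omega>}"
      using assms(3,4) AE_space by eventually_elim auto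
  qed (use assms in auto)
  then show ?thesis using prob_compl[OF assms(1)] by simp
qed

lemma eventually_le_of_limsup:
  fixes f :: "nat \<Rightarrow> real"
  assumes "limsup (\<lambda>t. ereal (f t)) = ereal l"
  shows "eventually (\<lambda>t. f t \<le> l + 1) sequentially"
proof -
  have "limsup (\<lambda>t. ereal (f t)) < ereal (l + 1)" using assms by simp
  then have "eventually (\<lambda>t. ereal (f t) < ereal (l + 1)) sequentially" by (rule Limsup_lessD)
  then show ?thesis by (rule eventually_mono) simp
qed

context reflected_walk begin

lemma events_measurable [measurable]:
  "{\<omega>\<in>space M. (\<lambda>t. Z t \<omega>) \<in> A_event a k} \<in> events"
  "{\<omega>\<in>space M. (\<lambda>t. Z t \<omega>) \<in> At_event a k} \<in> events"
  "{\<omega>\<in>space M. (\<lambda>t. Z t \<omega>) \<in> B_event a} \<in> events"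
  "{\<omega>\<in>space M. (\<lambda>t. Z t \<omega>) \<in> E_event k} \<in> events"
  unfolding A_event_def At_event_def B_event_def E_event_def mem_Collect_eq frequently_sequentially
  by measurable

text \<open>
  The two boundaries drift apart, so a path cannot remain at bounded distance from both.
\<close>

lemma not_near_both:
  assumes v: "valid_path s" and "\<alpha> < a" "a \<le> 1"
    and 1: "limsup (\<lambda>t. ereal (real (snd (s t)) - real (fst (s t)) powr \<alpha>)) = ereal k"
    and 2: "eventually (\<lambda>t. real (fst (s t)) powr a - real (snd (s t)) \<le> c) sequentially"
  shows False
proof -
  have "filterlim (\<lambda>x::real. x powr a - x powr \<alpha>) at_top at_top"
    using parameters(1) assms(2) by real_asymp
  then have "eventually (\<lambda>x::real. k + 1 + c + 1 \<le> x powr a - x powr \<alpha>) at_top"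
    by (simp add: filterlim_at_top)
  moreover have "filterlim (\<lambda>t. real (fst (s t))) at_top sequentially"
    using filterlim_compose[OF filterlim_real_sequentially valid_path_tendsto(1)[OF v]] .
  ultimately have "eventually (\<lambda>t. k + 1 + c + 1 \<le> real (fst (s t)) powr a - real (fst (s t)) powr \<alpha>) sequentially"
    by (rule eventually_compose_filterlim)
  with eventually_le_of_limsup[OF 1] 2 have "eventually (\<lambda>t. False) sequentially"
    by eventually_elim simp
  then show False by simp
qed

lemma At_disjoint:
  assumes v: "valid_path s" and \<alpha>: "\<alpha> < 1" and \<gamma>: "1 \<le> \<gamma>"
    and 1: "limsup (\<lambda>t. ereal (real (snd (s t)) - real (fst (s t)) powr \<alpha>)) = ereal k"
    and 2: "limsup (\<lambda>t. ereal (real (fst (s t)) - real (snd (s t)) powr (1 / \<gamma>))) = ereal l"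
  shows False
proof (rule not_near_both[OF v \<alpha> order_refl 1])
  show "eventually (\<lambda>t. real (fst (s t)) powr 1 - real (snd (s t)) \<le> l + 1) sequentially"
    using eventually_le_of_limsup[OF 2]
  proof (rule eventually_mono)
    fix t assume t: "real (fst (s t)) - real (snd (s t)) powr (1 / \<gamma>) \<le> l + 1"
    have "1 \<le> snd (s t)" using valid_path_A[OF v, of t] y_ge_1[of "fst (s t)" "snd (s t)"] by simp
    then have "real (snd (s t)) powr (1 / \<gamma>) \<le> real (snd (s t)) powr 1"
      using \<gamma> by (intro powr_mono) (auto simp: divide_le_eq_1)
    then show "real (fst (s t)) powr 1 - real (snd (s t)) \<le> l + 1" using t by simp
  qed
qed

text \<open>
  Almost every path is reflected infinitely often by one of the boundaries and is therefore caught by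
  it, but not by both.
\<close>

lemma prob_lower_plus_upper:
  assumes "\<alpha> < 1" "real j * \<delta> \<le> 1" "1 < real (j + 1) * \<delta>"
    and Q: "{\<omega>\<in>space M. Q (\<lambda>t. Z t \<omega>)} \<in> events"
    and upper: "AE \<omega> in M. (\<exists>\<^sub>F t in sequentially. upp \<gamma> (Z t \<omega>)) \<longrightarrow> Q (\<lambda>t. Z t \<omega>)"
    and disjoint: "\<And>s. valid_path s \<Longrightarrow>
      limsup (\<lambda>t. ereal (real (snd (s t)) - real (fst (s t)) powr \<alpha>)) = ereal (1 + real j) \<Longrightarrow> \<not> Q s"
  shows "\<P>(\<omega> in M. (\<lambda>t. Z t \<omega>) \<in> A_event \<alpha> (int j + 1)) + \<P>(\<omega> in M. Q (\<lambda>t. Z t \<omega>)) = 1"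
proof (rule prob_add_eq_1)
  show "AE \<omega> in M. (\<lambda>t. Z t \<omega>) \<in> A_event \<alpha> (int j + 1) \<or> Q (\<lambda>t. Z t \<omega>)"
    using AE_frequently_reflected upper AE_lower_limits[OF assms(1-3)]
    by eventually_elim (auto simp: frequently_disj_iff)
  show "AE \<omega> in M. \<not> ((\<lambda>t. Z t \<omega>) \<in> A_event \<alpha> (int j + 1) \<and> Q (\<lambda>t. Z t \<omega>))"
    using AE_valid_path by eventually_elim (use disjoint in \<open>auto simp: A_event_def add.commute\<close>)
qed (use Q in auto)

end

theorem theorem2p5:
  fixes \<beta>1 \<beta>2 \<alpha> \<gamma> :: real
  assumes "1 < \<beta>1" "\<beta>1 < \<beta>2"
    and "0 < \<alpha>" "\<alpha> < alpha_cr \<beta>1 \<beta>2" "alpha_cr \<beta>1 \<beta>2 < \<gamma>"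
  shows "\<exists>k1 k2 :: int.
    \<alpha> / ((\<beta>2 - 1) * (alpha_cr \<beta>1 \<beta>2 - \<alpha>)) < of_int k1 \<and>
    of_int k1 \<le> 1 + \<alpha> / ((\<beta>2 - 1) * (alpha_cr \<beta>1 \<beta>2 - \<alpha>)) \<and>
    1 / ((\<beta>2 - 1) * (\<gamma> - alpha_cr \<beta>1 \<beta>2)) < of_int k2 \<and>
    of_int k2 \<le> 1 + 1 / ((\<beta>2 - 1) * (\<gamma> - alpha_cr \<beta>1 \<beta>2)) \<and>
    (\<forall>z (M :: 'a measure) Z.
       balls_in_bins M (\<lambda>x. real x powr \<alpha>) (\<lambda>x. real x powr \<gamma>) \<beta>1 \<beta>2 z Z \<longrightarrow>
       (\<gamma> < 1 \<longrightarrow>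
          \<P>(\<omega> in M. (\<lambda>t. Z t \<omega>) \<in> A_event \<alpha> k1) + \<P>(\<omega> in M. (\<lambda>t. Z t \<omega>) \<in> B_event \<gamma>) = 1) \<and>
       (\<gamma> = 1 \<longrightarrow>
          \<P>(\<omega> in M. (\<lambda>t. Z t \<omega>) \<in> A_event \<alpha> k1) + \<P>(\<omega> in M. (\<lambda>t. Z t \<omega>) \<in> E_event k2) = 1) \<and>
       (\<gamma> > 1 \<longrightarrow>
          \<P>(\<omega> in M. (\<lambda>t. Z t \<omega>) \<in> A_event \<alpha> k1) + \<P>(\<omega> in M. (\<lambda>t. Z t \<omega>) \<in> At_event \<gamma> k2) = 1))"
proof -
  have "0 < \<beta>2 - 1" "\<beta>2 \<noteq> 1" using assms by auto
  define D1 where "D1 = (\<beta>1 - 1) / \<alpha> - (\<beta>2 - 1)"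
  define D2 where "D2 = (\<beta>2 - 1) / (1 / \<gamma>) - (\<beta>1 - 1)"
  have cr: "(\<beta>2 - 1) * alpha_cr \<beta>1 \<beta>2 = \<beta>1 - 1" using \<open>\<beta>2 \<noteq> 1\<close> by (simp add: alpha_cr_def)
  have "alpha_cr \<beta>1 \<beta>2 < 1" using assms by (simp add: alpha_cr_def divide_less_eq)
  then have \<alpha>1: "\<alpha> < 1" using assms by simp
  have \<gamma>: "0 < \<gamma>" "\<alpha> < \<gamma>" using assms by auto
  have "\<alpha> * D1 = (\<beta>1 - 1) - \<alpha> * (\<beta>2 - 1)" unfolding D1_def using assms(3) by (subst right_diff_distrib) simp
  then have e1: "(\<beta>2 - 1) * (alpha_cr \<beta>1 \<beta>2 - \<alpha>) = \<alpha> * D1"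
    using cr by (simp add: algebra_simps)
  have e2: "(\<beta>2 - 1) * (\<gamma> - alpha_cr \<beta>1 \<beta>2) = D2"
    using cr by (simp only: D2_def right_diff_distrib) simp
  have r1: "\<alpha> / ((\<beta>2 - 1) * (alpha_cr \<beta>1 \<beta>2 - \<alpha>)) = 1 / D1"
    and r2: "1 / ((\<beta>2 - 1) * (\<gamma> - alpha_cr \<beta>1 \<beta>2)) = 1 / D2"
    unfolding e1 e2 using assms(3) by simp_all
  have "0 < \<alpha> * D1" "0 < D2" unfolding e1[symmetric] e2[symmetric] using \<open>0 < \<beta>2 - 1\<close> assms by simp_all
  then have D1: "0 < D1" and D2: "0 < D2" using assms(3) by (auto simp: zero_less_mult_iff)
  define j1 j2 where "j1 = nat \<lfloor>1 / D1\<rfloor>" and "j2 = nat \<lfloor>1 / D2\<rfloor>"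
  have j: "real (nat \<lfloor>1 / D\<rfloor>) \<le> 1 / D" "1 / D < real (nat \<lfloor>1 / D\<rfloor>) + 1" if "0 < D" for D :: real
  proof -
    have "0 \<le> 1 / D" using that by simp
    then show "real (nat \<lfloor>1 / D\<rfloor>) \<le> 1 / D" "1 / D < real (nat \<lfloor>1 / D\<rfloor>) + 1" by linarith+
  qed
  note j1 = j[OF D1, folded j1_def] and j2 = j[OF D2, folded j2_def]
  have jD: "real j1 * D1 \<le> 1" "1 < real (j1 + 1) * D1" "real j2 * D2 \<le> 1" "1 < real (j2 + 1) * D2"
    using j1 j2 D1 D2 by (auto simp: field_simps)
  show ?thesis
    unfolding r1 r2
  proof (rule exI[of _ "int j1 + 1"], rule exI[of _ "int j2 + 1"], intro conjI allI impI)
    fix z and M :: "'a measure" and Z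
    assume model: "balls_in_bins M (\<lambda>x. real x powr \<alpha>) (\<lambda>x. real x powr \<gamma>) \<beta>1 \<beta>2 z Z"
    obtain A where A: "reflected_walk M (kernel (\<lambda>x. real x powr \<alpha>) (\<lambda>x. real x powr \<gamma>) \<beta>1 \<beta>2) z Z A \<alpha> \<gamma> \<beta>1 \<beta>2"
      using balls_in_bins_reflected_walk[OF model] assms \<gamma> by auto
    interpret W: reflected_walk M "kernel (\<lambda>x. real x powr \<alpha>) (\<lambda>x. real x powr \<gamma>) \<beta>1 \<beta>2" z Z A \<alpha> \<gamma> \<beta>1 \<beta>2 by (rule A)
    note swapped = W.swapped
    have W\<delta>: "W.\<delta> = D1" unfolding W.\<delta>_def D1_def ..
    have S\<delta>: "reflected_walk.\<delta> (1 / \<gamma>) \<beta>2 \<beta>1 = D2" unfolding reflected_walk.\<delta>_def[OF swapped] D2_def ..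
    note W_prob = W.prob_lower_plus_upper[OF \<alpha>1, unfolded W\<delta>, OF jD(1,2)]
    have low_swap: "low (1 / \<gamma>) (prod.swap u) \<longleftrightarrow> upp \<gamma> u" for u
      using powr_le_iff_le_powr[of "1 / \<gamma>" "real (snd u + 1)" "real (fst u)"] \<gamma>(1)
      unfolding low_def upp_def case_prod_beta not_le[symmetric] by (simp add: add.commute)
    {
      assume \<gamma>1: "\<gamma> < 1"
      have fast: "\<beta>1 - 1 < \<gamma> * (\<beta>2 - 1)" using D2 by (simp add: D2_def mult.commute)
      show "\<P>(\<omega> in M. (\<lambda>t. Z t \<omega>) \<in> A_event \<alpha> (int j1 + 1)) + \<P>(\<omega> in M. (\<lambda>t. Z t \<omega>) \<in> B_event \<gamma>) = 1"
      proof (rule W_prob[OF _ W.AE_upper_limits[OF \<gamma>1 fast]], simp, rule notI)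
        fix s assume s: "W.valid_path s" "limsup (\<lambda>t. ereal (real (snd (s t)) - real (fst (s t)) powr \<alpha>)) = ereal (1 + real j1)"
          and "s \<in> B_event \<gamma>"
        then have "limsup (\<lambda>t. ereal (real (fst (s t)) powr \<gamma> - real (snd (s t)))) = ereal 1"
          by (simp add: B_event_def one_ereal_def)
        from W.not_near_both[OF s(1) \<gamma>(2) less_imp_le[OF \<gamma>1] s(2) eventually_le_of_limsup[OF this]] show False .
      qed
    next
      assume \<gamma>1: "\<gamma> = 1"
      then have "1 / \<gamma> = 1" by simp
      from reflected_walk.AE_diagonal_limits[OF swapped this, of j2, unfolded S\<delta> low_swap swap_swap, OF jD(3,4)]
      show "\<P>(\<omega> in M. (\<lambda>t. Z t \<omega>) \<in> A_event \<alpha> (int j1 + 1)) + \<P>(\<omega> in M. (\<lambda>t. Z t \<omega>) \<in> E_event (int j2 + 1)) = 1"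
      proof (rule W_prob[rotated], goal_cases)
        case (1 s)
        then show ?case using W.At_disjoint[of s, OF _ \<alpha>1 eq_refl[OF \<gamma>1[symmetric]]] \<gamma>1 by (auto simp: E_event_def)
      qed simp
    next
      assume \<gamma>1: "1 < \<gamma>"
      then have "1 / \<gamma> < 1" by simp
      from reflected_walk.AE_lower_limits[OF swapped this, of j2, unfolded S\<delta> low_swap, OF jD(3,4)]
      have "AE \<omega> in M. (\<exists>\<^sub>F t in sequentially. upp \<gamma> (Z t \<omega>)) \<longrightarrow> (\<lambda>t. Z t \<omega>) \<in> At_event \<gamma> (int j2 + 1)"
        by (simp add: A_event_def At_event_def)
      then show "\<P>(\<omega> in M. (\<lambda>t. Z t \<omega>) \<in> A_event \<alpha> (int j1 + 1)) + \<P>(\<omega> in M. (\<lambda>t. Z t \<omega>) \<in> At_event \<gamma> (int j2 + 1)) = 1"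
      proof (rule W_prob[rotated], goal_cases)
        case (1 s)
        then show ?case using W.At_disjoint[of s, OF _ \<alpha>1 less_imp_le[OF \<gamma>1]] by (auto simp: At_event_def)
      qed simp
    }
  qed (use j1 j2 in auto)
qed

end
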